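(* Let $d=2$ and consider a two-dimensional random walk with internal states satisfying the basic assumptions (i)–(iv). Then the weak law of large numbers holds for the number of visited sites: for every $\varepsilon>0$, $$P\bigl(|L_2(n)-E_2(n)|>\varepsilon E_2(n)\bigr)\to0\qquad(n\to\infty).$$
   Context: Random walk with internal states (RWwIS). $E=\{1,\dots,s\}$ is a finite set, $d\ge1$ (here $d=2$), and $p_{y,j,k}\ge 0$ ($y\in\mathbb{Z}^d$, $j,k\in E$) satisfy $\sum_{y,k}p_{y,j,k}=1$ for each $j$. The RWwIS is the Markov chain $\xi_n=(\eta_n,\varepsilon_n)$ on $\mathbb{Z}^d\times E$ with $P(\xi_{n+1}=(x',k)\mid \xi_n=(x,j))=p_{x'-x,j,k}$; we start from $\eta_0=0$, the distribution of $\varepsilon_0$ being arbitrary. Put $A_y=(p_{y,j,k})_{j,k}$, $Q=\sum_y A_y$, $M_l=\sum_y y_lA_y$, $\Sigma_{l,m}=\sum_y y_ly_mA_y$, $\underline{1}=(1,\dots,1)^T\in\mathbb{R}^s$. Basic assumptions: (i) the Markov chain $(\varepsilon_n)$ on $E$, whose transition matrix is $Q$, is irreducible and aperiodic; $\mu$ is its unique stationary distribution. (ii) Trivial arithmetic: for $j\in E$ the subgroup of $\mathbb{Z}^d$ generated by all differences $y-y'$ such that for some $n\geq 1$ both $P(\xi_n=(y,j)\mid\xi_0=(0,j))>0$ and $P(\xi_n=(y',j)\mid\xi_0=(0,j))>0$ is $\mathbb{Z}^d$. (iii) Zero mean: $\langle\mu,M_l\underline{1}\rangle=0$ for all $l$.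 (iv) The second moments $\sum_y\|y\|^2A_y$ converge and the covariance matrix $\sigma=(\sigma_{l,m})_{1\le l,m\le d}$, $\sigma_{l,m}=\langle\mu,\Sigma_{l,m}\underline{1}\rangle-\langle\mu,M_l(Q-1)^{-1}M_m\underline{1}\rangle-\langle\mu,M_m(Q-1)^{-1}M_l\underline{1}\rangle$, is nonsingular (positive definite); here $(Q-1)^{-1}M_m\underline{1}$ is the unique vector $v$ with $\langle\mu,v\rangle=0$ and $Qv-v=M_m\underline{1}$. $L_d(n)=\#\{\eta_0,\dots,\eta_n\}$ is the number of distinct sites visited up to $n$ steps, and $E_d(n)$ is its expectation. *)

theory Defs
  imports "HOL-Probability.Probability" "HOL-Computational_Algebra.Group_Closure"
begin

text \<open>
  The lattice is \<open>int ^ 'd\<close>, the set of internal states is the finite type \<open>'e\<close>,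
  and \<open>p y j k\<close> is the probability of jumping by \<open>y\<close> while the internal state changes from
  \<open>j\<close> to \<open>k\<close>.
\<close>

type_synonym ('d, 'e) jump_kernel = "int ^ 'd \<Rightarrow> 'e \<Rightarrow> 'e \<Rightarrow> real"

definition stochastic_kernel :: "('d::finite, 'e::finite) jump_kernel \<Rightarrow> bool" where
  "stochastic_kernel p \<longleftrightarrow>
     (\<forall>y j k. 0 \<le> p y j k) \<and> (\<forall>j. ((\<lambda>(y, k). p y j k) has_sum 1) UNIV)"

text \<open>
  The Markov property is conditioned on the whole past, and only on pasts of positive
  probability, since \<^const>\<open>cond_prob\<close> is 0 otherwise. The law of the initial internal state
  is not constrained.
\<close>

definition rwwis ::
  "'a measure \<Rightarrow> ('d::finite, 'e::finite) jump_kernel \<Rightarrow> (nat \<Rightarrow> 'a \<Rightarrow> (int ^ 'd) \<times> 'e) \<Rightarrow> bool" where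
  "rwwis M p \<xi> \<longleftrightarrow>
     (\<forall>n. \<xi> n \<in> M \<rightarrow>\<^sub>M count_space UNIV) \<and>
     (AE \<omega> in M. fst (\<xi> 0 \<omega>) = 0) \<and>
     (\<forall>n h x j x' k.
        h n = (x, j) \<longrightarrow> \<P>(\<omega> in M. \<forall>i\<le>n. \<xi> i \<omega> = h i) > 0 \<longrightarrow>
        \<P>(\<omega> in M. \<xi> (Suc n) \<omega> = (x', k) \<bar> \<forall>i\<le>n. \<xi> i \<omega> = h i) = p (x' - x) j k)"

definition jump_matrix :: "('d::finite, 'e::finite) jump_kernel \<Rightarrow> int ^ 'd \<Rightarrow> real ^ 'e ^ 'e" where
  "jump_matrix p y = (\<chi> j k. p y j k)"

definition internal_matrix :: "('d::finite, 'e::finite) jump_kernel \<Rightarrow> real ^ 'e ^ 'e" where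
  "internal_matrix p = (\<Sum>\<^sub>\<infinity>y. jump_matrix p y)"

definition first_moment :: "('d::finite, 'e::finite) jump_kernel \<Rightarrow> 'd \<Rightarrow> real ^ 'e ^ 'e" where
  "first_moment p l = (\<Sum>\<^sub>\<infinity>y. of_int (y $ l) *\<^sub>R jump_matrix p y)"

definition second_moment :: "('d::finite, 'e::finite) jump_kernel \<Rightarrow> 'd \<Rightarrow> 'd \<Rightarrow> real ^ 'e ^ 'e" where
  "second_moment p l m = (\<Sum>\<^sub>\<infinity>y. of_int (y $ l * y $ m) *\<^sub>R jump_matrix p y)"

definition ones :: "real ^ 'e::finite" where
  "ones = (\<chi> j. 1)"

text \<open>
  Powers are taken with respect to \<open>**\<close>; the operator \<open>^\<close> on vectors of vectors is the
  entrywise power.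
\<close>

primrec matrix_power :: "real ^ 'e ^ 'e \<Rightarrow> nat \<Rightarrow> real ^ 'e ^ 'e::finite" where
  "matrix_power A 0 = mat 1"
| "matrix_power A (Suc n) = matrix_power A n ** A"

definition irreducible_chain :: "real ^ 'e ^ 'e::finite \<Rightarrow> bool" where
  "irreducible_chain Q \<longleftrightarrow> (\<forall>j k. \<exists>n. matrix_power Q n $ j $ k > 0)"

definition aperiodic_chain :: "real ^ 'e ^ 'e::finite \<Rightarrow> bool" where
  "aperiodic_chain Q \<longleftrightarrow> (\<forall>j. Gcd {n. n \<ge> 1 \<and> matrix_power Q n $ j $ j > 0} = 1)"

definition stationary_distribution :: "real ^ 'e ^ 'e \<Rightarrow> real ^ 'e::finite \<Rightarrow> bool" where
  "stationary_distribution Q \<mu> \<longleftrightarrow> (\<forall>j. 0 \<le> \<mu> $ j) \<and> (\<Sum>j\<in>UNIV. \<mu> $ j) = 1 \<and> \<mu> v* Q = \<mu>"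

text \<open>
  \<open>nstep p n y j k\<close> is the \<open>n\<close>-step probability of moving from \<open>(0, j)\<close> to \<open>(y, k)\<close>. It is defined
  from the kernel because \<open>(0, j)\<close> may have probability 0 as an initial state of a given walk.
\<close>

primrec nstep :: "('d::finite, 'e::finite) jump_kernel \<Rightarrow> nat \<Rightarrow> ('d, 'e) jump_kernel" where
  "nstep p 0 = (\<lambda>y j k. if y = 0 \<and> j = k then 1 else 0)"
| "nstep p (Suc n) = (\<lambda>y j k. \<Sum>\<^sub>\<infinity>(z, i). nstep p n z j i * p (y - z) i k)"

definition trivial_arithmetic :: "('d::finite, 'e::finite) jump_kernel \<Rightarrow> bool" where
  "trivial_arithmetic p \<longleftrightarrow>
     (\<forall>j. group_closure {y - y' | y y'. \<exists>n\<ge>1. nstep p n y j j > 0 \<and> nstep p n y' j j > 0} = UNIV)"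

definition zero_mean :: "('d::finite, 'e::finite) jump_kernel \<Rightarrow> real ^ 'e \<Rightarrow> bool" where
  "zero_mean p \<mu> \<longleftrightarrow> (\<forall>l. \<mu> \<bullet> (first_moment p l *v ones) = 0)"

definition second_moments_converge :: "('d::finite, 'e::finite) jump_kernel \<Rightarrow> bool" where
  "second_moments_converge p \<longleftrightarrow>
     (\<lambda>y. (norm (\<chi> l. real_of_int (y $ l)))\<^sup>2 *\<^sub>R jump_matrix p y) summable_on UNIV"

text \<open>The vector \<open>(Q - 1)\<^sup>-\<^sup>1 M\<^sub>m 1\<close>; \<open>Q - 1\<close> is only invertible on the vectors orthogonal to \<open>\<mu>\<close>.\<close>

definition corrector :: "('d::finite, 'e::finite) jump_kernel \<Rightarrow> real ^ 'e \<Rightarrow> 'd \<Rightarrow> real ^ 'e" where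
  "corrector p \<mu> m =
     (THE v. \<mu> \<bullet> v = 0 \<and> internal_matrix p *v v - v = first_moment p m *v ones)"

definition covariance :: "('d::finite, 'e::finite) jump_kernel \<Rightarrow> real ^ 'e \<Rightarrow> real ^ 'd ^ 'd" where
  "covariance p \<mu> = (\<chi> l m.
     \<mu> \<bullet> (second_moment p l m *v ones)
     - \<mu> \<bullet> (first_moment p l *v corrector p \<mu> m)
     - \<mu> \<bullet> (first_moment p m *v corrector p \<mu> l))"

definition visited_sites :: "(nat \<Rightarrow> 'a \<Rightarrow> 's \<times> 'e) \<Rightarrow> nat \<Rightarrow> 'a \<Rightarrow> nat" where
  "visited_sites \<xi> n \<omega> = card ((\<lambda>i. fst (\<xi> i \<omega>)) ` {0..n})"

definition expected_visited :: "'a measure \<Rightarrow> (nat \<Rightarrow> 'a \<Rightarrow> 's \<times> 'e) \<Rightarrow> nat \<Rightarrow> real" where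
  "expected_visited M \<xi> n = (\<integral>\<omega>. real (visited_sites \<xi> n \<omega>) \<partial>M)"

end

theory Submission
  imports Defs "HOL-Real_Asymp.Real_Asymp"
begin

text \<open>
The number of visited sites equals the number of times \<open>i \<le> n\<close> whose site is not visited again during
\<open>(i, n]\<close>. Let \<open>escape a j\<close> be the probability that a walk with internal state \<open>j\<close> does not return to
its site within \<open>a\<close> steps, \<open>g a\<close> its average under the stationary law, \<open>S n\<close> the sum of \<open>g a\<close> over
\<open>a \<le> n\<close> and \<open>A n = S n / (n + 1)\<close>. Since the internal chain forgets its initial state, the expected
range is asymptotically \<open>S n\<close>, for every initial law. By Chebyshev's inequality it is enough that the second
moment is at most \<open>(1 + o(1)) (S n)\<^sup>2\<close>.

\<^bold>\<open>Second moment.\<close> If \<open>i < k\<close> are both times of last visits, then the site of time \<open>i\<close> is avoided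
during \<open>(i, k]\<close> and the site of time \<open>k\<close> during \<open>(k, n]\<close>. The Markov property at time \<open>k\<close>, after a
window of fixed length in which the internal state mixes, bounds the probability of this by
\<open>(1 + \<delta>) g (k - i) g (n - k)\<close> up to a shift by the length of the window (\<open>square_range_le\<close>). What
remains is \<open>2 \<Sum> g a g b\<close> over \<open>a + b \<le> n\<close>, and this is at most \<open>(1 + o(1)) (S n)\<^sup>2\<close> as soon as \<open>A\<close>
varies slowly, that is, \<open>A n \<le> (1 + o(1)) A (r n)\<close> for every fixed \<open>r\<close> (\<open>self_convolution_le\<close>).

\<^bold>\<open>Slow variation\<close> (\<open>site_rate_slow\<close>). As \<open>A\<close> is decreasing, it has a limit, and a positive limit makes
the claim trivial. Let the limit be 0. Write \<open>u\<^sub>k(j, i)\<close> for the probability of being at the starting site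
in state \<open>i\<close> after \<open>k\<close> steps from state \<open>j\<close>, \<open>G\<^sub>N\<close> for the sum of \<open>u\<^sub>k\<close> over \<open>k \<le> N\<close>, and \<open>A\<^sub>i\<close> for the
average of \<open>escape a i\<close> over \<open>a \<le> n\<close>. Summing the last-exit decomposition of the starting site over
time gives, up to constants close to 1, \<open>\<Sum>\<^sub>i G\<^sub>N(j, i) A\<^sub>i(N) = 1\<close>. The bound \<open>u\<^sub>k \<le> C / (k + 1)\<close> makes \<open>G\<^sub>N\<close>
change by a bounded amount when \<open>N\<close> is multiplied by a constant; as \<open>A\<^sub>i \<rightarrow> 0\<close>, it follows that
\<open>\<Sum>\<^sub>i G\<^sub>N(j, i) (A\<^sub>i(n) - A\<^sub>i(N)) \<rightarrow> 0\<close> for \<open>N = r n\<close>, where all terms are nonnegative. Finally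
\<open>G\<^sub>N(i, i) \<ge> \<mu>\<^sub>i / A N\<close>, because the expected number of visits to a site in state \<open>i\<close> is at most
\<open>G\<^sub>N(i, i)\<close> times the probability of visiting it. Taking \<open>j = i\<close> shows \<open>A n - A N = o(A N)\<close>.

\<^bold>\<open>The bound \<open>u\<^sub>k \<le> C / (k + 1)\<close>\<close> (\<open>return_prob_bound\<close>) is the place where the dimension enters. Trivial
arithmetic provides two linearly independent vectors that are differences of loops of equal duration. So in a
block of steps of fixed length, from any internal state and with a probability bounded below, the walk
makes a fair choice between two end points that differ by the first vector, or by the second. After \<open>m\<close>
blocks the position contains of order \<open>m\<close> independent coin flips in each of two independent
directions, which spreads its law so that no point has a mass above \<open>C / m\<close>.
\<close>

section \<open>Coin flips in two independent directions\<close>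

text \<open>
The factor \<open>2 * n + 1\<close> instead of the asymptotically right \<open>pi * n\<close> makes the estimate inductive:
passing from \<open>n\<close> to \<open>n + 1\<close> multiplies the left side by \<open>4 (2n + 1) (2n + 3) / (n + 1)\<^sup>2 < 16\<close>.
\<close>

lemma central_binomial_square_le: "real (2 * n + 1) * (real ((2 * n) choose n))\<^sup>2 \<le> 16 ^ n"
proof (induction n)
  case (Suc n)
  have a: "Suc (2 * n + 1) * (2 * n + 1 choose n) = (Suc (2 * n + 1) choose Suc n) * Suc n"
    by (rule Suc_times_binomial_eq)
  have b: "Suc (2 * n) * (2 * n choose n) = (Suc (2 * n) choose Suc n) * Suc n"
    by (rule Suc_times_binomial_eq)
  have "(2 * n + 1 choose n) = (Suc (2 * n) choose Suc n)"
    using binomial_symmetric[of n "2 * n + 1"] by simp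
  with a b have "(Suc (2 * n + 1) choose Suc n) * Suc n = 2 * (2 * n + 1) * (2 * n choose n)"
    by (auto simp: algebra_simps)
  then have "real ((Suc (2 * n + 1) choose Suc n) * Suc n) = real (2 * (2 * n + 1) * (2 * n choose n))"
    by (simp only:)
  then have e: "real (2 * Suc n choose Suc n) * (real n + 1) = 2 * (2 * real n + 1) * real (2 * n choose n)"
    unfolding of_nat_mult by (simp del: binomial_Suc_Suc add: algebra_simps)
  let ?c = "real (2 * Suc n choose Suc n)" and ?b = "real (2 * n choose n)"
  have "(real (2 * Suc n + 1) * ?c\<^sup>2) * (real n + 1)\<^sup>2 = (2 * real n + 3) * (?c * (real n + 1))\<^sup>2"
    by (simp add: power2_eq_square algebra_simps)
  also have "\<dots> = 4 * (2 * real n + 3) * (2 * real n + 1) * (real (2 * n + 1) * ?b\<^sup>2)"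
    unfolding e by (simp add: power2_eq_square algebra_simps)
  also have "\<dots> \<le> 4 * (2 * real n + 3) * (2 * real n + 1) * 16 ^ n"
    by (intro mult_left_mono Suc.IH) auto
  also have "\<dots> \<le> (16 * (real n + 1)\<^sup>2) * 16 ^ n"
    by (intro mult_right_mono) (auto simp: power2_eq_square algebra_simps)
  also have "\<dots> = 16 ^ Suc n * (real n + 1)\<^sup>2" by simp
  finally show ?case by (rule mult_right_le_imp_le) auto
qed simp

lemma binomial_square_le: "real (n + 1) * (real (n choose k))\<^sup>2 \<le> 4 ^ n"
proof -
  have "real (n + 1) * (real (n choose (n div 2)))\<^sup>2 \<le> 4 ^ n"
  proof (cases "even n")
    case True
    then obtain m where n: "n = 2 * m" by auto
    show ?thesis using central_binomial_square_le[of m] by (simp add: n power_mult)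
  next
    case False
    then obtain m where n: "n = 2 * m + 1" by (auto elim: oddE)
    have "(Suc n choose Suc m) = 2 * (n choose m)"
      using binomial_symmetric[of m "n"] by (simp add: n)
    then have e: "real (2 * Suc m choose Suc m) = 2 * real (n choose m)" by (simp add: n)
    have "real (n + 1) * (2 * real (n choose m))\<^sup>2 \<le> real (2 * Suc m + 1) * (2 * real (n choose m))\<^sup>2"
      by (intro mult_right_mono) (auto simp: n)
    also have "\<dots> \<le> 16 ^ Suc m"
      using central_binomial_square_le[of "Suc m"] unfolding e by simp
    also have "\<dots> = 4 * 4 ^ n" by (simp add: n power_mult power_add)
    finally show ?thesis by (simp add: n power_mult_distrib)
  qed
  moreover have "(real (n choose k))\<^sup>2 \<le> (real (n choose (n div 2)))\<^sup>2"
    using binomial_maximum[of n k] by (intro power_mono) auto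
  ultimately show ?thesis
    by (meson mult_left_mono of_nat_0_le_iff order_trans)
qed

text \<open>
Averages a function of site and internal state over a fair choice between staying and a displacement by \<open>v\<close>.
\<close>

definition coin_flip :: "'v::ab_group_add \<Rightarrow> ('v \<times> 'e \<Rightarrow> real) \<Rightarrow> 'v \<times> 'e \<Rightarrow> real" where
  "coin_flip v f s = (f s + f (fst s + v, snd s)) / 2"

lemma coin_flips_expand:
  fixes v :: "int ^ 'd::finite"
  shows "(coin_flip v ^^ p) f (x, j) = (\<Sum>s\<le>p. real (p choose s) / 2 ^ p * f (x + of_nat s *s v, j))"
proof (induction p arbitrary: x)
  case (Suc p)
  define g where "g s = f (x + of_nat s *s v, j)" for s
  have sh: "f (x + v + of_nat s *s v, j) = g (Suc s)" for s
    by (simp add: g_def algebra_simps)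
  have "(\<Sum>s\<le>Suc p. real (Suc p choose s) * g s)
      = (g 0 + (\<Sum>s\<le>p. real (p choose Suc s) * g (Suc s))) + (\<Sum>s\<le>p. real (p choose s) * g (Suc s))"
    by (subst sum.atMost_Suc_shift) (simp add: algebra_simps sum.distrib)
  also have "g 0 + (\<Sum>s\<le>p. real (p choose Suc s) * g (Suc s)) = (\<Sum>s\<le>Suc p. real (p choose s) * g s)"
    by (subst sum.atMost_Suc_shift) simp
  also have "\<dots> = (\<Sum>s\<le>p. real (p choose s) * g s)" by simp
  finally have e: "(\<Sum>s\<le>Suc p. real (Suc p choose s) * g s)
      = (\<Sum>s\<le>p. real (p choose s) * g s) + (\<Sum>s\<le>p. real (p choose s) * g (Suc s))" .
  have "(coin_flip v ^^ Suc p) f (x, j)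
      = ((\<Sum>s\<le>p. real (p choose s) / 2 ^ p * g s) + (\<Sum>s\<le>p. real (p choose s) / 2 ^ p * g (Suc s))) / 2"
    by (simp add: coin_flip_def Suc.IH sh g_def[symmetric])
  also have "\<dots> = (\<Sum>s\<le>Suc p. real (Suc p choose s) * g s) / 2 ^ Suc p"
    unfolding e by (simp add: sum_divide_distrib[symmetric] add_divide_distrib algebra_simps)
  finally show ?case unfolding g_def sum_divide_distrib by (simp only: times_divide_eq_left)
qed simp

lemma binomial_weight_le: "real (p choose s) / 2 ^ p \<le> 1 / sqrt (real p + 1)"
proof -
  have four: "(2 ^ p)\<^sup>2 = (4::real) ^ p" by (simp add: power2_eq_square flip: power_mult_distrib)
  have "(sqrt (real p + 1) * real (p choose s))\<^sup>2 \<le> (2 ^ p)\<^sup>2"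
    using binomial_square_le[of p s] unfolding four power_mult_distrib[of "sqrt (real p + 1)"]
    by (simp add: add.commute)
  then have "sqrt (real p + 1) * real (p choose s) \<le> 2 ^ p"
    by (rule power2_le_imp_le) simp
  then show ?thesis by (simp add: field_simps)
qed

text \<open>
After \<open>p\<close> flips in direction \<open>v\<close> and \<open>q\<close> flips in direction \<open>w\<close> a site determines both numbers of
displacements, so its mass is at most a product of two binomial weights, that is, at most
\<open>1 / sqrt ((p + 1) (q + 1))\<close>. Bounding the geometric mean by the arithmetic mean separates \<open>p\<close> from
\<open>q\<close>, which later allows one to treat the random numbers of flips one at a time.
\<close>

lemma two_coin_flips_le:
  fixes v w :: "int ^ 'd::finite"
  assumes indep: "\<And>s t s' t' :: nat. of_nat s *s v + of_nat t *s w = of_nat s' *s v + of_nat t' *s w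
                    \<Longrightarrow> s = s' \<and> t = t'"
  shows "(coin_flip v ^^ p) ((coin_flip w ^^ q) (\<lambda>s. of_bool (s = (0, k)))) (x, j)
           \<le> (1 / (real p + 1) + 1 / (real q + 1)) / 2"
proof -
  let ?b = "\<lambda>p s. real (p choose s) / 2 ^ p"
  let ?at = "\<lambda>s t. x + of_nat s *s v + of_nat t *s w = 0 \<and> j = k"
  have ex: "(coin_flip v ^^ p) ((coin_flip w ^^ q) (\<lambda>s. of_bool (s = (0, k)))) (x, j)
      = (\<Sum>s\<le>p. \<Sum>t\<le>q. ?b p s * ?b q t * of_bool (?at s t))"
    by (simp add: coin_flips_expand sum_distrib_left algebra_simps)
  show ?thesis
  proof (cases "\<exists>s t. ?at s t")
    case True
    then obtain s0 t0 where at: "?at s0 t0" by blast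
    have iff: "?at s t \<longleftrightarrow> s = s0 \<and> t = t0" for s t
    proof
      assume "?at s t"
      then have "x + (of_nat s *s v + of_nat t *s w) = x + (of_nat s0 *s v + of_nat t0 *s w)"
        using at by (simp add: add.assoc)
      then show "s = s0 \<and> t = t0" by (intro indep) simp
    qed (use at in simp)
    have "(\<Sum>s\<le>p. \<Sum>t\<le>q. ?b p s * ?b q t * of_bool (?at s t))
        = (\<Sum>s\<le>p. ?b p s * of_bool (s = s0)) * (\<Sum>t\<le>q. ?b q t * of_bool (t = t0))"
      unfolding iff by (simp add: sum_product of_bool_conj algebra_simps)
    also have "\<dots> = (if s0 \<le> p then ?b p s0 else 0) * (if t0 \<le> q then ?b q t0 else 0)"
      by (simp add: of_bool_def if_distrib cong: if_cong)
    also have "\<dots> \<le> 1 / sqrt (real p + 1) * (1 / sqrt (real q + 1))"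
      by (intro mult_mono) (auto simp: binomial_weight_le)
    also have "\<dots> \<le> ((1 / sqrt (real p + 1))\<^sup>2 + (1 / sqrt (real q + 1))\<^sup>2) / 2"
      using sum_squares_bound[of "1 / sqrt (real p + 1)" "1 / sqrt (real q + 1)"] by simp
    also have "\<dots> = (1 / (real p + 1) + 1 / (real q + 1)) / 2"
      by (simp add: power_divide)
    finally show ?thesis unfolding ex .
  next
    case False
    then have z: "of_bool (?at s t) = (0::real)" for s t by auto
    have "(\<Sum>s\<le>p. \<Sum>t\<le>q. ?b p s * ?b q t * of_bool (?at s t)) = 0"
      by (intro sum.neutral ballI) (simp only: z mult_zero_right)
    then show ?thesis unfolding ex by simp
  qed
qed

lemma coin_flip_commute: "coin_flip v (coin_flip w f) = coin_flip w (coin_flip v f)"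
  by (auto simp: coin_flip_def fun_eq_iff field_simps)

lemma coin_flip_commute_funpow: "coin_flip v ((coin_flip w ^^ n) f) = (coin_flip w ^^ n) (coin_flip v f)"
  by (induction n) (simp_all add: coin_flip_commute[of v w])

section \<open>The averaging operator of a walk with internal states\<close>

text \<open>
Expectations over the walk are expressed by powers of the operator \<open>avg\<close>, which averages a
function of the state over one step. Only bounded functions occur; \<open>bdd\<close> with its introduction rules
takes care of integrability.
\<close>

locale internal_walk =
  fixes jump :: "'e::finite \<Rightarrow> ('v::{ab_group_add, countable} \<times> 'e) pmf"
begin

definition step :: "'v \<times> 'e \<Rightarrow> ('v \<times> 'e) pmf" where
  "step s = map_pmf (\<lambda>(y, k). (fst s + y, k)) (jump (snd s))"

definition avg :: "('v \<times> 'e \<Rightarrow> real) \<Rightarrow> 'v \<times> 'e \<Rightarrow> real" where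
  "avg f s = measure_pmf.expectation (step s) f"

definition bdd :: "('v \<times> 'e \<Rightarrow> real) \<Rightarrow> bool" where
  "bdd f \<longleftrightarrow> (\<exists>B. \<forall>s. \<bar>f s\<bar> \<le> B)"

named_theorems bdd_intros

lemma bddI: "(\<And>s. \<bar>f s\<bar> \<le> B) \<Longrightarrow> bdd f"
  by (auto simp: bdd_def)

lemma bdd_integrable: "bdd f \<Longrightarrow> integrable (measure_pmf q) f"
  unfolding bdd_def by (elim exE) (rule measure_pmf.integrable_const_bound, auto simp del: split_paired_All)

lemma bdd_const [bdd_intros]: "bdd (\<lambda>s. c)"
  by (rule bddI) auto

lemma bdd_of_bool [bdd_intros]: "bdd (\<lambda>s. of_bool (P s))"
  by (rule bddI[of _ 1]) auto

lemma bdd_internal [bdd_intros]: "bdd (\<lambda>s. g (snd s))"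
proof (rule bddI)
  fix s :: "'v \<times> 'e"
  show "\<bar>g (snd s)\<bar> \<le> (\<Sum>j\<in>UNIV. \<bar>g j\<bar>)"
    by (rule member_le_sum[where f = "\<lambda>j. \<bar>g j\<bar>"]) auto
qed

lemma bdd_add [bdd_intros]: "bdd f \<Longrightarrow> bdd g \<Longrightarrow> bdd (\<lambda>s. f s + g s)"
proof -
  assume "bdd f" "bdd g"
  then obtain B C where "\<And>s. \<bar>f s\<bar> \<le> B" "\<And>s. \<bar>g s\<bar> \<le> C" by (auto simp: bdd_def)
  then have "\<bar>f s + g s\<bar> \<le> B + C" for s by (meson abs_triangle_ineq add_mono order_trans)
  then show ?thesis by (rule bddI)
qed

lemma bdd_mult [bdd_intros]: "bdd f \<Longrightarrow> bdd g \<Longrightarrow> bdd (\<lambda>s. f s * g s)"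
proof -
  assume "bdd f" "bdd g"
  then obtain B C where "\<And>s. \<bar>f s\<bar> \<le> B" "\<And>s. \<bar>g s\<bar> \<le> C" by (auto simp: bdd_def)
  then have "\<bar>f s * g s\<bar> \<le> B * C" for s
    unfolding abs_mult by (intro mult_mono) (auto intro: order_trans[OF abs_ge_zero])
  then show ?thesis by (rule bddI)
qed

lemma bdd_diff [bdd_intros]: "bdd f \<Longrightarrow> bdd g \<Longrightarrow> bdd (\<lambda>s. f s - g s)"
  using bdd_add[OF _ bdd_mult[OF bdd_const[of "-1"]], of f g] by simp

lemma bdd_sum [bdd_intros]: "(\<And>i. i \<in> I \<Longrightarrow> bdd (f i)) \<Longrightarrow> bdd (\<lambda>s. \<Sum>i\<in>I. f i s)"
  by (induction I rule: infinite_finite_induct) (auto intro!: bdd_intros)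

lemma avg_abs_le:
  assumes "\<And>s. \<bar>f s\<bar> \<le> B" shows "\<bar>avg f s\<bar> \<le> B"
proof -
  have "\<bar>avg f s\<bar> \<le> measure_pmf.expectation (step s) (\<lambda>s. \<bar>f s\<bar>)"
    unfolding avg_def by (rule integral_abs_bound)
  also have "\<dots> \<le> measure_pmf.expectation (step s) (\<lambda>s. B)"
    using assms order_trans[OF abs_ge_zero assms]
    by (intro integral_mono bdd_integrable) (auto intro!: bddI[of _ B])
  finally show ?thesis by simp
qed

lemma bdd_avg [bdd_intros]: "bdd f \<Longrightarrow> bdd (avg f)"
  using avg_abs_le unfolding bdd_def by metis

lemma bdd_avg_pow [bdd_intros]: "bdd f \<Longrightarrow> bdd ((avg ^^ n) f)"
  by (induction n) (auto intro: bdd_intros)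

lemma avg_const [simp]: "avg (\<lambda>_. c) s = c"
  by (simp add: avg_def)

lemma avg_add: "bdd f \<Longrightarrow> bdd g \<Longrightarrow> avg (\<lambda>s. f s + g s) s = avg f s + avg g s"
  by (simp add: avg_def bdd_integrable)

lemma avg_diff: "bdd f \<Longrightarrow> bdd g \<Longrightarrow> avg (\<lambda>s. f s - g s) s = avg f s - avg g s"
  by (simp add: avg_def bdd_integrable)

lemma avg_mult: "avg (\<lambda>s. c * f s) s = c * avg f s"
  by (simp add: avg_def)

lemma avg_sum: "(\<And>i. i \<in> I \<Longrightarrow> bdd (f i)) \<Longrightarrow> avg (\<lambda>s. \<Sum>i\<in>I. f i s) s = (\<Sum>i\<in>I. avg (f i) s)"
  by (simp add: avg_def bdd_integrable)

lemma avg_mono: "bdd f \<Longrightarrow> bdd g \<Longrightarrow> (\<And>s. f s \<le> g s) \<Longrightarrow> avg f s \<le> avg g s"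
  unfolding avg_def by (intro integral_mono bdd_integrable)

lemma avg_nonneg: "(\<And>s. 0 \<le> f s) \<Longrightarrow> 0 \<le> avg f s"
  unfolding avg_def by (rule Bochner_Integration.integral_nonneg)

lemma avg_ge_point:
  assumes "bdd f" "\<And>s. 0 \<le> f s"
  shows "pmf (step s) t * f t \<le> avg f s"
proof -
  have "avg (\<lambda>u. f t * of_bool (u = t)) s \<le> avg f s"
    using assms by (intro avg_mono bdd_intros) auto
  also have "avg (\<lambda>u. f t * of_bool (u = t)) s = f t * pmf (step s) t"
  proof -
    have "(\<lambda>u. of_bool (u = t) :: real) = indicator {t}" by (auto simp: indicator_def)
    then show ?thesis unfolding avg_mult by (simp add: avg_def pmf.rep_eq)
  qed
  finally show ?thesis by (simp add: mult.commute)
qed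

lemma avg_pow_add: "bdd f \<Longrightarrow> bdd g \<Longrightarrow> (avg ^^ n) (\<lambda>s. f s + g s) = (\<lambda>s. (avg ^^ n) f s + (avg ^^ n) g s)"
  by (induction n) (simp, rule ext, simp add: avg_add bdd_avg_pow)

lemma avg_pow_mult: "(avg ^^ n) (\<lambda>s. c * f s) = (\<lambda>s. c * (avg ^^ n) f s)"
  by (induction n) (simp, rule ext, simp add: avg_mult)

lemma avg_pow_const [simp]: "(avg ^^ n) (\<lambda>_. c) = (\<lambda>_. c)"
  by (induction n) auto

lemma avg_pow_sum: "(\<And>i. i \<in> I \<Longrightarrow> bdd (f i)) \<Longrightarrow>
    (avg ^^ n) (\<lambda>s. \<Sum>i\<in>I. f i s) = (\<lambda>s. \<Sum>i\<in>I. (avg ^^ n) (f i) s)"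
  by (induction n) (simp, rule ext, simp add: avg_sum bdd_avg_pow)

lemma avg_pow_mono: "bdd f \<Longrightarrow> bdd g \<Longrightarrow> (\<And>s. f s \<le> g s) \<Longrightarrow> (avg ^^ n) f s \<le> (avg ^^ n) g s"
  by (induction n arbitrary: s) (auto intro!: avg_mono bdd_avg_pow)

lemma avg_pow_nonneg: "(\<And>s. 0 \<le> f s) \<Longrightarrow> 0 \<le> (avg ^^ n) f s"
  by (induction n arbitrary: s) (auto intro!: avg_nonneg)

lemma avg_pow_le_const: "bdd f \<Longrightarrow> (\<And>s. f s \<le> c) \<Longrightarrow> (avg ^^ n) f s \<le> c"
  using avg_pow_mono[of f "\<lambda>_. c" n s] by (simp add: bdd_const)

text \<open>
Dominated convergence; it replaces sums over all sites by limits of sums over finitely many sites.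
\<close>

lemma avg_pow_tendsto:
  assumes "\<And>s. (\<lambda>n. f n s) \<longlonglongrightarrow> g s" "\<And>n s. \<bar>f n s\<bar> \<le> B"
  shows "(\<lambda>n. (avg ^^ k) (f n) s) \<longlonglongrightarrow> (avg ^^ k) g s"
proof (induction k arbitrary: s)
  case (Suc k)
  have b: "\<bar>(avg ^^ k) (f n) s\<bar> \<le> B" for n s
    by (induction k arbitrary: s) (auto intro: assms avg_abs_le)
  have "(\<lambda>n. measure_pmf.expectation (step s) ((avg ^^ k) (f n)))
      \<longlonglongrightarrow> measure_pmf.expectation (step s) ((avg ^^ k) g)"
    by (rule integral_dominated_convergence[where w = "\<lambda>_. B"]) (auto intro: Suc b simp del: split_paired_All)
  then show ?case by (simp add: avg_def[of _ s])
qed (simp add: assms)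

lemma step_shift: "step (x + z, j) = map_pmf (\<lambda>t. (fst t + z, snd t)) (step (x, j))"
  unfolding step_def by (auto simp: pmf.map_comp algebra_simps intro!: map_pmf_cong)

lemma avg_shift: "avg f (x + z, j) = avg (\<lambda>t. f (fst t + z, snd t)) (x, j)"
  by (simp add: avg_def step_shift)

lemma avg_pow_shift: "(avg ^^ n) f (x + z, j) = (avg ^^ n) (\<lambda>t. f (fst t + z, snd t)) (x, j)"
proof (induction n arbitrary: x j)
  case (Suc n)
  have "(avg ^^ n) f (fst t + z, snd t) = (avg ^^ n) (\<lambda>t. f (fst t + z, snd t)) t" for t
    using Suc[of "fst t" "snd t"] by simp
  then show ?case by (simp add: avg_shift)
qed simp

lemma avg_pow_internal: "(avg ^^ n) (\<lambda>s. f (snd s)) (x, j) = (avg ^^ n) (\<lambda>s. f (snd s)) (0, j)"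
  using avg_pow_shift[of n "\<lambda>s. f (snd s)" 0 x j] by simp

text \<open>
The transition operator of the internal chain; the base site 0 is arbitrary by translation invariance.
\<close>

definition internal_avg :: "('e \<Rightarrow> real) \<Rightarrow> 'e \<Rightarrow> real" where
  "internal_avg f j = avg (\<lambda>s. f (snd s)) (0, j)"

lemma avg_internal: "avg (\<lambda>s. f (snd s)) = (\<lambda>s. internal_avg f (snd s))"
  using avg_pow_internal[of 1 f] by (auto simp: internal_avg_def fun_eq_iff)

lemma avg_pow_of_internal: "(avg ^^ n) (\<lambda>s. f (snd s)) = (\<lambda>s. (internal_avg ^^ n) f (snd s))"
  by (induction n) (auto simp: avg_internal)

text \<open>
The probability that a walk from \<open>s\<close> is not at the site \<open>x\<close> at any of the times \<open>0, \<dots>, n\<close>.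
\<close>

primrec avoid :: "nat \<Rightarrow> 'v \<Rightarrow> 'v \<times> 'e \<Rightarrow> real" where
  "avoid 0 x = (\<lambda>s. of_bool (fst s \<noteq> x))"
| "avoid (Suc n) x = (\<lambda>s. of_bool (fst s \<noteq> x) * avg (avoid n x) s)"

lemma bdd_avoid [bdd_intros]: "bdd (avoid n x)"
  by (induction n) (auto intro!: bdd_intros)

lemma avoid_nonneg: "0 \<le> avoid n x s"
  by (induction n arbitrary: s) (auto intro!: avg_nonneg mult_nonneg_nonneg)

lemma avoid_le_1: "avoid n x s \<le> 1"
proof (induction n arbitrary: s)
  case (Suc n)
  have "avg (avoid n x) s \<le> avg (\<lambda>_. 1) s"
    by (intro avg_mono bdd_intros Suc)
  then show ?case by simp
qed auto

lemma avoid_self [simp]: "avoid n (fst s) s = 0"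
  by (cases n) auto

lemma avoid_Suc_le: "avoid (Suc n) x s \<le> avoid n x s"
proof (induction n arbitrary: s)
  case 0
  have "avg (avoid 0 x) s \<le> 1" using avg_mono[of "avoid 0 x" "\<lambda>_. 1" s]
    by (auto intro: bdd_intros simp: bdd_of_bool)
  then show ?case by auto
next
  case (Suc n)
  have "avg (avoid (Suc n) x) s \<le> avg (avoid n x) s"
    by (intro avg_mono bdd_intros Suc)
  then show ?case by auto
qed

lemma avoid_shift: "avoid n (x + z) (y + z, j) = avoid n x (y, j)"
proof (induction n arbitrary: y j)
  case (Suc n)
  have "(\<lambda>t. avoid n (x + z) (fst t + z, snd t)) = avoid n x"
    by (auto simp: Suc fun_eq_iff)
  then show ?case by (simp add: avg_shift)
qed simp

text \<open>
The probability of no return to the starting site at the times \<open>1, \<dots>, n\<close>; the case \<open>Suc n\<close>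
averages over the first step, which is why \<open>avoid\<close> carries the index \<open>n\<close> there.
\<close>

primrec escape :: "nat \<Rightarrow> 'e \<Rightarrow> real" where
  "escape 0 j = 1"
| "escape (Suc n) j = avg (avoid n 0) (0, j)"

lemma avg_avoid: "avg (avoid n (fst s)) s = escape (Suc n) (snd s)"
proof -
  have "(\<lambda>t. avoid n (fst s) (fst t + fst s, snd t)) = avoid n 0"
    using avoid_shift[of n 0 "fst s"] by (auto simp: fun_eq_iff)
  then show ?thesis using avg_shift[of "avoid n (fst s)" 0 "fst s" "snd s"] by (cases s) simp
qed

lemma escape_nonneg: "0 \<le> escape n j"
  by (cases n) (auto intro!: avg_nonneg avoid_nonneg)

lemma escape_le_1: "escape n j \<le> 1"
  using avg_mono[of "avoid (n - 1) 0" "\<lambda>_. 1" "(0, j)"]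
  by (cases n) (auto simp: avoid_le_1 intro: bdd_intros)

lemma escape_Suc_le: "escape (Suc n) j \<le> escape n j"
proof (cases n)
  case 0
  then show ?thesis using escape_le_1[of 1 j] by simp
next
  case (Suc m)
  have "avg (avoid (Suc m) 0) (0, j) \<le> avg (avoid m 0) (0, j)"
    by (intro avg_mono bdd_intros avoid_Suc_le)
  then show ?thesis by (simp add: Suc)
qed

lemma escape_antimono: "decseq (\<lambda>n. escape n j)"
  by (intro decseq_SucI escape_Suc_le)

text \<open>
The quantity \<open>u\<^sub>n(j, i)\<close> of the introduction; its partial sums form \<open>green\<close>.
\<close>

definition return_prob :: "nat \<Rightarrow> 'e \<Rightarrow> 'e \<Rightarrow> real" where
  "return_prob n j i = (avg ^^ n) (\<lambda>s. of_bool (s = (0, i))) (0, j)"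

lemma return_prob_nonneg: "0 \<le> return_prob n j i"
  unfolding return_prob_def by (intro avg_pow_nonneg) auto

definition green :: "nat \<Rightarrow> 'e \<Rightarrow> 'e \<Rightarrow> real" where
  "green n j i = (\<Sum>k\<le>n. return_prob k j i)"


section \<open>Last exits and first visits\<close>

text \<open>
A walk that visits \<open>x\<close> by time \<open>n\<close> does so for a last time, at some time \<open>k\<close>, and from then on does
not return to \<open>x\<close> during the remaining \<open>n - k\<close> steps.
\<close>

lemma last_exit:
  "1 - avoid n x s = (\<Sum>k\<le>n. (avg ^^ k) (\<lambda>t. of_bool (fst t = x) * escape (n - k) (snd t)) s)"
proof (induction n arbitrary: s)
  case (Suc n)
  let ?f = "\<lambda>m t. of_bool (fst t = x) * escape m (snd t)"
  have b: "bdd (?f m)" for m by (intro bdd_intros)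
  have "(\<Sum>k\<le>Suc n. (avg ^^ k) (?f (Suc n - k)) s)
      = ?f (Suc n) s + (\<Sum>k\<le>n. (avg ^^ Suc k) (?f (n - k)) s)"
    by (subst sum.atMost_Suc_shift) simp
  also have "(\<Sum>k\<le>n. (avg ^^ Suc k) (?f (n - k)) s) = avg (\<lambda>s. \<Sum>k\<le>n. (avg ^^ k) (?f (n - k)) s) s"
    by (subst avg_sum) (auto intro!: bdd_intros)
  also have "(\<lambda>s. \<Sum>k\<le>n. (avg ^^ k) (?f (n - k)) s) = (\<lambda>s. 1 - avoid n x s)"
    using Suc by auto
  also have "avg \<dots> s = 1 - avg (avoid n x) s"
    by (subst avg_diff) (auto intro!: bdd_intros)
  finally show ?case using avg_avoid[of n s] by (auto simp del: escape.simps sum.atMost_Suc funpow.simps)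
qed auto

text \<open>
The starting site itself is certainly visited, so its last-exit decomposition has total mass 1.
\<close>

lemma renewal: "(\<Sum>k\<le>n. \<Sum>i\<in>UNIV. return_prob k j i * escape (n - k) i) = 1"
proof -
  have e: "of_bool (fst t = 0) * f (snd t) = (\<Sum>i\<in>UNIV. f i * of_bool (t = (0, i)))"
    for t :: "'v \<times> 'e" and f :: "'e \<Rightarrow> real"
    by (cases t) (auto simp: if_distrib of_bool_def cong: if_cong)
  have "1 = 1 - avoid n 0 (0, j)" using avoid_self[of n "(0, j)"] by simp
  also have "\<dots> = (\<Sum>k\<le>n. \<Sum>i\<in>UNIV. escape (n - k) i * return_prob k j i)"
    unfolding last_exit e return_prob_def
    by (subst avg_pow_sum) (auto intro!: bdd_intros simp: avg_pow_mult)
  finally show ?thesis by (simp add: mult.commute)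
qed

text \<open>
The expected number of sites visited at the times \<open>0, \<dots>, n\<close>, computed backwards: the starting site is
new with respect to the rest of the path exactly if the walk does not return to it (see
\<open>paths_site_count\<close> below).
\<close>

primrec mean_range :: "nat \<Rightarrow> 'v \<times> 'e \<Rightarrow> real" where
  "mean_range 0 = (\<lambda>s. 1)"
| "mean_range (Suc n) = (\<lambda>s. escape (Suc n) (snd s) + avg (mean_range n) s)"

lemma bdd_mean_range [bdd_intros]: "bdd (mean_range n)"
  by (induction n) (auto intro!: bdd_intros)

lemma mean_range_eq: "mean_range n s = (\<Sum>k\<le>n. (avg ^^ k) (\<lambda>t. escape (n - k) (snd t)) s)"
proof (induction n arbitrary: s)
  case (Suc n)
  let ?f = "\<lambda>m t. escape m (snd t) :: real"
  have "(\<Sum>k\<le>Suc n. (avg ^^ k) (?f (Suc n - k)) s)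
      = ?f (Suc n) s + (\<Sum>k\<le>n. (avg ^^ Suc k) (?f (n - k)) s)"
    by (subst sum.atMost_Suc_shift) simp
  also have "(\<Sum>k\<le>n. (avg ^^ Suc k) (?f (n - k)) s) = avg (\<lambda>s. \<Sum>k\<le>n. (avg ^^ k) (?f (n - k)) s) s"
    by (subst avg_sum) (auto intro!: bdd_intros)
  also have "(\<lambda>s. \<Sum>k\<le>n. (avg ^^ k) (?f (n - k)) s) = mean_range n"
    using Suc by auto
  finally show ?case by simp
qed auto

text \<open>
The expected range is the sum over all sites of the probability of visiting them; finite sets of sites
suffice here and avoid infinite sums.
\<close>

lemma sum_visit_le_mean_range:
  assumes "finite X" shows "(\<Sum>x\<in>X. 1 - avoid n x s) \<le> mean_range n s"
proof (induction n arbitrary: s)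
  case 0
  have "(\<Sum>x\<in>X. 1 - avoid 0 x s) = (\<Sum>x\<in>X. if x = fst s then 1 else 0)"
    by (intro sum.cong) auto
  also have "\<dots> \<le> 1" using assms by simp
  finally show ?case by simp
next
  case (Suc n)
  have e: "1 - avoid (Suc n) x s = (1 - avg (avoid n x) s) + of_bool (x = fst s) * avg (avoid n x) s" for x
    by auto
  have "(\<Sum>x\<in>X. 1 - avoid (Suc n) x s)
      = (\<Sum>x\<in>X. 1 - avg (avoid n x) s) + (\<Sum>x\<in>X. of_bool (x = fst s) * avg (avoid n x) s)"
    unfolding e sum.distrib ..
  also have "(\<Sum>x\<in>X. of_bool (x = fst s) * avg (avoid n x) s)
      = (\<Sum>x\<in>X. if x = fst s then avg (avoid n (fst s)) s else 0)"
    by (intro sum.cong) auto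
  also have "\<dots> \<le> escape (Suc n) (snd s)"
    using assms escape_nonneg[of "Suc n" "snd s"] by (simp only: sum.delta avg_avoid) auto
  also have "(\<Sum>x\<in>X. 1 - avg (avoid n x) s) = avg (\<lambda>t. \<Sum>x\<in>X. 1 - avoid n x t) s"
    by (subst avg_sum) (auto intro!: bdd_intros sum.cong simp: avg_diff bdd_const bdd_avoid)
  also have "\<dots> \<le> avg (mean_range n) s"
    using Suc by (intro avg_mono bdd_intros)
  finally show ?case by simp
qed

text \<open>
Decomposing at the first visit to the state \<open>(x, i)\<close>: the visits from then on number at most
\<open>green n i i\<close> in expectation, and a visit to \<open>(x, i)\<close> is a visit to \<open>x\<close>.
\<close>

lemma visits_le:
  "(\<Sum>k\<le>n. (avg ^^ k) (\<lambda>t. of_bool (t = (x, i))) s) \<le> (1 - avoid n x s) * green n i i"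
proof (induction n arbitrary: s)
  case 0
  show ?case by (auto simp: green_def return_prob_def)
next
  case (Suc n)
  let ?f = "\<lambda>t. of_bool (t = (x, i)) :: real"
  show ?case
  proof (cases "s = (x, i)")
    case True
    have "(avg ^^ k) ?f (x, i) = return_prob k i i" for k
      using avg_pow_shift[of k ?f 0 x i] unfolding return_prob_def by (simp add: prod_eq_iff)
    then show ?thesis unfolding True green_def using avoid_self[of "Suc n" "(x, i)"] by simp
  next
    case False
    have g: "green n i i \<le> green (Suc n) i i" "0 \<le> green (Suc n) i i"
      by (auto simp: green_def return_prob_nonneg intro!: sum_nonneg add_nonneg_nonneg)
    have "(\<Sum>k\<le>Suc n. (avg ^^ k) ?f s) = (\<Sum>k\<le>n. (avg ^^ Suc k) ?f s)"
      using False by (subst sum.atMost_Suc_shift) simp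
    also have "\<dots> = avg (\<lambda>s. \<Sum>k\<le>n. (avg ^^ k) ?f s) s"
      by (subst avg_sum) (auto intro!: bdd_intros)
    also have "\<dots> \<le> avg (\<lambda>s. green n i i * (1 - avoid n x s)) s"
      using Suc by (intro avg_mono bdd_intros) (simp add: mult.commute)
    also have "\<dots> = green n i i * (1 - avg (avoid n x) s)"
      unfolding avg_mult by (subst avg_diff) (auto intro!: bdd_intros)
    also have "\<dots> \<le> green (Suc n) i i * (1 - avoid (Suc n) x s)"
    proof (intro mult_mono g)
      have "avg (avoid n x) s \<le> avg (\<lambda>_. 1) s" "0 \<le> avg (avoid n x) s"
        by (intro avg_mono bdd_intros avoid_le_1 avg_nonneg avoid_nonneg)+
      then show "1 - avg (avoid n x) s \<le> 1 - avoid (Suc n) x s" by auto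
      show "0 \<le> 1 - avg (avoid n x) s" using \<open>avg (avoid n x) s \<le> avg (\<lambda>_. 1) s\<close> by simp
    qed
    finally show ?thesis by (simp add: mult.commute)
  qed
qed

text \<open>
Summing the previous bound over all sites counts the times with internal state \<open>i\<close> on the left and the
expected range on the right. This is the source of the lower bound for \<open>green n i i\<close>.
\<close>

lemma internal_visits_le:
  "(\<Sum>k\<le>n. (avg ^^ k) (\<lambda>t. of_bool (snd t = i)) s) \<le> green n i i * mean_range n s"
proof -
  define X :: "nat \<Rightarrow> 'v set" where "X m = {x. to_nat x \<le> m}" for m
  have fin: "finite (X m)" for m
    unfolding X_def using finite_vimageI[OF finite_atMost inj_to_nat] by (simp add: vimage_def)
  define f :: "nat \<Rightarrow> 'v \<times> 'e \<Rightarrow> real" where "f m t = (\<Sum>x\<in>X m. of_bool (t = (x, i)))" for m t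
  have f: "f m t = of_bool (snd t = i \<and> fst t \<in> X m)" for m t
  proof -
    have "f m t = (\<Sum>x\<in>X m. if x = fst t then of_bool (snd t = i) else 0)"
      unfolding f_def by (intro sum.cong) (auto simp: prod_eq_iff)
    then show ?thesis using fin[of m] by simp
  qed
  have lim: "(\<lambda>m. f m t) \<longlonglongrightarrow> of_bool (snd t = i)" for t
  proof (rule tendsto_eventually, rule eventually_sequentiallyI[of "to_nat (fst t)"])
    show "f m t = of_bool (snd t = i)" if "m \<ge> to_nat (fst t)" for m
      using that by (auto simp: f X_def)
  qed
  have "(\<lambda>m. \<Sum>k\<le>n. (avg ^^ k) (f m) s) \<longlonglongrightarrow> (\<Sum>k\<le>n. (avg ^^ k) (\<lambda>t. of_bool (snd t = i)) s)"
    by (intro tendsto_sum avg_pow_tendsto[where B = 1] lim) (auto simp: f)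
  moreover have "(\<Sum>k\<le>n. (avg ^^ k) (f m) s) \<le> green n i i * mean_range n s" for m
  proof -
    have "(\<Sum>k\<le>n. (avg ^^ k) (f m) s) = (\<Sum>k\<le>n. \<Sum>x\<in>X m. (avg ^^ k) (\<lambda>t. of_bool (t = (x, i))) s)"
      unfolding f_def by (subst avg_pow_sum) (auto intro!: bdd_intros)
    also have "\<dots> = (\<Sum>x\<in>X m. \<Sum>k\<le>n. (avg ^^ k) (\<lambda>t. of_bool (t = (x, i))) s)"
      by (rule sum.swap)
    also have "\<dots> \<le> (\<Sum>x\<in>X m. (1 - avoid n x s) * green n i i)"
      by (intro sum_mono visits_le)
    also have "\<dots> = green n i i * (\<Sum>x\<in>X m. 1 - avoid n x s)"
      by (subst sum_distrib_left) (simp add: mult.commute)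
    also have "\<dots> \<le> green n i i * mean_range n s"
      by (intro mult_left_mono sum_visit_le_mean_range fin)
        (auto simp: green_def return_prob_nonneg intro!: sum_nonneg)
    finally show ?thesis .
  qed
  ultimately show ?thesis by (intro LIMSEQ_le_const2[where a = "green n i i * mean_range n s"]) auto
qed

end

section \<open>The number of sites on a random path\<close>

lemma sum_truncated_shift_le:
  fixes f :: "nat \<Rightarrow> real"
  assumes "\<And>l. 0 \<le> f l"
  shows "(\<Sum>l\<le>n. f (l - p)) \<le> real p * f 0 + (\<Sum>l\<le>n. f l)"
proof -
  have "(\<Sum>l\<le>n. f (l - p)) \<le> (\<Sum>l\<le>n + p. f (l - p))"
    by (intro sum_mono2) (auto simp: assms)
  also have "{..n + p} = {..<p} \<union> {0 + p..n + p}" by auto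
  also have "(\<Sum>l\<in>{..<p} \<union> {0 + p..n + p}. f (l - p)) = (\<Sum>l<p. f (l - p)) + (\<Sum>l=0 + p..n + p. f (l - p))"
    by (rule sum.union_disjoint) auto
  also have "(\<Sum>l=0 + p..n + p. f (l - p)) = (\<Sum>l\<le>n. f l)"
    unfolding sum.shift_bounds_cl_nat_ivl by (simp add: atLeast0AtMost)
  also have "(\<Sum>l<p. f (l - p)) = real p * f 0" by simp
  finally show ?thesis .
qed

text \<open>
Both sides sum \<open>g a * g b\<close> over \<open>a + b \<le> n\<close>.
\<close>

lemma sum_convolution:
  fixes g :: "nat \<Rightarrow> real"
  shows "(\<Sum>l\<le>n. \<Sum>k\<le>l. g (l - k) * g k) = (\<Sum>a\<le>n. g a * (\<Sum>b\<le>n - a. g b))"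
proof (induction n)
  case (Suc n)
  have "(\<Sum>a\<le>Suc n. g a * (\<Sum>b\<le>Suc n - a. g b)) = (\<Sum>a\<le>n. g a * (\<Sum>b\<le>Suc (n - a). g b)) + g (Suc n) * g 0"
    by (simp add: Suc_diff_le)
  also have "\<dots> = (\<Sum>a\<le>n. g a * (\<Sum>b\<le>n - a. g b)) + ((\<Sum>a\<le>n. g (Suc n - a) * g a) + g 0 * g (Suc n))"
    by (simp add: Suc_diff_le distrib_left sum.distrib algebra_simps)
  also have "\<dots> = (\<Sum>l\<le>Suc n. \<Sum>k\<le>l. g (l - k) * g k)"
    by (simp add: Suc)
  finally show ?case by simp
qed simp

definition site_count :: "('v \<times> 'e) list \<Rightarrow> nat" where
  "site_count l = card (fst ` set l)"

lemma site_count_Cons: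
  "site_count (s # l) = (if fst s \<in> fst ` set l then 0 else 1) + site_count l"
  by (simp add: site_count_def insert_absorb)

context internal_walk
begin

primrec paths :: "nat \<Rightarrow> 'v \<times> 'e \<Rightarrow> ('v \<times> 'e) list pmf" where
  "paths 0 s = return_pmf [s]"
| "paths (Suc n) s = map_pmf ((#) s) (bind_pmf (step s) (paths n))"

lemma nn_integral_step: "bdd f \<Longrightarrow> (\<And>s. 0 \<le> f s) \<Longrightarrow> (\<integral>\<^sup>+t. ennreal (f t) \<partial>step s) = ennreal (avg f s)"
  unfolding avg_def by (intro nn_integral_eq_integral bdd_integrable) auto

lemma paths_avoid: "(\<integral>\<^sup>+l. of_bool (x \<notin> fst ` set l) \<partial>paths n s) = ennreal (avoid n x s)"
proof (induction n arbitrary: s)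
  case (Suc n)
  have "(\<integral>\<^sup>+l. of_bool (x \<notin> fst ` set l) \<partial>paths (Suc n) s)
      = (\<integral>\<^sup>+t. \<integral>\<^sup>+l. of_bool (fst s \<noteq> x) * of_bool (x \<notin> fst ` set l) \<partial>paths n t \<partial>step s)"
    by (auto intro!: nn_integral_cong)
  also have "\<dots> = of_bool (fst s \<noteq> x) * (\<integral>\<^sup>+t. ennreal (avoid n x t) \<partial>step s)"
    by (simp add: nn_integral_cmult Suc)
  also have "\<dots> = ennreal (avoid (Suc n) x s)"
    by (simp add: nn_integral_step bdd_avoid avoid_nonneg)
  finally show ?case .
qed simp

lemma mean_range_nonneg: "0 \<le> mean_range n s"
  by (induction n arbitrary: s) (auto intro!: avg_nonneg add_nonneg_nonneg escape_nonneg simp del: escape.simps)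

lemma paths_site_count: "(\<integral>\<^sup>+l. ennreal (site_count l) \<partial>paths n s) = ennreal (mean_range n s)"
proof (induction n arbitrary: s)
  case (Suc n)
  have e: "ennreal (real (site_count (s # l))) = of_bool (fst s \<notin> fst ` set l) + ennreal (site_count l)" for l
    by (auto simp: site_count_Cons ennreal_plus simp flip: ennreal_1)
  have "(\<integral>\<^sup>+l. ennreal (site_count l) \<partial>paths (Suc n) s)
      = (\<integral>\<^sup>+t. (\<integral>\<^sup>+l. of_bool (fst s \<notin> fst ` set l) + ennreal (site_count l) \<partial>paths n t) \<partial>step s)"
    by (simp add: e)
  also have "\<dots> = (\<integral>\<^sup>+t. ennreal (avoid n (fst s) t) \<partial>step s) + (\<integral>\<^sup>+t. ennreal (mean_range n t) \<partial>step s)"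
    by (simp add: nn_integral_add Suc paths_avoid)
  also have "\<dots> = ennreal (mean_range (Suc n) s)"
    using escape_nonneg[of "Suc n" "snd s"]
    by (simp add: nn_integral_step bdd_avoid avoid_nonneg bdd_mean_range mean_range_nonneg avg_avoid
        ennreal_plus avg_nonneg del: escape.simps)
  finally show ?case .
qed (simp add: site_count_def)

text \<open>
An upper bound for the expected number of sites on a path on the event that the path avoids \<open>x\<close>. It is
not the exact value: when the first site is not revisited, only avoidance of that site is kept.
\<close>

primrec avoid_range :: "nat \<Rightarrow> 'v \<Rightarrow> 'v \<times> 'e \<Rightarrow> real" where
  "avoid_range 0 x = (\<lambda>s. of_bool (fst s \<noteq> x))"
| "avoid_range (Suc n) x = (\<lambda>s. of_bool (fst s \<noteq> x) * (escape (Suc n) (snd s) + avg (avoid_range n x) s))"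

lemma bdd_avoid_range [bdd_intros]: "bdd (avoid_range n x)"
  by (induction n) (auto intro!: bdd_intros simp del: escape.simps)

lemma avoid_range_nonneg: "0 \<le> avoid_range n x s"
  by (induction n arbitrary: s)
    (auto intro!: avg_nonneg add_nonneg_nonneg mult_nonneg_nonneg escape_nonneg simp del: escape.simps)

lemma avoid_range_le: "avoid_range n x s \<le> real n + 1"
proof (induction n arbitrary: s)
  case (Suc n)
  have "avg (avoid_range n x) s \<le> avg (\<lambda>_. real n + 1) s"
    by (intro avg_mono bdd_intros Suc)
  moreover have "0 \<le> avg (avoid_range n x) s" by (intro avg_nonneg avoid_range_nonneg)
  ultimately show ?case using escape_le_1[of "Suc n" "snd s"] escape_nonneg[of "Suc n" "snd s"]
    by (auto simp del: escape.simps)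
qed auto

lemma bdd_avg_avoid_range [bdd_intros]: "bdd (\<lambda>s. avg (avoid_range n (fst s)) s)"
  by (rule bddI, rule avg_abs_le[of _ "real n + 1"]) (simp add: avoid_range_nonneg avoid_range_le)

lemma paths_avoid_range:
  "(\<integral>\<^sup>+l. of_bool (x \<notin> fst ` set l) * ennreal (site_count l) \<partial>paths n s) \<le> ennreal (avoid_range n x s)"
proof (induction n arbitrary: s)
  case 0
  show ?case by (auto simp: site_count_def)
next
  case (Suc n)
  have e: "of_bool (x \<notin> fst ` set (s # l)) * ennreal (real (site_count (s # l)))
      \<le> of_bool (fst s \<noteq> x) * (of_bool (fst s \<notin> fst ` set l) + of_bool (x \<notin> fst ` set l) * ennreal (site_count l))" for l
    by (auto simp: site_count_Cons ennreal_plus)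
  have "(\<integral>\<^sup>+l. of_bool (x \<notin> fst ` set l) * ennreal (site_count l) \<partial>paths (Suc n) s)
      \<le> (\<integral>\<^sup>+t. (\<integral>\<^sup>+l. of_bool (fst s \<noteq> x) * (of_bool (fst s \<notin> fst ` set l)
          + of_bool (x \<notin> fst ` set l) * ennreal (site_count l)) \<partial>paths n t) \<partial>step s)"
    unfolding paths.simps nn_integral_map_pmf nn_integral_bind_pmf by (intro nn_integral_mono e)
  also have "\<dots> = of_bool (fst s \<noteq> x) * ((\<integral>\<^sup>+t. ennreal (avoid n (fst s) t) \<partial>step s)
      + (\<integral>\<^sup>+t. (\<integral>\<^sup>+l. of_bool (x \<notin> fst ` set l) * ennreal (site_count l) \<partial>paths n t) \<partial>step s))"
    by (simp add: nn_integral_add nn_integral_cmult paths_avoid)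
  also have "\<dots> \<le> of_bool (fst s \<noteq> x) * ((\<integral>\<^sup>+t. ennreal (avoid n (fst s) t) \<partial>step s)
      + (\<integral>\<^sup>+t. ennreal (avoid_range n x t) \<partial>step s))"
    by (intro mult_left_mono add_left_mono nn_integral_mono Suc) auto
  also have "\<dots> = ennreal (avoid_range (Suc n) x s)"
    using escape_nonneg[of "Suc n" "snd s"]
    by (simp add: nn_integral_step bdd_avoid avoid_nonneg bdd_avoid_range avoid_range_nonneg avg_avoid
        ennreal_plus avg_nonneg del: escape.simps)
  finally show ?case .
qed

text \<open>
An upper bound for the second moment of the number of sites, from the expansion
\<open>(1 + m)\<^sup>2 = 1 + 2 m + m\<^sup>2\<close> at each step where the first site is not revisited.
\<close>

primrec square_range :: "nat \<Rightarrow> 'v \<times> 'e \<Rightarrow> real" where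
  "square_range 0 = (\<lambda>s. 1)"
| "square_range (Suc n) = (\<lambda>s. escape (Suc n) (snd s) + 2 * avg (avoid_range n (fst s)) s + avg (square_range n) s)"

lemma bdd_square_range [bdd_intros]: "bdd (square_range n)"
  by (induction n) (auto intro!: bdd_intros simp del: escape.simps)

lemma square_range_nonneg: "0 \<le> square_range n s"
  by (induction n arbitrary: s) (auto intro!: avg_nonneg add_nonneg_nonneg escape_nonneg avoid_range_nonneg simp del: escape.simps)

lemma paths_square_range:
  "(\<integral>\<^sup>+l. ennreal ((real (site_count l))\<^sup>2) \<partial>paths n s) \<le> ennreal (square_range n s)"
proof (induction n arbitrary: s)
  case (Suc n)
  have e: "ennreal ((real (site_count (s # l)))\<^sup>2) =
      of_bool (fst s \<notin> fst ` set l) + 2 * (of_bool (fst s \<notin> fst ` set l) * ennreal (site_count l))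
        + ennreal ((real (site_count l))\<^sup>2)" for l
  proof (cases "fst s \<in> fst ` set l")
    case True
    then show ?thesis by (simp add: site_count_Cons)
  next
    case False
    have "(real (site_count (s # l)))\<^sup>2 = 1 + 2 * real (site_count l) + (real (site_count l))\<^sup>2"
      using False by (simp add: site_count_Cons power2_sum)
    then show ?thesis using False by (simp add: ennreal_plus ennreal_mult')
  qed
  have "(\<integral>\<^sup>+l. ennreal ((real (site_count l))\<^sup>2) \<partial>paths (Suc n) s)
      = (\<integral>\<^sup>+t. ennreal (avoid n (fst s) t) \<partial>step s)
        + 2 * (\<integral>\<^sup>+t. (\<integral>\<^sup>+l. of_bool (fst s \<notin> fst ` set l) * ennreal (site_count l) \<partial>paths n t) \<partial>step s)
        + (\<integral>\<^sup>+t. (\<integral>\<^sup>+l. ennreal ((real (site_count l))\<^sup>2) \<partial>paths n t) \<partial>step s)"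
    unfolding paths.simps nn_integral_map_pmf nn_integral_bind_pmf e
    by (simp add: nn_integral_add nn_integral_cmult paths_avoid)
  also have "\<dots> \<le> (\<integral>\<^sup>+t. ennreal (avoid n (fst s) t) \<partial>step s)
        + 2 * (\<integral>\<^sup>+t. ennreal (avoid_range n (fst s) t) \<partial>step s) + (\<integral>\<^sup>+t. ennreal (square_range n t) \<partial>step s)"
    by (intro add_mono mult_left_mono nn_integral_mono Suc paths_avoid_range) auto
  also have "\<dots> = ennreal (square_range (Suc n) s)"
    using escape_nonneg[of "Suc n" "snd s"]
    by (simp add: nn_integral_step bdd_avoid avoid_nonneg bdd_avoid_range avoid_range_nonneg avg_avoid
        bdd_square_range square_range_nonneg ennreal_plus avg_nonneg ennreal_mult' del: escape.simps)
  finally show ?case .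
qed (simp add: site_count_def)

lemma square_range_eq: "square_range n s =
   (\<Sum>k\<le>n. (avg ^^ k) (\<lambda>t. case n - k of 0 \<Rightarrow> 1 | Suc l \<Rightarrow> escape (Suc l) (snd t) + 2 * avg (avoid_range l (fst t)) t) s)"
proof (induction n arbitrary: s)
  case (Suc n)
  let ?f = "\<lambda>m t. (case m of 0 \<Rightarrow> 1 | Suc l \<Rightarrow> escape (Suc l) (snd t) + 2 * avg (avoid_range l (fst t)) t)"
  have b: "bdd (?f m)" for m by (cases m) (auto intro!: bdd_intros simp del: escape.simps)
  have "(\<Sum>k\<le>Suc n. (avg ^^ k) (?f (Suc n - k)) s)
      = ?f (Suc n) s + (\<Sum>k\<le>n. (avg ^^ Suc k) (?f (n - k)) s)"
    by (subst sum.atMost_Suc_shift) simp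
  also have "(\<Sum>k\<le>n. (avg ^^ Suc k) (?f (n - k)) s) = avg (\<lambda>s. \<Sum>k\<le>n. (avg ^^ k) (?f (n - k)) s) s"
    by (subst avg_sum) (auto intro!: bdd_avg_pow b)
  also have "(\<lambda>s. \<Sum>k\<le>n. (avg ^^ k) (?f (n - k)) s) = square_range n"
    using Suc by auto
  finally show ?case by simp
qed auto

text \<open>
The expectation of \<open>f\<close> after \<open>n\<close> steps on the event that \<open>x\<close> is avoided up to then.
\<close>

primrec killed :: "nat \<Rightarrow> 'v \<Rightarrow> ('v \<times> 'e \<Rightarrow> real) \<Rightarrow> 'v \<times> 'e \<Rightarrow> real" where
  "killed 0 x f = (\<lambda>s. of_bool (fst s \<noteq> x) * f s)"
| "killed (Suc n) x f = (\<lambda>s. of_bool (fst s \<noteq> x) * avg (killed n x f) s)"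

lemma bdd_killed [bdd_intros]: "bdd f \<Longrightarrow> bdd (killed n x f)"
  by (induction n) (auto intro!: bdd_intros)

lemma killed_mono: "bdd f \<Longrightarrow> bdd g \<Longrightarrow> (\<And>s. f s \<le> g s) \<Longrightarrow> killed n x f s \<le> killed n x g s"
  by (induction n arbitrary: s) (auto intro!: avg_mono mult_left_mono bdd_killed)

lemma killed_const: "killed n x (\<lambda>_. c) s = c * avoid n x s"
  by (induction n arbitrary: s) (simp_all add: avg_mult[symmetric])

text \<open>
Dropping the avoidance condition during the last \<open>m\<close> steps creates the window in which the internal
state can mix.
\<close>

lemma killed_add_le:
  assumes "bdd f" "\<And>s. 0 \<le> f s"
  shows "killed (n + m) x f s \<le> killed n x ((avg ^^ m) f) s"
proof (induction n arbitrary: s)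
  case 0
  show ?case
  proof (induction m arbitrary: s)
    case (Suc m)
    have "avg (killed (0 + m) x f) s \<le> avg ((avg ^^ m) f) s"
    proof (intro avg_mono bdd_intros assms)
      show "killed (0 + m) x f t \<le> (avg ^^ m) f t" for t
        using Suc[of t] avg_pow_nonneg[of f m t] assms(2)
        by (cases "fst t = x") auto
    qed
    then show ?case by (auto intro: mult_left_mono)
  qed simp
next
  case (Suc n)
  have "avg (killed (n + m) x f) s \<le> avg (killed n x ((avg ^^ m) f)) s"
    by (intro avg_mono bdd_intros assms Suc)
  then show ?case by auto
qed

lemma avoid_range_eq: "avoid_range n x s = (\<Sum>k\<le>n. killed k x (\<lambda>t. escape (n - k) (snd t)) s)"
proof (induction n arbitrary: s)
  case (Suc n)
  let ?f = "\<lambda>m t. escape m (snd t) :: real"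
  have "(\<Sum>k\<le>Suc n. killed k x (?f (Suc n - k)) s)
      = killed 0 x (?f (Suc n)) s + (\<Sum>k\<le>n. killed (Suc k) x (?f (n - k)) s)"
    by (subst sum.atMost_Suc_shift) simp
  also have "(\<Sum>k\<le>n. killed (Suc k) x (?f (n - k)) s)
      = of_bool (fst s \<noteq> x) * avg (\<lambda>s. \<Sum>k\<le>n. killed k x (?f (n - k)) s) s"
    by (subst avg_sum) (auto intro!: bdd_intros simp: sum_distrib_left)
  also have "(\<lambda>s. \<Sum>k\<le>n. killed k x (?f (n - k)) s) = avoid_range n x"
    using Suc by auto
  finally show ?case by (simp add: algebra_simps del: escape.simps)
qed auto

end

section \<open>Convolution squares of slowly varying averages\<close>

lemma decseq_average:
  fixes g :: "nat \<Rightarrow> real"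
  assumes "decseq g" shows "decseq (\<lambda>n. (\<Sum>a\<le>n. g a) / (real n + 1))"
proof (rule decseq_SucI)
  fix n
  have "(\<Sum>a\<le>n. g (Suc n)) \<le> (\<Sum>a\<le>n. g a)"
    using assms by (intro sum_mono) (auto simp: decseq_def)
  then have "(real n + 1) * ((\<Sum>a\<le>n. g a) + g (Suc n)) \<le> (real n + 2) * (\<Sum>a\<le>n. g a)"
    by (simp add: algebra_simps)
  then show "(\<Sum>a\<le>Suc n. g a) / (real (Suc n) + 1) \<le> (\<Sum>a\<le>n. g a) / (real n + 1)"
    by (simp add: field_simps)
qed

lemma sum_rev: "(\<Sum>k\<le>n. f (n - k)) = (\<Sum>k\<le>n. f k)" for n :: nat
  by (rule sum.reindex_bij_witness[of _ "\<lambda>k. n - k" "\<lambda>k. n - k"]) auto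

text \<open>
Slow variation means that \<open>S b\<close> is nearly linear: \<open>S b \<le> (1 + \<eta>) A n (b + 1 + k)\<close> for all \<open>b\<close>,
where \<open>k = n div r\<close> takes care of the small \<open>b\<close>. Used twice, this compares the convolution with the one for
constant \<open>g\<close>, which is half of the square.
\<close>

lemma self_convolution_le:
  fixes g :: "nat \<Rightarrow> real"
  defines "S \<equiv> \<lambda>n. \<Sum>a\<le>n. g a"
  defines "A \<equiv> \<lambda>n. S n / (real n + 1)"
  assumes g: "\<And>n. 0 \<le> g n" and dec: "decseq g"
    and slow: "\<And>r \<eta>. 1 \<le> r \<Longrightarrow> 0 < \<eta> \<Longrightarrow> eventually (\<lambda>n. A n \<le> (1 + \<eta>) * A (r * n)) sequentially"
    and \<epsilon>: "0 < \<epsilon>"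
  shows "eventually (\<lambda>n. (\<Sum>a\<le>n. g a * S (n - a)) \<le> (1 / 2 + \<epsilon>) * (S n)\<^sup>2) sequentially"
proof -
  obtain r :: nat where r: "real r > max 1 (14 / \<epsilon>)" using reals_Archimedean2 by blast
  then have r1: "real r > 1" and r14: "14 / real r \<le> \<epsilon>" using \<epsilon> by (auto simp: field_simps)
  \<comment> \<open>One parameter measures the slow variation and bounds both k / (n + 1) and 1 / (n + 1); the errors add up
to at most 14 times it.\<close>
  define \<eta> where "\<eta> = 1 / real r"
  have \<eta>: "0 < \<eta>" "\<eta> < 1" using r1 by (auto simp: \<eta>_def)
  obtain n0 where n0: "\<And>n. n \<ge> n0 \<Longrightarrow> A n \<le> (1 + \<eta>) * A (2 * r * n)"
    using slow[of "2 * r" \<eta>] r1 \<eta> by (auto simp: eventually_sequentially)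
  have decA: "A m \<le> A n" if "n \<le> m" for m n
    using decseq_average[OF dec] that unfolding A_def S_def decseq_def by blast
  have S0: "0 \<le> S n" for n unfolding S_def by (intro sum_nonneg g)
  have A0: "0 \<le> A n" for n unfolding A_def using S0 by simp
  have SA: "S n = (real n + 1) * A n" for n by (simp add: A_def)
  have "(\<Sum>a\<le>n. g a * S (n - a)) \<le> (1 / 2 + \<epsilon>) * (S n)\<^sup>2" if n: "n \<ge> r * (n0 + 1)" for n
  proof -
    define k where "k = n div r"
    have rp: "r > 0" using r1 by simp
    have k: "k \<ge> n0 + 1" unfolding k_def using n rp by (simp add: less_eq_div_iff_mult_less_eq mult.commute)
    have rk: "r * k \<le> n" "n < r * (k + 1)" using rp unfolding k_def
      by (simp, metis Suc_eq_plus1 dividend_less_times_div add.commute mult_Suc_right)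
    have "r * (k + 1) \<le> 2 * r * k" using k by (simp add: algebra_simps)
    then have nk: "n \<le> 2 * r * k" using rk by linarith
    have Ak: "A k \<le> (1 + \<eta>) * A n"
    proof -
      have "A k \<le> (1 + \<eta>) * A (2 * r * k)" using n0 k by simp
      also have "\<dots> \<le> (1 + \<eta>) * A n" using decA[OF nk] \<eta> by (intro mult_left_mono) auto
      finally show ?thesis .
    qed
    define N where "N = real n + 1"
    define B where "B = (1 + \<eta>) * A n"
    define \<kappa> where "\<kappa> = real k / N"
    have N: "N > 0" by (simp add: N_def)
    have B0: "0 \<le> B" using A0 \<eta> by (simp add: B_def)
    have BN: "B * N = (1 + \<eta>) * S n" using N by (simp add: B_def A_def N_def)
    have kN: "real k = \<kappa> * N" using N by (simp add: \<kappa>_def)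
    have \<kappa>0: "0 \<le> \<kappa>" using N by (simp add: \<kappa>_def)
    have \<kappa>: "\<kappa> \<le> \<eta>"
    proof -
      have "real r * real k \<le> real n" using rk(1) by (metis of_nat_le_iff of_nat_mult)
      then show ?thesis using r1 N by (simp add: \<kappa>_def \<eta>_def N_def field_simps)
    qed
    have N\<eta>: "1 \<le> \<eta> * N"
    proof -
      have "r \<le> n" using n by (simp add: algebra_simps)
      then show ?thesis using r1 by (simp add: \<eta>_def N_def field_simps)
    qed
    have Sb: "S b \<le> B * (real b + 1 + real k)" for b
    proof (cases "k \<le> b")
      case True
      have "S b \<le> (real b + 1) * A k" unfolding SA[of b] by (intro mult_left_mono decA True) simp
      also have "\<dots> \<le> (real b + 1 + real k) * B"
        using Ak A0[of k] B0 unfolding B_def by (intro mult_mono) auto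
      finally show ?thesis by (simp add: mult.commute)
    next
      case False
      have "S b \<le> S k" unfolding S_def using False by (intro sum_mono2) (auto simp: g)
      also have "\<dots> = (real k + 1) * A k" by (rule SA)
      also have "\<dots> \<le> (real b + 1 + real k) * B"
        using Ak A0[of k] B0 unfolding B_def by (intro mult_mono) auto
      finally show ?thesis by (simp add: mult.commute)
    qed
    have sumS: "(\<Sum>a\<le>m. g a * (real (m - a) + 1)) = (\<Sum>b\<le>m. S b)" for m
    proof (induction m)
      case (Suc m)
      have "(\<Sum>a\<le>Suc m. g a * (real (Suc m - a) + 1)) = (\<Sum>a\<le>m. g a * (real (m - a) + 1) + g a) + g (Suc m)"
        by (simp add: Suc_diff_le algebra_simps)
      also have "\<dots> = (\<Sum>b\<le>m. S b) + S (Suc m)" using Suc by (simp add: sum.distrib S_def)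
      finally show ?case by simp
    qed (simp add: S_def)
    \<comment> \<open>The value of the bound for constant g; its main term is half of the square of N.\<close>
    have lin: "(\<Sum>b\<le>n. real b + 1 + real k) = N * (N + 1) / 2 + real k * N"
      unfolding N_def by (induction n) (simp_all add: field_simps)
    have "(\<Sum>a\<le>n. g a * S (n - a)) \<le> (\<Sum>a\<le>n. g a * (B * (real (n - a) + 1 + real k)))"
      by (intro sum_mono mult_left_mono Sb g)
    also have "\<dots> = B * ((\<Sum>a\<le>n. g a * (real (n - a) + 1)) + real k * S n)"
      unfolding S_def by (simp add: sum_distrib_left sum.distrib[symmetric] algebra_simps)
    also have "(\<Sum>a\<le>n. g a * (real (n - a) + 1)) = (\<Sum>b\<le>n. S b)" by (rule sumS)
    also have "B * ((\<Sum>b\<le>n. S b) + real k * S n) \<le> B * (B * (N * (N + 1) / 2 + real k * N) + real k * S n)"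
    proof (intro mult_left_mono add_right_mono B0)
      have "(\<Sum>b\<le>n. S b) \<le> (\<Sum>b\<le>n. B * (real b + 1 + real k))" by (intro sum_mono Sb)
      then show "(\<Sum>b\<le>n. S b) \<le> B * (N * (N + 1) / 2 + real k * N)"
        unfolding sum_distrib_left[symmetric] lin .
    qed
    also have "\<dots> = (B * N) * (B * N) / 2 + (B * N) * B / 2 + (B * N) * (B * N) * \<kappa> + (B * N) * S n * \<kappa>"
      by (simp add: kN algebra_simps add_divide_distrib)
    also have "\<dots> \<le> (B * N) * (B * N) / 2 + (B * N) * (B * N) * \<eta> / 2 + (B * N) * (B * N) * \<eta> + (B * N) * S n * \<eta>"
    proof -
      have "B * 1 \<le> B * (\<eta> * N)" by (intro mult_left_mono N\<eta> B0)
      then have "(B * N) * B \<le> (B * N) * (B * (\<eta> * N))" using B0 N by (intro mult_left_mono) auto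
      moreover have "(B * N) * (B * N) * \<kappa> \<le> (B * N) * (B * N) * \<eta>" using \<kappa> by (intro mult_left_mono) auto
      moreover have "(B * N) * S n * \<kappa> \<le> (B * N) * S n * \<eta>" using \<kappa> B0 N S0 by (intro mult_left_mono) auto
      ultimately show ?thesis by (simp add: mult_ac)
    qed
    also have "\<dots> = (S n)\<^sup>2 * ((1 + \<eta>)\<^sup>2 * (1 / 2 + 3 / 2 * \<eta>) + (1 + \<eta>) * \<eta>)"
      unfolding BN by (simp add: power2_eq_square field_simps)
    also have "\<dots> \<le> (S n)\<^sup>2 * (1 / 2 + \<epsilon>)"
    proof (intro mult_left_mono)
      have "\<eta>\<^sup>2 \<le> \<eta>" "\<eta> ^ 3 \<le> \<eta>" using \<eta> by (auto simp: power2_eq_square power3_eq_cube mult_le_one mult_left_le)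
      moreover have "14 * \<eta> \<le> \<epsilon>" using r14 by (simp add: \<eta>_def)
      moreover have "(1 + \<eta>)\<^sup>2 * (1 / 2 + 3 / 2 * \<eta>) + (1 + \<eta>) * \<eta> = 1 / 2 + 7 / 2 * \<eta> + 9 / 2 * \<eta>\<^sup>2 + 3 / 2 * \<eta> ^ 3"
        by (simp add: power2_eq_square power3_eq_cube field_simps)
      ultimately show "(1 + \<eta>)\<^sup>2 * (1 / 2 + 3 / 2 * \<eta>) + (1 + \<eta>) * \<eta> \<le> 1 / 2 + \<epsilon>" using \<eta> by linarith
    qed simp
    finally show ?thesis by (simp add: mult.commute)
  qed
  then show ?thesis by (auto simp: eventually_sequentially)
qed

section \<open>Moments of the range in terms of escape probabilities\<close>

text \<open>
The two properties of a walk on which the weak law rests, next to stationarity: relative mixing of the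
internal chain, uniformly over nonnegative functions, and the decay of the return probabilities.
\<close>

locale mixing_walk = internal_walk jump
  for jump :: "'e::finite \<Rightarrow> ('v::{ab_group_add, countable} \<times> 'e) pmf" +
  fixes \<mu> :: "'e \<Rightarrow> real"
  assumes \<mu>_pos: "0 < \<mu> j"
    and \<mu>_sum: "(\<Sum>j\<in>UNIV. \<mu> j) = 1"
    and stationary: "(\<Sum>j\<in>UNIV. \<mu> j * internal_avg f j) = (\<Sum>j\<in>UNIV. \<mu> j * f j)"
    and mixing: "0 < \<delta> \<Longrightarrow> \<exists>m. \<forall>k\<ge>m. \<forall>f j. (\<forall>i. 0 \<le> f i) \<longrightarrow>
        (1 - \<delta>) * (\<Sum>i\<in>UNIV. \<mu> i * f i) \<le> (internal_avg ^^ k) f j \<and>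
        (internal_avg ^^ k) f j \<le> (1 + \<delta>) * (\<Sum>i\<in>UNIV. \<mu> i * f i)"
    and return_prob_le: "\<exists>C. \<forall>k j i. return_prob k j i \<le> C / (real k + 1)"
begin

definition mean :: "('e \<Rightarrow> real) \<Rightarrow> real" where "mean f = (\<Sum>i\<in>UNIV. \<mu> i * f i)"

lemma mean_mono: "(\<And>i. f i \<le> g i) \<Longrightarrow> mean f \<le> mean g"
  unfolding mean_def by (intro sum_mono mult_left_mono) (auto simp: less_imp_le[OF \<mu>_pos])

lemma mean_nonneg: "(\<And>i. 0 \<le> f i) \<Longrightarrow> 0 \<le> mean f"
  unfolding mean_def by (intro sum_nonneg mult_nonneg_nonneg) (auto simp: less_imp_le[OF \<mu>_pos])

lemma mean_const [simp]: "mean (\<lambda>_. c) = c"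
  unfolding mean_def by (simp add: sum_distrib_right[symmetric] \<mu>_sum)

lemma mean_sum: "mean (\<lambda>i. \<Sum>k\<in>K. f k i) = (\<Sum>k\<in>K. mean (f k))"
  unfolding mean_def sum_distrib_left by (rule sum.swap)

lemma mean_mult: "mean (\<lambda>i. c * f i) = c * mean f"
  unfolding mean_def by (simp add: sum_distrib_left mult_ac)

lemma mean_internal_avg_pow: "mean ((internal_avg ^^ k) f) = mean f"
  by (induction k) (simp_all add: mean_def stationary)

definition mean_escape :: "nat \<Rightarrow> real" where "mean_escape n = mean (escape n)"

definition escape_total :: "nat \<Rightarrow> real" where "escape_total n = (\<Sum>a\<le>n. mean_escape a)"

lemma mean_escape_bounds: "0 \<le> mean_escape n" "mean_escape n \<le> 1"
  using mean_mono[of "escape n" "\<lambda>_. 1"] unfolding mean_escape_def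
  by (auto intro: mean_nonneg escape_nonneg escape_le_1)

lemma mean_escape_0 [simp]: "mean_escape 0 = 1"
proof -
  have "escape 0 = (\<lambda>_. 1)" by (rule ext) simp
  then show ?thesis by (simp add: mean_escape_def)
qed

lemma mean_escape_antimono: "decseq mean_escape"
  by (intro decseq_SucI) (auto simp: mean_escape_def intro!: mean_mono escape_Suc_le simp del: escape.simps)

lemma escape_total_nonneg: "0 \<le> escape_total n"
  unfolding escape_total_def by (intro sum_nonneg mean_escape_bounds)

lemma escape_total_le: "escape_total n \<le> real n + 1"
proof -
  have "escape_total n \<le> (\<Sum>a\<le>n. 1)" unfolding escape_total_def by (intro sum_mono mean_escape_bounds)
  then show ?thesis by simp
qed

lemma escape_total_mono: "m \<le> n \<Longrightarrow> escape_total m \<le> escape_total n"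
  unfolding escape_total_def by (intro sum_mono2) (auto simp: mean_escape_bounds)

lemma sum_small_index: "(\<Sum>k\<le>n. of_bool (k < m)) \<le> real m"
proof -
  have "(\<Sum>k\<le>n. of_bool (k < m)) = real (card ({..n} \<inter> {k. k < m}))"
    by (simp add: of_bool_def sum.If_cases)
  also have "card ({..n} \<inter> {k. k < m}) \<le> card {..<m}" by (rule card_mono) auto
  finally show ?thesis by simp
qed

text \<open>
From time \<open>m\<close> on, averages of nonnegative functions of the internal state are stationary up to the factor
\<open>1 \<plusminus> \<delta>\<close>.
\<close>

definition mixed :: "real \<Rightarrow> nat \<Rightarrow> bool" where
  "mixed \<delta> m \<longleftrightarrow> (\<forall>k\<ge>m. \<forall>f j. (\<forall>i. 0 \<le> f i) \<longrightarrow>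
     (1 - \<delta>) * mean f \<le> (internal_avg ^^ k) f j \<and> (internal_avg ^^ k) f j \<le> (1 + \<delta>) * mean f)"

lemma ex_mixed: "0 < \<delta> \<Longrightarrow> \<exists>m. mixed \<delta> m"
  unfolding mixed_def mean_def by (rule mixing)

lemma mixedD:
  assumes "mixed \<delta> m" "m \<le> k" "\<And>i. 0 \<le> f i"
  shows "(1 - \<delta>) * mean f \<le> (internal_avg ^^ k) f j" "(internal_avg ^^ k) f j \<le> (1 + \<delta>) * mean f"
  using assms unfolding mixed_def by blast+

text \<open>
The internal state at the time \<open>k \<ge> m\<close> is nearly stationary; the first \<open>m\<close> times are given away.
\<close>

lemma mean_range_ge:
  assumes mix: "mixed \<delta> m" and \<delta>: "0 \<le> \<delta>" "\<delta> \<le> 1"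
  shows "(1 - \<delta>) * (escape_total n - real m) \<le> mean_range n s"
proof -
  have t: "(1 - \<delta>) * (mean_escape (n - k) - of_bool (k < m)) \<le> (avg ^^ k) (\<lambda>t. escape (n - k) (snd t)) s" for k
  proof (cases "k < m")
    case True
    then have "(1 - \<delta>) * (mean_escape (n - k) - of_bool (k < m)) \<le> 0"
      using mean_escape_bounds(2)[of "n - k"] \<delta> by (simp add: mult_nonneg_nonpos)
    also have "0 \<le> (avg ^^ k) (\<lambda>t. escape (n - k) (snd t)) s"
      by (intro avg_pow_nonneg escape_nonneg)
    finally show ?thesis .
  next
    case False
    then show ?thesis using mixedD(1)[OF mix, of k "escape (n - k)"]
      by (simp add: avg_pow_of_internal escape_nonneg mean_escape_def)
  qed
  have "(1 - \<delta>) * (escape_total n - real m) \<le> (1 - \<delta>) * (escape_total n - (\<Sum>k\<le>n. of_bool (k < m)))"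
    using sum_small_index[where n = n and m = m] \<delta> by (intro mult_left_mono) auto
  also have "\<dots> = (\<Sum>k\<le>n. (1 - \<delta>) * (mean_escape (n - k) - of_bool (k < m)))"
    using sum_rev[of mean_escape n] by (simp only: escape_total_def sum_distrib_left[symmetric] sum_subtractf)
  also have "\<dots> \<le> mean_range n s" unfolding mean_range_eq by (intro sum_mono t)
  finally show ?thesis .
qed

text \<open>
Main term of the pair count for a walk started in the internal state \<open>j\<close> at the earlier of two times of
last visits; \<open>k\<close> is the distance of the two times and \<open>b - k\<close> the time left after the later one, both
without the mixing window.
\<close>

definition escape_conv :: "nat \<Rightarrow> 'e \<Rightarrow> real" where
  "escape_conv b j = (\<Sum>k\<le>b. mean_escape (b - k) * escape k j)"

lemma escape_conv_nonneg: "0 \<le> escape_conv b j"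
  unfolding escape_conv_def by (intro sum_nonneg mult_nonneg_nonneg mean_escape_bounds escape_nonneg)

lemma escape_conv_le: "escape_conv b j \<le> escape_total b"
proof -
  have "escape_conv b j \<le> (\<Sum>k\<le>b. mean_escape (b - k) * 1)"
    unfolding escape_conv_def by (intro sum_mono mult_left_mono escape_le_1 mean_escape_bounds)
  then show ?thesis using sum_rev[of mean_escape b] by (simp add: escape_total_def)
qed

text \<open>
For the later time \<open>k\<close> at distance at least \<open>m\<close>, avoidance of the first site is required only up to \<open>k - m\<close>;
by then mixing has made \<open>g\<close> out of the escape probability at time \<open>k\<close>. The \<open>m\<close> closest times
contribute at most 1 each.
\<close>

lemma avg_avoid_range_le:
  assumes mix: "mixed \<delta> m" and \<delta>: "0 \<le> \<delta>"
  shows "avg (avoid_range l (fst s)) s \<le> real m + (1 + \<delta>) * escape_conv (l - m) (snd s)"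
proof -
  let ?b = "\<lambda>k. of_bool (m \<le> k) * ((1 + \<delta>) * mean_escape (l - k))"
  have t: "killed k x (\<lambda>t. escape (l - k) (snd t)) t \<le> of_bool (k < m) + ?b k * avoid (k - m) x t" for k x t
  proof (cases "k < m")
    case True
    have "killed k x (\<lambda>t. escape (l - k) (snd t)) t \<le> killed k x (\<lambda>_. 1) t"
      by (intro killed_mono bdd_intros escape_le_1)
    also have "\<dots> \<le> 1" using avoid_le_1[of k x t] by (simp add: killed_const)
    finally show ?thesis using True by simp
  next
    case False
    let ?f = "\<lambda>t. escape (l - k) (snd t)"
    have "killed k x ?f t = killed ((k - m) + m) x ?f t" using False by simp
    also have "\<dots> \<le> killed (k - m) x ((avg ^^ m) ?f) t"
      by (intro killed_add_le bdd_intros escape_nonneg)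
    also have "\<dots> \<le> killed (k - m) x (\<lambda>_. (1 + \<delta>) * mean_escape (l - k)) t"
      unfolding mean_escape_def
    proof (intro killed_mono bdd_intros)
      show "(avg ^^ m) ?f t \<le> (1 + \<delta>) * mean (escape (l - k))" for t
        unfolding avg_pow_of_internal by (rule mixedD(2)[OF mix]) (auto simp: escape_nonneg)
    qed
    finally show ?thesis using False by (simp add: killed_const)
  qed
  have "avg (avoid_range l (fst s)) s
      \<le> avg (\<lambda>t. (\<Sum>k\<le>l. of_bool (k < m) + ?b k * avoid (k - m) (fst s) t)) s"
    by (intro avg_mono bdd_intros) (auto simp: avoid_range_eq intro!: sum_mono t)
  also have "\<dots> = (\<Sum>k\<le>l. of_bool (k < m) + ?b k * escape (Suc (k - m)) (snd s))"
    by (subst avg_sum) (auto intro!: bdd_intros sum.cong simp: avg_add avg_mult bdd_of_bool bdd_const bdd_mult bdd_avoid avg_avoid simp del: escape.simps)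
  also have "\<dots> = (\<Sum>k\<le>l. of_bool (k < m)) + (\<Sum>k\<le>l. ?b k * escape (Suc (k - m)) (snd s))"
    by (rule sum.distrib)
  also have "\<dots> \<le> real m + (1 + \<delta>) * escape_conv (l - m) (snd s)"
  proof (intro add_mono sum_small_index)
    have "(\<Sum>k\<le>l. ?b k * escape (Suc (k - m)) (snd s)) \<le> (\<Sum>k\<le>l. ?b k * escape (k - m) (snd s))"
      using \<delta> by (intro sum_mono mult_left_mono escape_Suc_le) (auto simp: mean_escape_bounds)
    also have "\<dots> = (1 + \<delta>) * (\<Sum>k\<in>{m..l}. mean_escape (l - k) * escape (k - m) (snd s))"
      unfolding sum_distrib_left by (intro sum.mono_neutral_cong_right) (auto simp: mult_ac)
    also have "\<dots> \<le> (1 + \<delta>) * escape_conv (l - m) (snd s)"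
    proof (intro mult_left_mono)
      show "(\<Sum>k\<in>{m..l}. mean_escape (l - k) * escape (k - m) (snd s)) \<le> escape_conv (l - m) (snd s)"
      proof (cases "m \<le> l")
        case True
        have "(\<Sum>k\<in>{m..l}. mean_escape (l - k) * escape (k - m) (snd s)) = escape_conv (l - m) (snd s)"
          unfolding escape_conv_def
          by (rule sum.reindex_bij_witness[of _ "\<lambda>k. k + m" "\<lambda>k. k - m"]) (use True in auto)
        then show ?thesis by simp
      qed (simp add: escape_conv_nonneg)
    qed (use \<delta> in auto)
    finally show "(\<Sum>k\<le>l. ?b k * escape (Suc (k - m)) (snd s)) \<le> (1 + \<delta>) * escape_conv (l - m) (snd s)" .
  qed
  finally show ?thesis .
qed

text \<open>
Mixing is used a second time, for the earlier of the two times of last visits: if it is at least \<open>m\<close>, its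
internal state is nearly stationary and \<open>escape_conv\<close> averages to the convolution square of \<open>g\<close>; the \<open>m\<close>
first times contribute at most \<open>escape_total n\<close> each.
\<close>

lemma square_range_le:
  assumes mix: "mixed \<delta> m" and \<delta>: "0 \<le> \<delta>"
  shows "square_range n s \<le> (real n + 1) * (1 + 2 * real m)
     + 2 * (1 + \<delta>) * (real m * escape_total n + (1 + \<delta>) * (real m + 1 + (\<Sum>a\<le>n. mean_escape a * escape_total (n - a))))"
proof -
  let ?h = "\<lambda>p t. case p of 0 \<Rightarrow> 1 | Suc l \<Rightarrow> escape (Suc l) (snd t) + 2 * avg (avoid_range l (fst t)) t"
  let ?H = "\<lambda>p j. (1 + 2 * real m) + 2 * (1 + \<delta>) * escape_conv (p - Suc m) j"
  define cbar where "cbar b = mean (escape_conv b)" for b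
  have cbar: "cbar b = (\<Sum>k\<le>b. mean_escape (b - k) * mean_escape k)" for b
    unfolding cbar_def escape_conv_def by (simp add: mean_sum mean_mult mean_escape_def)
  have cbar0: "0 \<le> cbar b" for b unfolding cbar_def by (intro mean_nonneg escape_conv_nonneg)
  have bh: "bdd (?h p)" for p by (cases p) (auto intro!: bdd_intros simp del: escape.simps)
  have hH: "?h p t \<le> ?H p (snd t)" for p t
  proof (cases p)
    case 0
    then show ?thesis using \<delta> escape_conv_nonneg[of 0 "snd t"] by simp
  next
    case (Suc l)
    then show ?thesis
      using avg_avoid_range_le[OF mix \<delta>, of l t] escape_le_1[of "Suc l" "snd t"]
      by (simp add: algebra_simps del: escape.simps)
  qed
  have t: "(avg ^^ k) (?h p) s \<le> (1 + 2 * real m)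
      + 2 * (1 + \<delta>) * (of_bool (k < m) * escape_total n + (1 + \<delta>) * cbar (p - Suc m))" if "p \<le> n" for k p
  proof -
    let ?b = "p - Suc m"
    have "(avg ^^ k) (?h p) s \<le> (avg ^^ k) (\<lambda>t. ?H p (snd t)) s"
      by (intro avg_pow_mono bh bdd_internal[of "?H p"] hH)
    also have "\<dots> = (1 + 2 * real m) + 2 * (1 + \<delta>) * (avg ^^ k) (\<lambda>t. escape_conv ?b (snd t)) s"
      by (subst avg_pow_add) (auto intro!: bdd_intros simp: avg_pow_mult)
    also have "(avg ^^ k) (\<lambda>t. escape_conv ?b (snd t)) s \<le> of_bool (k < m) * escape_total n + (1 + \<delta>) * cbar ?b"
    proof (cases "k < m")
      case True
      have "(avg ^^ k) (\<lambda>t. escape_conv ?b (snd t)) s \<le> escape_total ?b"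
        by (intro avg_pow_le_const bdd_intros escape_conv_le)
      also have "\<dots> \<le> escape_total n" using that by (intro escape_total_mono) simp
      finally show ?thesis using True cbar0[of ?b] \<delta> by (simp add: add_increasing2)
    next
      case False
      then show ?thesis using mixedD(2)[OF mix, of k "escape_conv ?b" "snd s"]
        by (simp add: avg_pow_of_internal cbar_def escape_conv_nonneg)
    qed
    finally show ?thesis using \<delta> by (simp add: mult_left_mono)
  qed
  have "square_range n s \<le> (\<Sum>k\<le>n. (1 + 2 * real m)
      + 2 * (1 + \<delta>) * (of_bool (k < m) * escape_total n + (1 + \<delta>) * cbar (n - k - Suc m)))"
    unfolding square_range_eq by (intro sum_mono t) simp
  also have "\<dots> = (real n + 1) * (1 + 2 * real m)
      + 2 * (1 + \<delta>) * ((\<Sum>k\<le>n. of_bool (k < m)) * escape_total n + (1 + \<delta>) * (\<Sum>k\<le>n. cbar (n - k - Suc m)))"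
    by (simp only: sum.distrib sum_distrib_left[symmetric] sum_distrib_right[symmetric] sum_constant card_atMost) (simp add: algebra_simps)
  also have "(\<Sum>k\<le>n. cbar (n - k - Suc m)) = (\<Sum>l\<le>n. cbar (l - Suc m))"
    by (rule sum_rev[of "\<lambda>l. cbar (l - Suc m)"])
  also have "(real n + 1) * (1 + 2 * real m)
      + 2 * (1 + \<delta>) * ((\<Sum>k\<le>n. of_bool (k < m)) * escape_total n + (1 + \<delta>) * (\<Sum>l\<le>n. cbar (l - Suc m)))
    \<le> (real n + 1) * (1 + 2 * real m)
      + 2 * (1 + \<delta>) * (real m * escape_total n + (1 + \<delta>) * (real m + 1 + (\<Sum>a\<le>n. mean_escape a * escape_total (n - a))))"
  proof (intro add_left_mono mult_left_mono add_mono mult_right_mono sum_small_index escape_total_nonneg)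
    have "(\<Sum>l\<le>n. cbar (l - Suc m)) \<le> real (Suc m) * cbar 0 + (\<Sum>l\<le>n. cbar l)"
      by (intro sum_truncated_shift_le cbar0)
    also have "(\<Sum>l\<le>n. cbar l) = (\<Sum>a\<le>n. mean_escape a * escape_total (n - a))"
      unfolding cbar escape_total_def by (rule sum_convolution)
    also have "cbar 0 = 1" by (simp add: cbar)
    finally show "(\<Sum>l\<le>n. cbar (l - Suc m)) \<le> real m + 1 + (\<Sum>a\<le>n. mean_escape a * escape_total (n - a))" by simp
  qed (use \<delta> in auto)
  finally show ?thesis .
qed

definition escape_sum :: "'e \<Rightarrow> nat \<Rightarrow> real" where "escape_sum i n = (\<Sum>a\<le>n. escape a i)"

lemma escape_sum_nonneg: "0 \<le> escape_sum i n"
  unfolding escape_sum_def by (intro sum_nonneg escape_nonneg)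

lemma escape_total_eq: "escape_total n = (\<Sum>i\<in>UNIV. \<mu> i * escape_sum i n)"
  unfolding escape_total_def escape_sum_def mean_escape_def mean_sum[symmetric] by (simp add: mean_def)

lemma green_nonneg: "0 \<le> green n j i"
  unfolding green_def by (intro sum_nonneg return_prob_nonneg)

text \<open>
Under the stationary law the state \<open>i\<close> occurs \<open>\<mu> i * (n + 1)\<close> times on average, and the expected range is
\<open>escape_total n\<close>.
\<close>

lemma green_lower: "\<mu> i * (real n + 1) \<le> green n i i * escape_total n"
proof -
  let ?f = "\<lambda>j. of_bool (j = i) :: real"
  have mf: "mean ?f = \<mu> i" by (simp add: mean_def of_bool_def if_distrib cong: if_cong)
  have "mean (\<lambda>j. \<Sum>k\<le>n. (internal_avg ^^ k) ?f j) \<le> mean (\<lambda>j. green n i i * mean_range n (0, j))"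
    using internal_visits_le[where n = n and i = i and s = "(0, j)" for j]
    by (intro mean_mono) (simp add: avg_pow_of_internal[of _ ?f])
  then show ?thesis
    unfolding mean_mult mean_range_eq mean_sum avg_pow_of_internal
    using sum_rev[of mean_escape n] mean_sum[where f = "\<lambda>k j. (internal_avg ^^ k) (escape (n - k)) j" and K = "{..n}"]
    by (simp add: mean_internal_avg_pow mf mean_escape_def escape_total_def algebra_simps)
qed

text \<open>
The renewal identity summed over time. In this form the concave functions \<open>escape_sum i\<close> replace the
escape probabilities, which makes both of the following comparisons immediate.
\<close>

lemma renewal_sum: "(\<Sum>k\<le>N. \<Sum>i\<in>UNIV. return_prob k j i * escape_sum i (N - k)) = real N + 1"
proof (induction N)
  case 0
  show ?case using renewal[of j 0] by (simp add: escape_sum_def)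
next
  case (Suc N)
  have "(\<Sum>k\<le>Suc N. \<Sum>i\<in>UNIV. return_prob k j i * escape_sum i (Suc N - k))
      = (\<Sum>k\<le>N. \<Sum>i\<in>UNIV. return_prob k j i * (escape_sum i (N - k) + escape (Suc N - k) i))
        + (\<Sum>i\<in>UNIV. return_prob (Suc N) j i * escape 0 i)"
    by (simp add: Suc_diff_le escape_sum_def del: escape.simps)
  also have "\<dots> = (\<Sum>k\<le>N. \<Sum>i\<in>UNIV. return_prob k j i * escape_sum i (N - k))
      + (\<Sum>k\<le>Suc N. \<Sum>i\<in>UNIV. return_prob k j i * escape (Suc N - k) i)"
    by (simp add: distrib_left sum.distrib del: escape.simps)
  finally show ?case using Suc renewal[of j "Suc N"] by simp
qed

lemma green_escape_ge: "real N + 1 \<le> (\<Sum>i\<in>UNIV. green N j i * escape_sum i N)"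
proof -
  have "(\<Sum>k\<le>N. \<Sum>i\<in>UNIV. return_prob k j i * escape_sum i (N - k)) \<le> (\<Sum>k\<le>N. \<Sum>i\<in>UNIV. return_prob k j i * escape_sum i N)"
    unfolding escape_sum_def by (intro sum_mono mult_left_mono sum_mono2 return_prob_nonneg) (auto simp: escape_nonneg)
  also have "\<dots> = (\<Sum>i\<in>UNIV. green N j i * escape_sum i N)"
    unfolding green_def sum_distrib_right by (rule sum.swap)
  finally show ?thesis by (simp add: renewal_sum)
qed

lemma green_escape_le:
  assumes "K \<le> N" shows "(\<Sum>i\<in>UNIV. green K j i * escape_sum i (N - K)) \<le> real N + 1"
proof -
  have "(\<Sum>i\<in>UNIV. green K j i * escape_sum i (N - K)) = (\<Sum>k\<le>K. \<Sum>i\<in>UNIV. return_prob k j i * escape_sum i (N - K))"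
    unfolding green_def sum_distrib_right by (rule sum.swap)
  also have "\<dots> \<le> (\<Sum>k\<le>K. \<Sum>i\<in>UNIV. return_prob k j i * escape_sum i (N - k))"
    unfolding escape_sum_def by (intro sum_mono mult_left_mono sum_mono2 return_prob_nonneg) (auto simp: escape_nonneg)
  also have "\<dots> \<le> (\<Sum>k\<le>N. \<Sum>i\<in>UNIV. return_prob k j i * escape_sum i (N - k))"
    using assms by (intro sum_mono2) (auto intro!: sum_nonneg mult_nonneg_nonneg return_prob_nonneg escape_sum_nonneg)
  finally show ?thesis by (simp add: renewal_sum)
qed

end

section \<open>Slow variation of the expected range\<close>

context mixing_walk
begin

definition site_rate :: "nat \<Rightarrow> real" where "site_rate n = escape_total n / (real n + 1)"

definition escape_rate :: "'e \<Rightarrow> nat \<Rightarrow> real" where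
  "escape_rate i n = escape_sum i n / (real n + 1)"

lemma site_rate_nonneg: "0 \<le> site_rate n"
  by (simp add: site_rate_def escape_total_nonneg)

lemma escape_rate_nonneg: "0 \<le> escape_rate i n"
  by (simp add: escape_rate_def escape_sum_nonneg)

lemma site_rate_antimono: "decseq site_rate"
  unfolding site_rate_def escape_total_def by (rule decseq_average[OF mean_escape_antimono])

lemma escape_rate_antimono: "decseq (escape_rate i)"
  unfolding escape_rate_def escape_sum_def by (rule decseq_average[OF escape_antimono])

lemma site_rate_eq: "site_rate n = (\<Sum>i\<in>UNIV. \<mu> i * escape_rate i n)"
  by (simp add: site_rate_def escape_rate_def escape_total_eq sum_divide_distrib)

lemma escape_rate_le: "\<mu> i * escape_rate i n \<le> site_rate n"
  unfolding site_rate_eq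
  by (rule member_le_sum[where f = "\<lambda>i. \<mu> i * escape_rate i n"])
    (auto simp: escape_rate_nonneg less_imp_le[OF \<mu>_pos])

lemma green_site_rate_ge: "\<mu> i \<le> green n i i * site_rate n"
  using green_lower[of i n] by (simp add: site_rate_def field_simps)

lemma green_escape_rate_ge: "1 \<le> (\<Sum>i\<in>UNIV. green N j i * escape_rate i N)"
  using green_escape_ge[of N j] by (simp add: escape_rate_def sum_divide_distrib[symmetric] field_simps)

text \<open>
Only the returns up to time \<open>K\<close> are kept; as the average escape probability decreases, \<open>escape_sum i\<close> at
\<open>N - K\<close> is at least the fraction \<open>(N + 1 - K) / (N + 1)\<close> of its value at \<open>N\<close>.
\<close>

lemma green_escape_rate_le:
  assumes "K \<le> N"
  shows "(real N + 1 - real K) * (\<Sum>i\<in>UNIV. green K j i * escape_rate i N) \<le> real N + 1"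
proof -
  have "(real N + 1 - real K) * escape_rate i N \<le> escape_sum i (N - K)" for i
  proof -
    have "escape_rate i N \<le> escape_rate i (N - K)"
      using escape_rate_antimono[of i] by (simp add: decseq_def)
    then have "(real N + 1 - real K) * escape_rate i N \<le> (real N + 1 - real K) * escape_rate i (N - K)"
      using assms by (intro mult_left_mono) auto
    also have "\<dots> = escape_sum i (N - K)"
    proof -
      have e: "real N + 1 - real K = real (N - K) + 1" using assms by simp
      show ?thesis unfolding e escape_rate_def times_divide_eq_right
        by (rule nonzero_mult_div_cancel_left) linarith
    qed
    finally show ?thesis .
  qed
  then have "(\<Sum>i\<in>UNIV. green K j i * ((real N + 1 - real K) * escape_rate i N))
      \<le> (\<Sum>i\<in>UNIV. green K j i * escape_sum i (N - K))"
    by (intro sum_mono mult_left_mono green_nonneg)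
  then show ?thesis using green_escape_le[OF assms, of j] by (simp add: sum_distrib_left mult_ac)
qed

lemma green_diff_le:
  assumes C: "\<And>k j i. return_prob k j i \<le> C / (real k + 1)" and KN: "K \<le> N"
  shows "green N j i \<le> green K j i + C * real N / (real K + 1)"
proof -
  have C0: "0 \<le> C" using C[of 0 j i] return_prob_nonneg[of 0 j i] by simp
  have "{..N} = {..K} \<union> {K<..N}" using KN by auto
  then have "green N j i = green K j i + (\<Sum>k\<in>{K<..N}. return_prob k j i)"
    unfolding green_def by (simp only:) (rule sum.union_disjoint, auto)
  also have "(\<Sum>k\<in>{K<..N}. return_prob k j i) \<le> (\<Sum>k\<in>{K<..N}. C / (real K + 1))"
  proof (intro sum_mono)
    fix k assume "k \<in> {K<..N}"
    then have "C / (real k + 1) \<le> C / (real K + 1)" using C0 by (intro divide_left_mono) auto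
    then show "return_prob k j i \<le> C / (real K + 1)" using C[of k j i] by linarith
  qed
  also have "\<dots> \<le> C * real N / (real K + 1)"
    using C0 by (simp add: divide_right_mono mult_left_mono mult.commute)
  finally show ?thesis by simp
qed

text \<open>
The heart of the proof, as explained in the introduction. If the limit is 0, then with \<open>N = r n\<close> and \<open>K = n div q\<close> the sums
\<open>\<Sum>\<^sub>i G\<^sub>K(j, i) A\<^sub>i(n)\<close> and \<open>\<Sum>\<^sub>i G\<^sub>N(j, i) A\<^sub>i(N)\<close> are at most \<open>1 + 1 / (q - 1)\<close> and at least 1, and
\<open>G\<^sub>N - G\<^sub>K\<close> is at most \<open>C r q\<close>. Since the comparison of \<open>n\<close> with \<open>r n\<close> does not involve \<open>q\<close>, taking
\<open>q\<close> large makes the error arbitrarily small.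
\<close>

lemma site_rate_slow:
  assumes r: "1 \<le> r" and \<eta>: "0 < \<eta>"
  shows "eventually (\<lambda>n. site_rate n \<le> (1 + \<eta>) * site_rate (r * n)) sequentially"
proof -
  obtain a where a: "site_rate \<longlonglongrightarrow> a" "\<And>n. a \<le> site_rate n"
    using decseq_convergent[OF site_rate_antimono, of 0] site_rate_nonneg by blast
  have a0: "0 \<le> a" using a(1) site_rate_nonneg by (intro LIMSEQ_le_const) auto
  show ?thesis
  proof (cases "a = 0")
    case False
    then have "a < (1 + \<eta>) * a" using a0 \<eta> by simp
    then have "eventually (\<lambda>n. site_rate n < (1 + \<eta>) * a) sequentially"
      by (rule order_tendstoD(2)[OF a(1)])
    then show ?thesis
    proof eventually_elim
      case (elim n)
      have "(1 + \<eta>) * a \<le> (1 + \<eta>) * site_rate (r * n)" using a(2) \<eta> by (intro mult_left_mono) auto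
      then show ?case using elim by linarith
    qed
  next
    case True
    obtain C where C: "\<And>k j i. return_prob k j i \<le> C / (real k + 1)" using return_prob_le by blast
    have C0: "0 \<le> C" using C[of 0 undefined undefined] return_prob_nonneg[of 0 undefined undefined] by simp
    let ?E = "real CARD('e)"
    have E: "?E > 0" by simp
    obtain q :: nat where q: "real q > max 2 (2 * ?E / \<eta> + 1)" using reals_Archimedean2 by blast
    then have q2: "real q > 2" and "2 * ?E / \<eta> < real q - 1" by auto
    then have qE: "?E / (real q - 1) \<le> \<eta> / 2" using \<eta> by (simp add: field_simps)
    have lim: "(\<lambda>n. \<Sum>i\<in>UNIV. escape_rate i n) \<longlonglongrightarrow> 0"
    proof -
      have "(\<lambda>n. escape_rate i n) \<longlonglongrightarrow> 0" for i
      proof (rule tendsto_sandwich[OF _ _ tendsto_const])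
        show "eventually (\<lambda>n. escape_rate i n \<le> site_rate n / \<mu> i) sequentially"
          using escape_rate_le[of i] \<mu>_pos[of i] by (intro always_eventually) (auto simp: field_simps)
        show "(\<lambda>n. site_rate n / \<mu> i) \<longlonglongrightarrow> 0" using tendsto_divide[OF a(1) tendsto_const, of "\<mu> i"] True \<mu>_pos[of i]
          by simp
      qed (simp add: escape_rate_nonneg)
      then show ?thesis using tendsto_sum[of UNIV "\<lambda>i n. escape_rate i n" "\<lambda>_. 0"] by simp
    qed
    have "(\<lambda>n. ?E * (C * r * q) * (\<Sum>i\<in>UNIV. escape_rate i n)) \<longlonglongrightarrow> 0"
      using tendsto_mult[OF tendsto_const lim, of "?E * (C * r * q)"] by simp
    then have "eventually (\<lambda>n. ?E * (C * r * q) * (\<Sum>i\<in>UNIV. escape_rate i n) < \<eta> / 2) sequentially"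
      using \<eta> by (intro order_tendstoD(2)) auto
    then show ?thesis
    proof eventually_elim
      case (elim n)
      define K where "K = n div q"
      define N where "N = r * n"
      define D where "D = (\<Sum>i\<in>UNIV. escape_rate i n)"
      define \<theta> where "\<theta> = 1 / (real q - 1) + C * r * q * D"
      have nN: "n \<le> N" using r by (simp add: N_def)
      have KN: "K \<le> n" by (simp add: K_def)
      have D0: "0 \<le> D" unfolding D_def by (intro sum_nonneg escape_rate_nonneg)
      have Kq: "real q * real K \<le> real n" "real n \<le> real q * (real K + 1)"
      proof -
        have "q * K \<le> n" by (simp add: K_def)
        then show "real q * real K \<le> real n" by (metis of_nat_le_iff of_nat_mult)
        have "n \<le> q * (K + 1)" using dividend_less_times_div[of q n] q2 by (simp add: K_def)
        then show "real n \<le> real q * (real K + 1)" by (metis of_nat_1 of_nat_add of_nat_le_iff of_nat_mult)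
      qed
      \<comment> \<open>A crude count of the terms suffices, because this constant is multiplied by a quantity that tends to 0.\<close>
      have gd: "green N j i \<le> green K j i + C * r * q" for i j
      proof -
        have "C * real N / (real K + 1) \<le> C * r * q"
        proof -
          have "real N \<le> real r * (real q * (real K + 1))"
            unfolding N_def using Kq(2) by (simp add: mult_left_mono)
          then have "C * real N \<le> C * (real r * (real q * (real K + 1)))" by (rule mult_left_mono[OF _ C0])
          then show ?thesis by (simp add: divide_le_eq mult_ac)
        qed
        then show ?thesis using green_diff_le[OF C, of K N j i] KN nN by linarith
      qed
      have low: "(\<Sum>i\<in>UNIV. green K j i * escape_rate i n) \<le> 1 + 1 / (real q - 1)" for j
      proof -
        let ?X = "\<Sum>i\<in>UNIV. green K j i * escape_rate i n"
        have X0: "0 \<le> ?X" by (intro sum_nonneg mult_nonneg_nonneg green_nonneg escape_rate_nonneg)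
        have "(real n + 1) * (real q - 1) \<le> real q * (real n + 1 - real K)"
          using Kq(1) q2 by (simp add: algebra_simps)
        then have "(real n + 1) * (real q - 1) * ?X \<le> real q * (real n + 1 - real K) * ?X"
          by (rule mult_right_mono[OF _ X0])
        also have "\<dots> \<le> real q * (real n + 1)"
          using green_escape_rate_le[OF KN, of j] by (simp add: mult.assoc mult_left_mono)
        finally have "(real n + 1) * ((real q - 1) * ?X) \<le> (real n + 1) * real q" by (simp add: mult_ac)
        then have "(real q - 1) * ?X \<le> real q" by (rule mult_left_le_imp_le) auto
        then show ?thesis using q2 by (simp add: field_simps)
      qed
      \<comment> \<open>All summands are nonnegative, so the diagonal one inherits the bound for the whole sum.\<close>
      have main: "\<mu> i * (escape_rate i n - escape_rate i N) \<le> \<theta> * site_rate N" for i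
      proof -
        have dec: "escape_rate k N \<le> escape_rate k n" for k
          using escape_rate_antimono[of k] nN by (simp add: decseq_def)
        have "green N i i * (escape_rate i n - escape_rate i N)
            \<le> (\<Sum>k\<in>UNIV. green N i k * (escape_rate k n - escape_rate k N))"
          by (rule member_le_sum[where f = "\<lambda>k. green N i k * (escape_rate k n - escape_rate k N)"])
            (auto intro!: mult_nonneg_nonneg green_nonneg simp: dec)
        also have "\<dots> = (\<Sum>k\<in>UNIV. green N i k * escape_rate k n) - (\<Sum>k\<in>UNIV. green N i k * escape_rate k N)"
          by (simp add: right_diff_distrib sum_subtractf)
        also have "\<dots> \<le> (\<Sum>k\<in>UNIV. (green K i k + C * r * q) * escape_rate k n) - 1"
          using green_escape_rate_ge[of N i]
          by (intro diff_mono sum_mono mult_right_mono gd escape_rate_nonneg)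
        also have "\<dots> = (\<Sum>k\<in>UNIV. green K i k * escape_rate k n) + C * r * q * D - 1"
          unfolding D_def by (simp add: distrib_right sum.distrib sum_distrib_left)
        also have "\<dots> \<le> \<theta>" using low[of i] by (simp add: \<theta>_def)
        finally have le: "green N i i * (escape_rate i n - escape_rate i N) \<le> \<theta>" .
        have "\<mu> i * (escape_rate i n - escape_rate i N)
            \<le> (green N i i * site_rate N) * (escape_rate i n - escape_rate i N)"
          by (intro mult_right_mono green_site_rate_ge) (simp add: dec)
        also have "\<dots> = (green N i i * (escape_rate i n - escape_rate i N)) * site_rate N" by simp
        also have "\<dots> \<le> \<theta> * site_rate N" by (intro mult_right_mono le site_rate_nonneg)
        finally show ?thesis .
      qed
      have "site_rate n - site_rate N = (\<Sum>i\<in>UNIV. \<mu> i * (escape_rate i n - escape_rate i N))"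
        unfolding site_rate_eq by (simp add: right_diff_distrib sum_subtractf)
      also have "\<dots> \<le> (\<Sum>i\<in>(UNIV::'e set). \<theta> * site_rate N)" by (intro sum_mono main)
      also have "\<dots> = (?E * \<theta>) * site_rate N" by simp
      also have "\<dots> \<le> \<eta> * site_rate N"
      proof (rule mult_right_mono[OF _ site_rate_nonneg])
        have "?E * \<theta> = ?E / (real q - 1) + ?E * (C * r * q) * D" by (simp add: \<theta>_def algebra_simps)
        then show "?E * \<theta> \<le> \<eta>" using qE elim unfolding D_def by linarith
      qed
      finally show ?case unfolding N_def by (simp add: algebra_simps)
    qed
  qed
qed

lemma sum_reciprocals_le: "(\<Sum>k\<le>n. 1 / (real k + 1)) \<le> 1 + ln (real n + 1)"
proof (induction n)
  case (Suc n)
  have "ln ((real n + 1) / (real n + 2)) \<le> (real n + 1) / (real n + 2) - 1"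
    by (rule ln_le_minus_one) simp
  then have "1 / (real n + 2) \<le> ln (real n + 2) - ln (real n + 1)"
    by (simp add: ln_div field_simps)
  then show ?case using Suc by (simp add: add.commute add.left_commute)
qed simp

text \<open>
The return probabilities sum to at most a logarithm, and the renewal identity turns this into a lower
bound for the escape probabilities.
\<close>

lemma site_rate_ge_inverse_ln: "\<exists>c>0. \<forall>n. c \<le> (1 + ln (real n + 1)) * site_rate n"
proof -
  obtain C where C: "\<And>k j i. return_prob k j i \<le> C / (real k + 1)" using return_prob_le by blast
  have C0: "0 \<le> C" using C[of 0 undefined undefined] return_prob_nonneg[of 0 undefined undefined] by simp
  define R where "R = (\<Sum>i\<in>UNIV. 1 / \<mu> i)"
  have R0: "0 \<le> R" unfolding R_def by (intro sum_nonneg) (simp add: less_imp_le[OF \<mu>_pos])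
  have "1 \<le> (C * R + 1) * ((1 + ln (real n + 1)) * site_rate n)" for n
  proof -
    let ?l = "1 + ln (real n + 1)"
    have l0: "0 \<le> ?l" by simp
    have "green n j i \<le> C * ?l" for i j
    proof -
      have "green n j i \<le> (\<Sum>k\<le>n. C * (1 / (real k + 1)))"
        unfolding green_def using C by (intro sum_mono) simp
      also have "\<dots> \<le> C * ?l" unfolding sum_distrib_left[symmetric] by (intro mult_left_mono sum_reciprocals_le C0)
      finally show ?thesis .
    qed
    then have "1 \<le> (\<Sum>i\<in>UNIV. (C * ?l) * (site_rate n * (1 / \<mu> i)))"
      using green_escape_rate_ge[of n undefined] escape_rate_le[of _ n] \<mu>_pos
      by (elim order_trans, intro sum_mono mult_mono)
        (auto simp: escape_rate_nonneg field_simps C0 l0)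
    also have "\<dots> = C * R * (?l * site_rate n)" unfolding R_def by (simp add: sum_distrib_left mult_ac)
    also have "\<dots> \<le> (C * R + 1) * (?l * site_rate n)"
      using site_rate_nonneg[of n] l0 by (intro mult_right_mono) auto
    finally show ?thesis .
  qed
  moreover have "0 < C * R + 1" using C0 R0 by (simp add: add_nonneg_pos)
  ultimately show ?thesis by (intro exI[of _ "1 / (C * R + 1)"]) (auto simp: field_simps)
qed

text \<open>
This makes the errors of order \<open>n\<close> in the second moment negligible.
\<close>

lemma escape_total_square_dominates:
  assumes "0 < \<epsilon>" shows "eventually (\<lambda>n. real n + 1 \<le> \<epsilon> * (escape_total n)\<^sup>2) sequentially"
proof -
  obtain c where c: "c > 0" "\<And>n. c \<le> (1 + ln (real n + 1)) * site_rate n"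
    using site_rate_ge_inverse_ln by blast
  have "((\<lambda>n::nat. (1 + ln (real n + 1))\<^sup>2 / (real n + 1)) \<longlongrightarrow> 0) sequentially" by real_asymp
  then have "eventually (\<lambda>n::nat. (1 + ln (real n + 1))\<^sup>2 / (real n + 1) < \<epsilon> * c\<^sup>2) sequentially"
    using assms c by (intro order_tendstoD(2)) auto
  then show ?thesis
  proof eventually_elim
    case (elim n)
    let ?l = "1 + ln (real n + 1)"
    have l: "?l > 0" by (simp add: add_pos_nonneg)
    have c2: "c\<^sup>2 \<le> (?l * site_rate n)\<^sup>2" using c by (intro power_mono) auto
    have "?l\<^sup>2 < \<epsilon> * (real n + 1) * c\<^sup>2" using elim by (simp add: divide_less_eq mult_ac)
    also have "\<dots> \<le> \<epsilon> * (real n + 1) * (?l * site_rate n)\<^sup>2" using c2 assms by (intro mult_left_mono) auto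
    finally have "?l\<^sup>2 * 1 \<le> ?l\<^sup>2 * (\<epsilon> * (real n + 1) * (site_rate n)\<^sup>2)" by (simp add: power_mult_distrib mult_ac)
    then have "1 \<le> \<epsilon> * (real n + 1) * (site_rate n)\<^sup>2" using l by (simp only: mult_le_cancel_left_pos zero_less_power)
    then have "(real n + 1) * 1 \<le> (real n + 1) * (\<epsilon> * (real n + 1) * (site_rate n)\<^sup>2)" by (intro mult_left_mono) auto
    then show ?case by (simp add: site_rate_def power_divide power2_eq_square)
  qed
qed

text \<open>
Uniformity in the starting state is what makes the initial law irrelevant.
\<close>

lemma range_moments:
  assumes "0 < \<delta>" "\<delta> \<le> 1"
  shows "eventually (\<lambda>n. \<forall>s. (1 - \<delta>) * escape_total n \<le> mean_range n s \<and> square_range n s \<le> (1 + \<delta>) * (escape_total n)\<^sup>2) sequentially"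
proof -
  define \<delta>' where "\<delta>' = \<delta> / 32"
  have \<delta>': "0 < \<delta>'" "\<delta>' \<le> 1 / 32" using assms by (auto simp: \<delta>'_def)
  obtain m where m: "mixed \<delta>' m" using ex_mixed[OF \<delta>'(1)] by blast
  define c where "c = (1 + 2 * real m) + 3 * (real m + 2 * (real m + 1))"
  have c0: "c > 0" by (simp add: c_def add_pos_nonneg)
  have escape_conv: "eventually (\<lambda>n. (\<Sum>a\<le>n. mean_escape a * escape_total (n - a)) \<le> (1 / 2 + \<delta>') * (escape_total n)\<^sup>2) sequentially"
    unfolding escape_total_def
    by (rule self_convolution_le)
      (use site_rate_slow mean_escape_antimono mean_escape_bounds \<delta>' in \<open>auto simp: site_rate_def escape_total_def\<close>)
  have "eventually (\<lambda>n. real n + 1 \<le> (\<delta>' / c) * (escape_total n)\<^sup>2) sequentially"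
    using \<delta>' c0 by (intro escape_total_square_dominates) auto
  with escape_conv show ?thesis
  proof eventually_elim
    case (elim n)
    let ?S = "escape_total n" and ?T = "\<Sum>a\<le>n. mean_escape a * escape_total (n - a)"
    have dom: "c * (real n + 1) \<le> \<delta>' * ?S\<^sup>2" using elim(2) c0 by (simp add: field_simps)
    have S0: "0 \<le> ?S" by (rule escape_total_nonneg)
    have "0 < ?S\<^sup>2" using dom c0 \<delta>' by (smt (verit) mult_pos_pos of_nat_0_le_iff zero_less_mult_pos)
    then have S: "0 < ?S" using S0 by (simp add: zero_less_power2)
    have mS: "real m \<le> \<delta>' * ?S"
    proof -
      have "real m * ?S \<le> c * (real n + 1)" using escape_total_le[of n] S0 by (intro mult_mono) (auto simp: c_def)
      then have "real m * ?S \<le> (\<delta>' * ?S) * ?S" using dom by (simp add: power2_eq_square mult.assoc)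
      then show ?thesis using S by (rule mult_right_le_imp_le)
    qed
    show ?case
    proof (intro allI conjI)
      fix s
      have "(1 - \<delta>) * ?S \<le> (1 - \<delta>') * (?S - \<delta>' * ?S)"
      proof -
        have "(1 - \<delta>') * (?S - \<delta>' * ?S) = (1 - 2 * \<delta>' + \<delta>'\<^sup>2) * ?S" by (simp add: power2_eq_square algebra_simps)
        moreover have "1 - \<delta> \<le> 1 - 2 * \<delta>' + \<delta>'\<^sup>2" using assms zero_le_power2[of \<delta>'] unfolding \<delta>'_def by linarith
        ultimately show ?thesis using S0 by (simp add: mult_right_mono)
      qed
      also have "\<dots> \<le> (1 - \<delta>') * (?S - real m)" using mS \<delta>' by (intro mult_left_mono) auto
      also have "\<dots> \<le> mean_range n s" using \<delta>' by (intro mean_range_ge m) auto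
      finally show "(1 - \<delta>) * ?S \<le> mean_range n s" .
      have "square_range n s \<le> (real n + 1) * (1 + 2 * real m)
          + 2 * (1 + \<delta>') * (real m * ?S + (1 + \<delta>') * (real m + 1 + ?T))"
        using \<delta>' by (intro square_range_le m) auto
      also have "\<dots> = (real n + 1) * (1 + 2 * real m) + 2 * (1 + \<delta>') * (real m * ?S + (1 + \<delta>') * (real m + 1))
          + 2 * (1 + \<delta>')\<^sup>2 * ?T" by (simp add: power2_eq_square algebra_simps)
      also have "\<dots> \<le> (real n + 1) * (1 + 2 * real m)
            + 3 * (real m * (real n + 1) + 2 * ((real m + 1) * (real n + 1)))
          + 2 * (1 + \<delta>')\<^sup>2 * ((1 / 2 + \<delta>') * ?S\<^sup>2)"
      proof (intro add_mono mult_mono order_refl elim(1))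
        show "real m + 1 \<le> (real m + 1) * (real n + 1)" by (simp add: algebra_simps)
      qed (use \<delta>' S0 escape_total_le[of n] in \<open>auto intro!: add_nonneg_nonneg mult_nonneg_nonneg sum_nonneg mean_escape_bounds escape_total_nonneg\<close>)
      also have "\<dots> = c * (real n + 1) + (1 + \<delta>')\<^sup>2 * (1 + 2 * \<delta>') * ?S\<^sup>2"
        by (simp add: c_def algebra_simps)
      also have "\<dots> \<le> \<delta>' * ?S\<^sup>2 + (1 + \<delta>')\<^sup>2 * (1 + 2 * \<delta>') * ?S\<^sup>2" using dom by simp
      also have "\<dots> = (\<delta>' + (1 + \<delta>')\<^sup>2 * (1 + 2 * \<delta>')) * ?S\<^sup>2" by (simp add: algebra_simps)
      also have "\<dots> \<le> (1 + \<delta>) * ?S\<^sup>2"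
      proof (rule mult_right_mono)
        have "\<delta>'\<^sup>2 \<le> \<delta>'" "\<delta>' ^ 3 \<le> \<delta>'" using \<delta>' by (auto simp: power2_eq_square power3_eq_cube mult_le_one mult_left_le)
        moreover have "(1 + \<delta>')\<^sup>2 * (1 + 2 * \<delta>') = 1 + 4 * \<delta>' + 5 * \<delta>'\<^sup>2 + 2 * \<delta>' ^ 3"
          by (simp add: power2_eq_square power3_eq_cube algebra_simps)
        ultimately show "\<delta>' + (1 + \<delta>')\<^sup>2 * (1 + 2 * \<delta>') \<le> 1 + \<delta>" using \<delta>' by (simp add: \<delta>'_def)
      qed simp
      finally show "square_range n s \<le> (1 + \<delta>) * ?S\<^sup>2" .
    qed
  qed
qed

end

section \<open>Reachability and mixing of the internal chain\<close>

context internal_walk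
begin

text \<open>
\<open>reach n s t\<close> is the probability of going from \<open>s\<close> to \<open>t\<close> in \<open>n\<close> steps.
\<close>

definition reach :: "nat \<Rightarrow> 'v \<times> 'e \<Rightarrow> 'v \<times> 'e \<Rightarrow> real" where
  "reach n s t = (avg ^^ n) (\<lambda>u. of_bool (u = t)) s"

lemma reach_mult_le:
  assumes "bdd f" "\<And>s. 0 \<le> f s" shows "reach n s t * f t \<le> (avg ^^ n) f s"
proof -
  have "f t * reach n s t = (avg ^^ n) (\<lambda>u. f t * of_bool (u = t)) s"
    by (simp add: reach_def avg_pow_mult)
  also have "\<dots> \<le> (avg ^^ n) f s"
    using assms by (intro avg_pow_mono bdd_intros) auto
  finally show ?thesis by (simp add: mult.commute)
qed

lemma reach_shift: "reach n (x + z, j) (y + z, k) = reach n (x, j) (y, k)"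
  unfolding reach_def by (subst avg_pow_shift) (simp add: prod_eq_iff)

lemma reach_trans:
  assumes "0 < reach n s t" "0 < reach m t u" shows "0 < reach (n + m) s u"
proof -
  have "0 < reach n s t * reach m t u" using assms by simp
  also have "\<dots> \<le> reach (n + m) s u"
    unfolding reach_def[of m t u] reach_def[of "n + m"] funpow_add comp_def
    by (intro reach_mult_le bdd_intros avg_pow_nonneg) auto
  finally show ?thesis .
qed

lemma reach_loop:
  assumes "0 < reach n s (y, k)" "0 < reach m (0, k) (z, l)" shows "0 < reach (n + m) s (y + z, l)"
  using reach_trans[OF assms(1), of m "(y + z, l)"] assms(2) reach_shift[of m 0 y k z l]
  by (simp add: add.commute)

lemma ex_reach:
  assumes "bdd f" "\<And>s. 0 \<le> f s" "0 < (avg ^^ n) f s"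
  shows "\<exists>t. 0 < reach n s t \<and> 0 < f t"
  using assms(3)
proof (induction n arbitrary: s)
  case 0
  then show ?case by (auto simp: reach_def)
next
  case (Suc n)
  have "\<exists>t\<in>set_pmf (step s). 0 < (avg ^^ n) f t"
  proof (rule ccontr)
    assume "\<not> ?thesis"
    then have "(avg ^^ n) f t = 0" if "t \<in> set_pmf (step s)" for t
      using that avg_pow_nonneg[of f n t] assms(2) by (meson linorder_not_le order_antisym)
    then have "avg ((avg ^^ n) f) s = 0"
      unfolding avg_def by (intro integral_eq_zero_AE) (auto simp: AE_measure_pmf_iff)
    then show False using Suc.prems by simp
  qed
  then obtain t where t: "t \<in> set_pmf (step s)" "0 < (avg ^^ n) f t" by blast
  from Suc.IH[OF t(2)] obtain u where u: "0 < reach n t u" "0 < f u" by blast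
  have "0 < pmf (step s) t * reach n t u" using t u by (simp add: set_pmf_iff pmf_positive)
  also have "\<dots> \<le> reach (Suc n) s u"
    unfolding reach_def funpow.simps comp_def by (intro avg_ge_point bdd_intros avg_pow_nonneg) auto
  finally show ?case using u by blast
qed

lemma internal_avg_pow: "(internal_avg ^^ n) f j = (avg ^^ n) (\<lambda>s. f (snd s)) (x, j)"
  by (simp add: avg_pow_of_internal)

lemma internal_avg_pow_ge:
  assumes "\<And>i. L \<le> f i" shows "L \<le> (internal_avg ^^ n) f j"
  unfolding internal_avg_pow[where x = 0]
  using avg_pow_mono[of "\<lambda>_. L" "\<lambda>s. f (snd s)" n] assms by (auto intro: bdd_intros)

lemma internal_avg_pow_le:
  assumes "\<And>i. f i \<le> U" shows "(internal_avg ^^ n) f j \<le> U"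
  unfolding internal_avg_pow[where x = 0] by (intro avg_pow_le_const bdd_intros assms)

text \<open>
Doeblin's argument: if all entries of the \<open>N\<close>-th power are at least \<open>c\<close>, then all averages of \<open>f\<close> put the
weight \<open>c\<close> on one and the same value \<open>f k\<close>, so both bounds for \<open>f\<close> move towards it.
\<close>

lemma doeblin_contraction:
  assumes c: "\<And>j k. c \<le> (internal_avg ^^ N) (\<lambda>i. of_bool (i = k)) j"
    and LU: "\<And>i. L \<le> f i" "\<And>i. f i \<le> U"
  shows "\<exists>L' U'. (\<forall>j. L' \<le> (internal_avg ^^ N) f j \<and> (internal_avg ^^ N) f j \<le> U') \<and> U' - L' = (1 - c) * (U - L)"
proof -
  fix k :: 'e
  have bnd: "c * g k \<le> (internal_avg ^^ N) g j" if "\<And>i. 0 \<le> g i" for g j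
  proof -
    have "c * g k \<le> (internal_avg ^^ N) (\<lambda>i. of_bool (i = k)) j * g k"
      by (intro mult_right_mono c that)
    also have "\<dots> = (avg ^^ N) (\<lambda>s. g k * of_bool (snd s = k)) (0, j)"
      by (simp add: internal_avg_pow[where x = 0] avg_pow_mult mult.commute)
    also have "\<dots> \<le> (avg ^^ N) (\<lambda>s. g (snd s)) (0, j)"
      using that by (intro avg_pow_mono bdd_intros) auto
    finally show ?thesis by (simp add: internal_avg_pow[where x = 0])
  qed
  have lin: "(internal_avg ^^ N) (\<lambda>i. a + b * f i) j = a + b * (internal_avg ^^ N) f j" for a b j
    unfolding internal_avg_pow[where x = 0] by (subst avg_pow_add) (auto intro!: bdd_intros simp: avg_pow_mult)
  have "L + c * (f k - L) \<le> (internal_avg ^^ N) f j" for j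
    using bnd[of "\<lambda>i. - L + 1 * f i" j] LU unfolding lin by (simp add: algebra_simps)
  moreover have "(internal_avg ^^ N) f j \<le> U - c * (U - f k)" for j
    using bnd[of "\<lambda>i. U + (-1) * f i" j] LU unfolding lin by (simp add: algebra_simps)
  ultimately show ?thesis
    by (intro exI[of _ "L + c * (f k - L)"] exI[of _ "U - c * (U - f k)"]) (auto simp: algebra_simps)
qed

lemma doeblin_contraction_pow:
  assumes c: "\<And>j k. c \<le> (internal_avg ^^ N) (\<lambda>i. of_bool (i = k)) j"
    and LU: "\<And>i. L \<le> f i" "\<And>i. f i \<le> U"
  shows "\<exists>L' U'. (\<forall>j. L' \<le> (internal_avg ^^ (N * t)) f j \<and> (internal_avg ^^ (N * t)) f j \<le> U') \<and> U' - L' = (1 - c) ^ t * (U - L)"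
proof (induction t)
  case 0
  show ?case using LU by auto
next
  case (Suc t)
  then obtain L' U' where 1: "\<And>j. L' \<le> (internal_avg ^^ (N * t)) f j" "\<And>j. (internal_avg ^^ (N * t)) f j \<le> U'"
    "U' - L' = (1 - c) ^ t * (U - L)" by blast
  obtain L'' U'' where
    "\<forall>j. L'' \<le> (internal_avg ^^ N) ((internal_avg ^^ (N * t)) f) j \<and> (internal_avg ^^ N) ((internal_avg ^^ (N * t)) f) j \<le> U''"
    "U'' - L'' = (1 - c) * (U' - L')"
    using doeblin_contraction[where f = "(internal_avg ^^ (N * t)) f", OF c 1(1,2)] by blast
  then show ?case by (intro exI[of _ L''] exI[of _ U'']) (simp add: funpow_add 1(3))
qed

text \<open>
A nonnegative \<open>f\<close> is at most its stationary mean divided by the smallest weight of \<open>\<mu>\<close>. The contraction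
of its range, in which the mean always lies, is therefore a relative error.
\<close>

lemma internal_avg_mixing:
  assumes pos: "\<And>j k. 0 < (internal_avg ^^ N) (\<lambda>i. of_bool (i = k)) j"
    and \<mu>: "\<And>j. 0 < \<mu> j" "(\<Sum>j\<in>UNIV. \<mu> j) = 1"
    and stat: "\<And>f. (\<Sum>j\<in>UNIV. \<mu> j * internal_avg f j) = (\<Sum>j\<in>UNIV. \<mu> j * f j)"
    and \<delta>: "0 < \<delta>"
  shows "\<exists>m. \<forall>k\<ge>m. \<forall>f j. (\<forall>i. 0 \<le> f i) \<longrightarrow>
     (1 - \<delta>) * (\<Sum>i\<in>UNIV. \<mu> i * f i) \<le> (internal_avg ^^ k) f j \<and> (internal_avg ^^ k) f j \<le> (1 + \<delta>) * (\<Sum>i\<in>UNIV. \<mu> i * f i)"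
proof -
  define c where "c = Min (range (\<lambda>(j, k). (internal_avg ^^ N) (\<lambda>i. of_bool (i = k)) j))"
  have c: "c \<le> (internal_avg ^^ N) (\<lambda>i. of_bool (i = k)) j" for j k
    unfolding c_def by (intro Min_le) (auto intro!: rev_image_eqI[of "(j, k)"])
  have c0: "0 < c" unfolding c_def using pos by (subst Min_gr_iff) auto
  have c1: "c \<le> 1" using c[of undefined undefined] internal_avg_pow_le[of "\<lambda>i. of_bool (i = undefined)" 1 N undefined] by simp
  define \<mu>0 where "\<mu>0 = Min (range \<mu>)"
  have \<mu>0: "\<mu>0 \<le> \<mu> i" for i unfolding \<mu>0_def by (intro Min_le) auto
  have \<mu>00: "0 < \<mu>0" unfolding \<mu>0_def using \<mu> by (subst Min_gr_iff) auto
  have "(\<lambda>t. (1 - c) ^ t) \<longlonglongrightarrow> 0" using c0 c1 by (intro LIMSEQ_realpow_zero) auto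
  then have "eventually (\<lambda>t. (1 - c) ^ t < \<delta> * \<mu>0) sequentially"
    using \<delta> \<mu>00 by (intro order_tendstoD(2)) auto
  then obtain t where t: "(1 - c) ^ t < \<delta> * \<mu>0" by (auto simp: eventually_sequentially)
  show ?thesis
  proof (intro exI allI impI)
    fix k and f :: "'e \<Rightarrow> real" and j assume k: "N * t \<le> k" and f: "\<forall>i. 0 \<le> f i"
    define m where "m = (\<Sum>i\<in>UNIV. \<mu> i * f i)"
    have m0: "0 \<le> m" unfolding m_def using f \<mu> by (intro sum_nonneg mult_nonneg_nonneg) (auto simp: less_imp_le)
    have fU: "f i \<le> m / \<mu>0" for i
    proof -
      have "\<mu>0 * f i \<le> \<mu> i * f i" using \<mu>0 f by (intro mult_right_mono) auto
      also have "\<dots> \<le> m" unfolding m_def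
        by (rule member_le_sum[where f = "\<lambda>i. \<mu> i * f i"]) (use f \<mu> in \<open>auto simp: less_imp_le\<close>)
      finally show ?thesis using \<mu>00 by (simp add: field_simps)
    qed
    obtain L U where LU: "\<forall>j. L \<le> (internal_avg ^^ (N * t)) f j \<and> (internal_avg ^^ (N * t)) f j \<le> U"
      "U - L = (1 - c) ^ t * (m / \<mu>0 - 0)"
      using doeblin_contraction_pow[where f = f, OF c spec[OF f] fU, of t] by blast
    have "(internal_avg ^^ k) f = (internal_avg ^^ (k - N * t)) ((internal_avg ^^ (N * t)) f)"
      using k by (simp add: funpow_add[symmetric, THEN fun_cong, unfolded comp_def])
    then have kLU: "L \<le> (internal_avg ^^ k) f i" "(internal_avg ^^ k) f i \<le> U" for i
      using LU by (auto intro: internal_avg_pow_ge internal_avg_pow_le)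
    have mk: "m = (\<Sum>i\<in>UNIV. \<mu> i * (internal_avg ^^ k) f i)" unfolding m_def by (induction k) (auto simp: stat)
    have "(\<Sum>i\<in>UNIV. \<mu> i * L) \<le> m" "m \<le> (\<Sum>i\<in>UNIV. \<mu> i * U)"
      unfolding mk by (intro sum_mono mult_left_mono kLU less_imp_le[OF \<mu>(1)])+
    then have "L \<le> m" "m \<le> U" by (simp_all add: sum_distrib_right[symmetric] \<mu>)
    moreover have "U - L \<le> \<delta> * m"
    proof -
      have "(1 - c) ^ t * (m / \<mu>0) \<le> (\<delta> * \<mu>0) * (m / \<mu>0)" using t m0 \<mu>00 by (intro mult_right_mono) auto
      then show ?thesis using LU(2) \<mu>00 by simp
    qed
    ultimately show "(1 - \<delta>) * (\<Sum>i\<in>UNIV. \<mu> i * f i) \<le> (internal_avg ^^ k) f j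
        \<and> (internal_avg ^^ k) f j \<le> (1 + \<delta>) * (\<Sum>i\<in>UNIV. \<mu> i * f i)"
      unfolding m_def[symmetric] using kLU[of j] by (simp add: algebra_simps)
  qed
qed

end


section \<open>Return probabilities decay at least like 1/n\<close>

text \<open>
With \<open>z = p + 1 + m * \<alpha> / 2\<close> this is one induction step for the expectation of \<open>1 / (p + 1 + B)\<close>, where
\<open>B\<close> is binomial with parameters \<open>m\<close> and \<open>\<alpha>\<close>. Halving the rate \<open>\<alpha>\<close> on the right absorbs the
convexity.
\<close>

lemma coin_flip_rate:
  fixes z \<alpha> :: real
  assumes "1 \<le> z" "0 < \<alpha>" "\<alpha> \<le> 1"
  shows "(1 - \<alpha>) / z + \<alpha> / (z + 1) \<le> 1 / (z + \<alpha> / 2)"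
proof -
  have "((1 - \<alpha>) * (z + 1) + \<alpha> * z) * (z + \<alpha> / 2) \<le> z * (z + 1)"
  proof -
    have "z * (z + 1) - ((1 - \<alpha>) * (z + 1) + \<alpha> * z) * (z + \<alpha> / 2) = \<alpha> / 2 * (z - 1 + \<alpha>)"
      by (simp add: field_simps)
    moreover have "0 \<le> \<alpha> / 2 * (z - 1 + \<alpha>)" using assms by simp
    ultimately show ?thesis by linarith
  qed
  moreover have "(1 - \<alpha>) / z + \<alpha> / (z + 1) = ((1 - \<alpha>) * (z + 1) + \<alpha> * z) / (z * (z + 1))"
    using assms by (simp add: add_frac_eq)
  ultimately show ?thesis using assms by (simp add: divide_le_eq le_divide_eq)
qed

locale lattice_walk = internal_walk jump
  for jump :: "'e::finite \<Rightarrow> ((int ^ 'd::finite) \<times> 'e) pmf"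
begin

lemma bdd_coin_flip: "bdd f \<Longrightarrow> bdd (coin_flip v f)"
proof -
  assume "bdd f"
  then obtain B where B: "\<And>s. \<bar>f s\<bar> \<le> B" by (auto simp: bdd_def)
  show ?thesis
  proof (rule bddI[of _ B])
    fix s show "\<bar>coin_flip v f s\<bar> \<le> B"
      using abs_triangle_ineq[of "f s" "f (fst s + v, snd s)"] B[of s] B[of "(fst s + v, snd s)"]
      by (simp add: coin_flip_def)
  qed
qed

lemma bdd_coin_flips: "bdd f \<Longrightarrow> bdd ((coin_flip v ^^ n) f)"
  by (induction n) (auto intro: bdd_coin_flip)

lemma avg_coin_flip: "bdd f \<Longrightarrow> avg (coin_flip v f) = coin_flip v (avg f)"
proof (rule ext)
  fix s assume f: "bdd f"
  then obtain B where B: "\<And>s. \<bar>f s\<bar> \<le> B" by (auto simp: bdd_def)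
  have f': "bdd (\<lambda>t. f (fst t + v, snd t))" by (rule bddI[of _ B]) (rule B)
  have "avg (coin_flip v f) s = avg (\<lambda>t. (1/2) * (f t + f (fst t + v, snd t))) s"
    by (intro arg_cong[where f = "\<lambda>f. avg f s"]) (simp add: fun_eq_iff coin_flip_def)
  also have "\<dots> = (1/2) * (avg f s + avg (\<lambda>t. f (fst t + v, snd t)) s)"
    unfolding avg_mult by (subst avg_add[OF f f']) simp
  also have "avg (\<lambda>t. f (fst t + v, snd t)) s = avg f (fst s + v, snd s)"
    using avg_shift[of f "fst s" v "snd s"] by simp
  finally show "avg (coin_flip v f) s = coin_flip v (avg f) s" by (simp add: coin_flip_def[of v "avg f" s])
qed

lemma avg_pow_coin_flips: "bdd f \<Longrightarrow> (avg ^^ n) ((coin_flip v ^^ p) f) = (coin_flip v ^^ p) ((avg ^^ n) f)"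
proof (induction n)
  case (Suc n)
  have "avg ((coin_flip v ^^ p) g) = (coin_flip v ^^ p) (avg g)" if "bdd g" for g
    using that by (induction p) (auto simp: avg_coin_flip bdd_coin_flips)
  then show ?case using Suc by (simp add: bdd_avg_pow)
qed simp

text \<open>
The three points carry the weights of a coin flip between \<open>s1\<close> and \<open>s2\<close> and of one between \<open>s1\<close> and
\<open>s3\<close>, each performed with probability \<open>\<alpha>\<close>; on the rest of the space \<open>F\<close> is bounded by \<open>M0\<close>.
\<close>

lemma avg_pow_three_points:
  assumes bF: "bdd F" and F: "\<And>s. F s \<le> M0"
    and ne: "s1 \<noteq> s2" "s1 \<noteq> s3"
    and M: "F s1 + F s2 \<le> 2 * M1" "F s1 + F s3 \<le> 2 * M2"
    and \<alpha>: "0 \<le> \<alpha>" "\<alpha> \<le> reach n s s1" "\<alpha> \<le> reach n s s2" "\<alpha> \<le> reach n s s3"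
  shows "(avg ^^ n) F s \<le> (1 - 2 * \<alpha>) * M0 + \<alpha> * M1 + \<alpha> * M2"
proof -
  let ?g = "\<lambda>t. M0 - F t"
  \<comment> \<open>The point s1 belongs to both coin flips and is counted twice; as s1 differs from s2 and s3, the
weights 1/2 add up to at most 1 at every point.\<close>
  let ?p = "\<lambda>u t. (?g u / 2) * of_bool (t = u)"
  have b: "bdd (?p u)" for u by (intro bdd_intros)
  have e: "(avg ^^ n) (?p u) s = reach n s u * ?g u / 2" for u
    unfolding reach_def by (subst avg_pow_mult) simp
  have "(\<alpha> * ?g s1 + \<alpha> * ?g s1 + \<alpha> * ?g s2 + \<alpha> * ?g s3) / 2
      \<le> (reach n s s1 * ?g s1 + reach n s s1 * ?g s1 + reach n s s2 * ?g s2 + reach n s s3 * ?g s3) / 2"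
    using \<alpha> F by (intro divide_right_mono add_mono mult_right_mono) auto
  also have "\<dots> = (avg ^^ n) (\<lambda>t. ?p s1 t + ?p s1 t + ?p s2 t + ?p s3 t) s"
    by (simp only: avg_pow_add b bdd_add e add_divide_distrib)
  also have "\<dots> \<le> (avg ^^ n) ?g s"
  proof (intro avg_pow_mono bdd_intros bF)
    fix t show "?p s1 t + ?p s1 t + ?p s2 t + ?p s3 t \<le> ?g t"
      using ne F[of t] by (auto simp: of_bool_def)
  qed
  also have "(\<lambda>t. M0 - F t) = (\<lambda>t. M0 + (-1) * F t)" by simp
  also have "(avg ^^ n) \<dots> s = M0 - (avg ^^ n) F s"
    unfolding avg_pow_add[OF bdd_const bdd_mult[OF bdd_const bF]] avg_pow_mult by simp
  finally have "(avg ^^ n) F s \<le> M0 - \<alpha> * (4 * M0 - (F s1 + F s2) - (F s1 + F s3)) / 2"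
    by (simp add: algebra_simps add_divide_distrib diff_divide_distrib)
  also have "\<alpha> * (4 * M0 - 2 * M1 - 2 * M2) \<le> \<alpha> * (4 * M0 - (F s1 + F s2) - (F s1 + F s3))"
    using M \<alpha> by (intro mult_left_mono) auto
  then have "M0 - \<alpha> * (4 * M0 - (F s1 + F s2) - (F s1 + F s3)) / 2 \<le> M0 - \<alpha> * (4 * M0 - 2 * M1 - 2 * M2) / 2"
    by simp
  also have "\<dots> = (1 - 2 * \<alpha>) * M0 + \<alpha> * M1 + \<alpha> * M2" by (simp add: field_simps)
  finally show ?thesis .
qed

text \<open>
The function is smoothed by \<open>p\<close> and \<open>q\<close> extra coin flips, so that the induction over the number of blocks can
trade one block for one more flip in either direction. This needs that flips and steps commute,
by translation invariance. The bound \<open>\<beta> m p\<close> says that \<open>m\<close> blocks are worth at least \<open>\<alpha> m / 2\<close>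
flips.
\<close>

lemma return_prob_bound:
  fixes v w :: "int ^ 'd"
  assumes indep: "\<And>s t s' t' :: nat. of_nat s *s v + of_nat t *s w = of_nat s' *s v + of_nat t' *s w
                    \<Longrightarrow> s = s' \<and> t = t'"
    and \<alpha>: "0 < \<alpha>" "\<And>j. \<alpha> \<le> reach B (0, j) (a j, j0)" "\<And>j. \<alpha> \<le> reach B (0, j) (a j + v, j0)"
      "\<And>j. \<alpha> \<le> reach B (0, j) (a j + w, j0)"
    and B: "0 < B"
  shows "\<exists>C. \<forall>k j i. return_prob k j i \<le> C / (real k + 1)"
proof -
  have vw: "v \<noteq> 0" "w \<noteq> 0" using indep[of 1 0 0 0] indep[of 0 1 0 0] by auto
  have "reach B (0, j0) (a j0, j0) \<le> 1"
    unfolding reach_def by (intro avg_pow_le_const bdd_intros) simp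
  then have \<alpha>1: "\<alpha> \<le> 1" using \<alpha>(2)[of j0] by linarith
  define \<beta> where "\<beta> m p = 1 / (real p + 1 + \<alpha> / 2 * real m)" for m p :: nat
  have claim: "(coin_flip v ^^ p) ((coin_flip w ^^ q) ((avg ^^ (B * m)) (\<lambda>u. of_bool (u = (0, i))))) s
      \<le> (\<beta> m p + \<beta> m q) / 2" for m p q i s
  proof (induction m arbitrary: p q s)
    case 0
    show ?case using two_coin_flips_le[OF indep, where p = p and q = q and k = i and x = "fst s" and j = "snd s"] by (simp add: \<beta>_def)
  next
    case (Suc m)
    let ?G = "(avg ^^ (B * m)) (\<lambda>u. of_bool (u = (0, i)))"
    let ?F = "(coin_flip v ^^ p) ((coin_flip w ^^ q) ?G)"
    have bG: "bdd ?G" by (intro bdd_intros)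
    have bF: "bdd ?F" by (intro bdd_coin_flips bG)
    obtain x j where s: "s = (x, j)" by (cases s)
    have rs: "reach B (x, j) (y + x, k) = reach B (0, j) (y, k)" for y k
      using reach_shift[of B 0 x j y k] by simp
    have "(coin_flip v ^^ p) ((coin_flip w ^^ q) ((avg ^^ (B * Suc m)) (\<lambda>u. of_bool (u = (0, i)))))
        = (avg ^^ B) ?F"
      by (simp add: avg_pow_coin_flips bG bdd_coin_flips funpow_add)
    moreover have "(avg ^^ B) ?F s \<le> (1 - 2 * \<alpha>) * ((\<beta> m p + \<beta> m q) / 2)
        + \<alpha> * ((\<beta> m (Suc p) + \<beta> m q) / 2) + \<alpha> * ((\<beta> m p + \<beta> m (Suc q)) / 2)"
    proof (rule avg_pow_three_points[OF bF, where ?s1.0 = "(a j + x, j0)" and ?s2.0 = "(a j + v + x, j0)"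
          and ?s3.0 = "(a j + w + x, j0)"])
      show "?F t \<le> (\<beta> m p + \<beta> m q) / 2" for t by (rule Suc.IH)
      have "coin_flip v ?F t \<le> (\<beta> m (Suc p) + \<beta> m q) / 2" for t
        using Suc.IH[of "Suc p" q t] by simp
      from this[of "(a j + x, j0)"]
      show "?F (a j + x, j0) + ?F (a j + v + x, j0) \<le> 2 * ((\<beta> m (Suc p) + \<beta> m q) / 2)"
        by (simp add: coin_flip_def algebra_simps)
      have "coin_flip w ?F t \<le> (\<beta> m p + \<beta> m (Suc q)) / 2" for t
        using Suc.IH[of p "Suc q" t] by (simp add: coin_flip_commute_funpow)
      from this[of "(a j + x, j0)"]
      show "?F (a j + x, j0) + ?F (a j + w + x, j0) \<le> 2 * ((\<beta> m p + \<beta> m (Suc q)) / 2)"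
        by (simp add: coin_flip_def algebra_simps)
    qed (use \<alpha> vw in \<open>auto simp: s rs\<close>)
    moreover have "(1 - \<alpha>) * \<beta> m p + \<alpha> * \<beta> m (Suc p) \<le> \<beta> (Suc m) p" for p
      using coin_flip_rate[of "real p + 1 + \<alpha> / 2 * real m" \<alpha>] \<alpha>(1) \<alpha>1
      by (simp add: \<beta>_def add_divide_distrib algebra_simps)
    from this[of p] this[of q] have "(1 - 2 * \<alpha>) * ((\<beta> m p + \<beta> m q) / 2)
        + \<alpha> * ((\<beta> m (Suc p) + \<beta> m q) / 2) + \<alpha> * ((\<beta> m p + \<beta> m (Suc q)) / 2) \<le> (\<beta> (Suc m) p + \<beta> (Suc m) q) / 2"
      by (simp add: field_simps)
    ultimately show ?case by simp
  qed
  have "return_prob k j i \<le> (2 * real B / \<alpha>) / (real k + 1)" for k j i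
  proof -
    define m where "m = k div B"
    have "return_prob k j i = (avg ^^ (k mod B + B * m)) (\<lambda>u. of_bool (u = (0, i))) (0, j)"
      by (simp add: return_prob_def m_def)
    also have "\<dots> \<le> (\<beta> m 0 + \<beta> m 0) / 2"
      unfolding funpow_add comp_def
      by (rule avg_pow_le_const) (use claim[of 0 0 m i] in \<open>auto intro!: bdd_intros\<close>)
    also have "\<dots> = \<beta> m 0" by simp
    also have "\<dots> = 1 / (1 + \<alpha> / 2 * real m)" by (simp add: \<beta>_def)
    also have "\<dots> \<le> (2 * real B / \<alpha>) / (real k + 1)"
    proof -
      have "k < B * (m + 1)" using dividend_less_times_div[of B k] B by (simp add: m_def)
      then have "k + 1 \<le> B * (m + 1)" by simp
      then have "real (k + 1) \<le> real (B * (m + 1))" by (simp only: of_nat_le_iff)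
      then have "\<alpha> / 2 * (real k + 1) \<le> \<alpha> / 2 * (real B * (real m + 1))"
        using \<alpha>(1) by (intro mult_left_mono) (auto simp: algebra_simps)
      also have "\<dots> = real B * (\<alpha> / 2 * real m + \<alpha> / 2)" by (simp add: algebra_simps)
      also have "\<dots> \<le> real B * (1 + \<alpha> / 2 * real m)" using \<alpha>1 by (intro mult_left_mono) auto
      finally have "\<alpha> / 2 * (real k + 1) \<le> real B * (1 + \<alpha> / 2 * real m)" .
      define D P K where "D = 2 * real B / \<alpha>" and "P = 1 + \<alpha> / 2 * real m" and "K = real k + 1"
      have "\<alpha> / 2 * K \<le> real B * P" unfolding K_def P_def by fact
      then have "K \<le> D * P" using \<alpha>(1) by (simp add: D_def pos_le_divide_eq mult_ac)
      moreover have "0 < P" using \<alpha>(1) by (simp add: P_def add_pos_nonneg)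
      moreover have "0 < K" by (simp add: K_def)
      ultimately have "1 / P \<le> D / K" by (simp add: divide_simps mult.commute)
      then show ?thesis unfolding D_def P_def K_def .
    qed
    finally show ?thesis .
  qed
  then show ?thesis by blast
qed

end

section \<open>Jump kernels give mixing walks\<close>

text \<open>
The smallest positive difference \<open>d\<close> of two elements of \<open>A\<close> and 0 divides all elements, since a
remainder would be a smaller difference; so \<open>d = 1\<close>. Two consecutive elements \<open>b\<close> and \<open>b + 1\<close> then
represent every \<open>n \<ge> b\<^sup>2\<close>.
\<close>

lemma additive_set_cofinite:
  fixes A :: "nat set"
  assumes add: "\<And>a b. a \<in> A \<Longrightarrow> b \<in> A \<Longrightarrow> a + b \<in> A" and gcd: "Gcd A = 1"
  shows "\<exists>N. \<forall>n\<ge>N. n \<in> A"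
proof -
  define A0 where "A0 = insert 0 A"
  have add0: "a + b \<in> A0" if "a \<in> A0" "b \<in> A0" for a b using that add by (auto simp: A0_def)
  have mult0: "k * a \<in> A0" if "a \<in> A0" for k a
  proof (induction k)
    case 0
    show ?case by (simp add: A0_def)
  next
    case (Suc k)
    then show ?case using add0[OF that Suc] by simp
  qed
  have "\<not> A \<subseteq> {0}" using gcd Gcd_0_iff[of A] by auto
  then obtain a0 where a0: "a0 \<in> A" "a0 > 0" by auto
  define P where "P d \<longleftrightarrow> d > 0 \<and> (\<exists>b\<in>A0. b + d \<in> A0)" for d
  have "P a0" using a0 by (auto simp: P_def A0_def)
  define d where "d = (LEAST d. P d)"
  have "P d" unfolding d_def by (rule LeastI[of P a0]) fact
  then obtain b where b: "d > 0" "b \<in> A0" "b + d \<in> A0" by (auto simp: P_def)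
  have "d dvd x" if "x \<in> A" for x
  proof (rule ccontr)
    assume nd: "\<not> d dvd x"
    define q r where "q = x div d" and "r = x mod d"
    have r: "0 < r" "r < d" using nd b by (auto simp: r_def dvd_eq_mod_eq_0)
    have x: "x = q * d + r" by (simp add: q_def r_def)
    have "q * (b + d) + r = x + q * b" by (simp add: x algebra_simps)
    moreover have "x + q * b \<in> A0" using that by (intro add0 mult0 b) (simp add: A0_def)
    ultimately have "q * (b + d) + r \<in> A0" by (simp only:)
    moreover have "q * (b + d) \<in> A0" by (intro mult0 b)
    ultimately have "P r" unfolding P_def using r by blast
    then have "d \<le> r" unfolding d_def by (rule Least_le)
    then show False using r by simp
  qed
  then have "d dvd Gcd A" by (rule Gcd_greatest)
  then have d: "d = 1" using gcd by simp
  have "n \<in> A" if n: "n \<ge> b * b + b + 1" for n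
  proof -
    have "n \<in> A0"
    proof (cases "b = 0")
      case True
      then show ?thesis using mult0[of 1 n] b d by simp
    next
      case False
      define t r where "t = n div b" and "r = n mod b"
      have e: "n = t * b + r" by (simp add: t_def r_def)
      have "r < b" using False by (simp add: r_def)
      moreover have "b \<le> t" unfolding t_def using n False by (simp add: less_eq_div_iff_mult_less_eq)
      ultimately have "r * b \<le> t * b" by simp
      then have n': "n = (t - r) * b + r * (b + 1)" by (simp add: e diff_mult_distrib)
      have "(t - r) * b \<in> A0" "r * (b + 1) \<in> A0"
        using mult0[OF b(2), of "t - r"] mult0[OF b(3), of r] d by simp_all
      then show ?thesis unfolding n' by (rule add0)
    qed
    then show ?thesis using n by (auto simp: A0_def)
  qed
  then show ?thesis by blast
qed

text \<open>
If all pairs in \<open>D\<close> had determinant 0, then so would all pairs in the group it generates, as the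
determinant is additive in each argument.
\<close>

lemma ex_independent_differences:
  fixes D :: "(int ^ 2) set"
  assumes "group_closure D = UNIV"
  shows "\<exists>v\<in>D. \<exists>w\<in>D. \<forall>s t s' t' :: nat.
     of_nat s *s v + of_nat t *s w = of_nat s' *s v + of_nat t' *s w \<longrightarrow> s = s' \<and> t = t'"
proof -
  define det where "det v w = v $ 1 * w $ 2 - v $ 2 * w $ 1" for v w :: "int ^ 2"
  have ker: "det v u = 0" if "\<And>w. w \<in> D \<Longrightarrow> det v w = 0" for v u
  proof -
    have "u \<in> group_closure D" using assms by simp
    then show ?thesis
    proof induction
      case (base w)
      then show ?case using that by (auto simp: det_def)
    next
      case (diff w w')
      have "det v (w - w') = det v w - det v w'" by (simp add: det_def algebra_simps)
      then show ?case using diff by simp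
    qed
  qed
  have "\<exists>v\<in>D. \<exists>w\<in>D. det v w \<noteq> 0"
  proof (rule ccontr)
    assume none: "\<not> ?thesis"
    have 1: "det v u = 0" if "v \<in> D" for v u by (rule ker) (use that none in auto)
    have 2: "det u v = 0" if "v \<in> D" for v u using 1[OF that, of u] by (simp add: det_def mult.commute)
    have "det u u' = 0" for u u' by (rule ker) (rule 2)
    from this[of "\<chi> i. if i = 1 then 1 else 0" "\<chi> i. if i = 1 then 0 else 1"]
    have "(if (1::2) = 1 then 1 else 0) * (if (2::2) = 1 then 0 else 1)
        - (if (2::2) = 1 then 1 else 0) * (if (1::2) = 1 then 0 else 1) = (0::int)"
      unfolding det_def vec_lambda_beta .
    moreover have "(2::2) \<noteq> 1" by simp
    ultimately show False by (simp only: if_True if_False) simp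
  qed
  then obtain v w where vw: "v \<in> D" "w \<in> D" "det v w \<noteq> 0" by blast
  have "s = s' \<and> t = t'"
    if e: "of_nat s *s v + of_nat t *s w = of_nat s' *s v + of_nat t' *s w" for s t s' t' :: nat
  proof -
    have c: "int s * v $ i + int t * w $ i = int s' * v $ i + int t' * w $ i" for i
      using arg_cong[OF e, of "\<lambda>x. x $ i"] by simp
    have "(int s - int s') * det v w = 0"
      unfolding det_def using c[of 1] c[of 2] by algebra
    moreover have "(int t - int t') * det v w = 0"
      unfolding det_def using c[of 1] c[of 2] by algebra
    ultimately show ?thesis using vw(3) by simp
  qed
  then show ?thesis using vw by blast
qed

definition jump_law :: "('d::finite, 'e::finite) jump_kernel \<Rightarrow> 'e \<Rightarrow> ((int ^ 'd) \<times> 'e) pmf" where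
  "jump_law p j = embed_pmf (\<lambda>(y, k). p y j k)"

lemma pmf_jump_law:
  assumes "stochastic_kernel p" shows "pmf (jump_law p j) (y, k) = p y j k"
proof -
  let ?f = "\<lambda>(y, k). p y j k"
  have nn: "0 \<le> ?f t" for t using assms by (cases t) (auto simp: stochastic_kernel_def)
  have hs: "(?f has_sum 1) UNIV" using assms by (auto simp: stochastic_kernel_def)
  then have "(\<lambda>t. norm (?f t)) summable_on UNIV"
    using nn by (simp add: has_sum_imp_summable)
  then have s: "Infinite_Set_Sum.abs_summable_on ?f UNIV" by (simp only: abs_summable_equivalent)
  have "(\<integral>\<^sup>+t. ennreal (?f t) \<partial>count_space UNIV) = 1"
    using nn_integral_conv_infsetsum[OF s nn] infsetsum_infsum[OF s] infsumI[OF hs] by simp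
  then have "pmf (jump_law p j) (y, k) = ?f (y, k)"
    unfolding jump_law_def by (intro pmf_embed_pmf nn)
  then show ?thesis by simp
qed

lemma has_sum_vec:
  fixes f :: "'i \<Rightarrow> ('a::{t2_space, comm_monoid_add}) ^ 'n::finite"
  assumes "\<And>i. ((\<lambda>x. f x $ i) has_sum s $ i) A" shows "(f has_sum s) A"
  using assms unfolding has_sum_def by (intro vec_tendstoI) simp

lemma internal_matrix_eq_prob:
  assumes "stochastic_kernel p"
  shows "internal_matrix p $ j $ k = measure_pmf.prob (jump_law p j) {t. snd t = k}"
proof -
  let ?q = "\<lambda>j k. measure_pmf.prob (jump_law p j) {t. snd t = k}"
  have "((\<lambda>y. p y j k) has_sum ?q j k) UNIV" for j k
  proof -
    let ?f = "pmf (jump_law p j)"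
    have s: "Infinite_Set_Sum.abs_summable_on ?f {t. snd t = k}" by (rule pmf_abs_summable)
    then have "(\<lambda>t. norm (?f t)) summable_on {t. snd t = k}"
      by (simp only: abs_summable_equivalent)
    then have "?f summable_on {t. snd t = k}" by simp
    then have hs: "(?f has_sum ?q j k) {t. snd t = k}"
      using infsetsum_infsum[OF s] by (simp add: measure_pmf_conv_infsetsum)
    have e: "(\<lambda>y. (y, k)) ` UNIV = {t. snd t = k}" by force
    have "(?f has_sum ?q j k) ((\<lambda>y. (y, k)) ` UNIV)" unfolding e by (rule hs)
    then have "((?f \<circ> (\<lambda>y. (y, k))) has_sum ?q j k) UNIV"
      by (rule has_sum_reindex[THEN iffD1, rotated]) (simp add: inj_on_def)
    then show ?thesis by (simp add: comp_def pmf_jump_law[OF assms])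
  qed
  then have "(jump_matrix p has_sum (\<chi> j k. ?q j k)) UNIV"
    by (intro has_sum_vec) (simp add: jump_matrix_def)
  then show ?thesis unfolding internal_matrix_def by (simp add: infsumI)
qed

context
  fixes p :: "('d::finite, 'e::finite) jump_kernel"
  assumes sk: "stochastic_kernel p"
begin

interpretation lattice_walk "jump_law p" .

lemma internal_avg_eq_matrix: "internal_avg f j = (internal_matrix p *v (\<chi> k. f k)) $ j"
proof -
  have e: "f (snd s) = (\<Sum>k\<in>UNIV. f k * of_bool (snd s = k))" for s :: "(int ^ 'd) \<times> 'e"
    by (simp add: of_bool_def if_distrib cong: if_cong)
  have st: "step (0, j) = jump_law p j" by (simp add: step_def)
  have "avg (\<lambda>s. of_bool (snd s = k)) (0, j) = internal_matrix p $ j $ k" for k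
  proof -
    have "(\<lambda>s :: (int ^ 'd) \<times> 'e. of_bool (snd s = k) :: real) = indicator {t. snd t = k}" by (auto simp: indicator_def)
    then show ?thesis by (simp add: avg_def st internal_matrix_eq_prob[OF sk])
  qed
  then have "internal_avg f j = (\<Sum>k\<in>UNIV. f k * internal_matrix p $ j $ k)"
    unfolding internal_avg_def e by (subst avg_sum) (auto intro!: bdd_intros simp: avg_mult)
  then show ?thesis by (simp add: matrix_vector_mult_def mult.commute)
qed

lemma internal_avg_pow_eq_matrix: "(internal_avg ^^ n) f j = (matrix_power (internal_matrix p) n *v (\<chi> k. f k)) $ j"
proof (induction n arbitrary: f)
  case (Suc n)
  have "(internal_avg ^^ Suc n) f j = (internal_avg ^^ n) (internal_avg f) j" by (simp only: funpow_Suc_right comp_def)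
  also have "\<dots> = (matrix_power (internal_matrix p) n *v (\<chi> k. internal_avg f k)) $ j" by (rule Suc)
  also have "(\<chi> k. internal_avg f k) = internal_matrix p *v (\<chi> k. f k)"
    by (simp add: vec_eq_iff internal_avg_eq_matrix)
  finally show ?case by (simp add: matrix_vector_mul_assoc)
qed simp

lemma matrix_power_eq_internal_avg: "matrix_power (internal_matrix p) n $ j $ k = (internal_avg ^^ n) (\<lambda>i. of_bool (i = k)) j"
  unfolding internal_avg_pow_eq_matrix
  by (simp add: matrix_vector_mult_def of_bool_def if_distrib cong: if_cong)

lemma matrix_power_nonneg: "0 \<le> matrix_power (internal_matrix p) n $ j $ k"
  unfolding matrix_power_eq_internal_avg by (rule internal_avg_pow_ge) simp

lemma matrix_power_add_pos:
  assumes "0 < matrix_power (internal_matrix p) n $ j $ k" "0 < matrix_power (internal_matrix p) m $ k $ l"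
  shows "0 < matrix_power (internal_matrix p) (n + m) $ j $ l"
proof -
  let ?q = "\<lambda>n j k. matrix_power (internal_matrix p) n $ j $ k"
  have "?q (n + m) j l = (internal_avg ^^ n) (\<lambda>i. ?q m i l) j"
    unfolding matrix_power_eq_internal_avg by (simp add: funpow_add)
  also have "\<dots> = (\<Sum>i\<in>UNIV. ?q n j i * ?q m i l)"
    unfolding internal_avg_pow_eq_matrix by (simp add: matrix_vector_mult_def)
  also have "\<dots> \<ge> ?q n j k * ?q m k l"
    by (rule member_le_sum[where f = "\<lambda>i. ?q n j i * ?q m i l"]) (auto simp: matrix_power_nonneg)
  finally show ?thesis using assms by (smt (verit) mult_pos_pos)
qed

lemma matrix_power_eventually_pos:
  assumes irr: "irreducible_chain (internal_matrix p)" and ap: "aperiodic_chain (internal_matrix p)"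
  shows "\<exists>N. \<forall>n\<ge>N. \<forall>j k. 0 < matrix_power (internal_matrix p) n $ j $ k"
proof -
  let ?q = "\<lambda>n j k. matrix_power (internal_matrix p) n $ j $ k"
  have "\<exists>N. \<forall>n\<ge>N. n \<in> {n. n \<ge> 1 \<and> ?q n j j > 0}" for j
    using ap matrix_power_add_pos by (intro additive_set_cofinite) (auto simp: aperiodic_chain_def)
  then have "\<forall>j. \<exists>N. \<forall>n\<ge>N. ?q n j j > 0" by blast
  then obtain R where R: "\<And>j n. n \<ge> R j \<Longrightarrow> ?q n j j > 0" by metis
  obtain T where T: "\<And>j k. ?q (T j k) j k > 0" using irr unfolding irreducible_chain_def by metis
  define N where "N = (\<Sum>j\<in>UNIV. R j) + (\<Sum>j\<in>UNIV. \<Sum>k\<in>UNIV. T j k)"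
  show ?thesis
  proof (intro exI allI impI)
    fix n j k assume n: "N \<le> n"
    have "R j \<le> (\<Sum>j\<in>UNIV. R j)" by (rule member_le_sum) auto
    moreover have "T j k \<le> (\<Sum>k\<in>UNIV. T j k)" by (rule member_le_sum) auto
    moreover have "(\<Sum>k\<in>UNIV. T j k) \<le> (\<Sum>j\<in>UNIV. \<Sum>k\<in>UNIV. T j k)"
      by (rule member_le_sum[where f = "\<lambda>j. \<Sum>k\<in>UNIV. T j k"]) auto
    ultimately have "R j + T j k \<le> n" using n by (simp add: N_def)
    then have "?q (n - T j k) j j > 0" "n = (n - T j k) + T j k" by (auto intro!: R)
    then show "0 < ?q n j k" using matrix_power_add_pos T by metis
  qed
qed

lemma nstep_nonneg: "0 \<le> nstep p n y j k"
  using sk by (induction n arbitrary: y k)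
    (auto intro!: infsum_nonneg mult_nonneg_nonneg simp: stochastic_kernel_def split: prod.splits)

text \<open>
Transfers the loops of trivial arithmetic, which speaks of \<open>nstep\<close>, to the walk itself.
\<close>

lemma nstep_pos_imp_reach: "0 < nstep p n y j k \<Longrightarrow> 0 < reach n (0, j) (y, k)"
proof (induction n arbitrary: y k)
  case 0
  then show ?case by (auto simp: reach_def split: if_splits)
next
  case (Suc n)
  let ?f = "\<lambda>(z, i). nstep p n z j i * p (y - z) i k"
  have "\<exists>zi. ?f zi \<noteq> 0"
  proof (rule ccontr)
    assume "\<not> ?thesis"
    then have "infsum ?f UNIV = 0" by (intro infsum_0) auto
    then show False using Suc.prems by simp
  qed
  then obtain z i where zi: "nstep p n z j i \<noteq> 0" "p (y - z) i k \<noteq> 0" by auto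
  have "0 < reach n (0, j) (z, i)"
    using zi nstep_nonneg[of n z j i] by (intro Suc.IH) simp
  moreover have "0 < reach 1 (0, i) (y - z, k)"
  proof -
    have "0 < pmf (step (0, i)) (y - z, k) * of_bool ((y - z, k) = (y - z, k))"
      using zi(2) sk by (simp add: step_def pmf_jump_law stochastic_kernel_def less_le)
    also have "\<dots> \<le> reach 1 (0, i) (y - z, k)"
      unfolding reach_def by (simp del: of_bool_eq) (rule order_trans[OF _ avg_ge_point], auto intro: bdd_intros)
    finally show ?thesis .
  qed
  ultimately show ?case using reach_loop[of n "(0, j)" z i 1 "y - z" k] by simp
qed

end

text \<open>
For the decay of the return probabilities, a block consists of a path to the internal state \<open>j0\<close>,
followed by a loop that decides between the ends \<open>y\<close> and \<open>y'\<close> and a loop that decides between \<open>z\<close> and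
\<open>z'\<close>. The three end points used are those in which at most one of the two loops deviates from
\<open>y'\<close>, \<open>z'\<close>.
\<close>

lemma mixing_walk_jump_law:
  fixes p :: "(2, 'e::finite) jump_kernel"
  assumes sk: "stochastic_kernel p"
    and irr: "irreducible_chain (internal_matrix p)"
    and ap: "aperiodic_chain (internal_matrix p)"
    and sd: "stationary_distribution (internal_matrix p) \<mu>"
    and ta: "trivial_arithmetic p"
  shows "mixing_walk (jump_law p) (($) \<mu>)"
proof -
  interpret lattice_walk "jump_law p" .
  let ?Q = "internal_matrix p"
  obtain N where N: "\<And>n j k. n \<ge> N \<Longrightarrow> 0 < matrix_power ?Q n $ j $ k"
    using matrix_power_eventually_pos[OF sk irr ap] by blast
  have stat: "(\<Sum>j\<in>UNIV. \<mu> $ j * internal_avg f j) = (\<Sum>j\<in>UNIV. \<mu> $ j * f j)" for f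
  proof -
    have "(\<Sum>j\<in>UNIV. \<mu> $ j * internal_avg f j) = \<mu> \<bullet> (?Q *v (\<chi> k. f k))"
      by (simp add: inner_vec_def internal_avg_eq_matrix[OF sk])
    also have "\<dots> = (\<mu> v* ?Q) \<bullet> (\<chi> k. f k)" by (simp add: dot_lmul_matrix)
    also have "\<mu> v* ?Q = \<mu>" using sd by (simp add: stationary_distribution_def)
    finally show ?thesis by (simp add: inner_vec_def)
  qed
  have stat_pow: "(\<Sum>j\<in>UNIV. \<mu> $ j * (internal_avg ^^ n) f j) = (\<Sum>j\<in>UNIV. \<mu> $ j * f j)" for f n
    by (induction n) (auto simp: stat)
  have \<mu>1: "(\<Sum>j\<in>UNIV. \<mu> $ j) = 1" and \<mu>0: "\<And>j. 0 \<le> \<mu> $ j"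
    using sd by (auto simp: stationary_distribution_def)
  have \<mu>pos: "0 < \<mu> $ k" for k
  proof -
    have "\<exists>i. \<mu> $ i \<noteq> 0" using \<mu>1 by (metis sum.neutral zero_neq_one)
    then obtain i where i: "\<mu> $ i > 0" using \<mu>0 by (metis less_le)
    have "0 < \<mu> $ i * matrix_power ?Q N $ i $ k" using i N by simp
    also have "\<dots> \<le> (\<Sum>j\<in>UNIV. \<mu> $ j * matrix_power ?Q N $ j $ k)"
      by (rule member_le_sum[where f = "\<lambda>j. \<mu> $ j * matrix_power ?Q N $ j $ k"])
        (auto intro!: mult_nonneg_nonneg \<mu>0 matrix_power_nonneg[OF sk])
    also have "\<dots> = \<mu> $ k"
      unfolding matrix_power_eq_internal_avg[OF sk] stat_pow by (simp add: of_bool_def if_distrib cong: if_cong)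
    finally show ?thesis .
  qed
  show ?thesis
  proof
    show "0 < \<mu> $ j" for j by (rule \<mu>pos)
    show "(\<Sum>j\<in>UNIV. \<mu> $ j) = 1" by (rule \<mu>1)
    show "(\<Sum>j\<in>UNIV. \<mu> $ j * internal_avg f j) = (\<Sum>j\<in>UNIV. \<mu> $ j * f j)" for f by (rule stat)
    have "0 < (internal_avg ^^ N) (\<lambda>i. of_bool (i = k)) j" for j k
      using N[of N j k] by (simp add: matrix_power_eq_internal_avg[OF sk])
    then show "\<exists>m. \<forall>k\<ge>m. \<forall>f j. (\<forall>i. 0 \<le> f i) \<longrightarrow>
        (1 - \<delta>) * (\<Sum>i\<in>UNIV. \<mu> $ i * f i) \<le> (internal_avg ^^ k) f j \<and>
        (internal_avg ^^ k) f j \<le> (1 + \<delta>) * (\<Sum>i\<in>UNIV. \<mu> $ i * f i)" if "0 < \<delta>" for \<delta>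
      using \<mu>pos \<mu>1 stat that by (intro internal_avg_mixing) auto
    fix j0 :: 'e
    let ?D = "{y - y' | y y'. \<exists>n\<ge>1. nstep p n y j0 j0 > 0 \<and> nstep p n y' j0 j0 > 0}"
    have "group_closure ?D = UNIV" using ta by (simp add: trivial_arithmetic_def)
    from ex_independent_differences[OF this] obtain v w where vw: "v \<in> ?D" "w \<in> ?D"
      and indep: "\<And>s t s' t' :: nat. of_nat s *s v + of_nat t *s w = of_nat s' *s v + of_nat t' *s w \<Longrightarrow> s = s' \<and> t = t'"
      by blast
    from vw(1) obtain y y' n1 where y: "v = y - y'" "n1 \<ge> 1" "0 < reach n1 (0, j0) (y, j0)" "0 < reach n1 (0, j0) (y', j0)"
      using nstep_pos_imp_reach[OF sk] by blast
    from vw(2) obtain z z' n2 where z: "w = z - z'" "n2 \<ge> 1" "0 < reach n2 (0, j0) (z, j0)" "0 < reach n2 (0, j0) (z', j0)"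
      using nstep_pos_imp_reach[OF sk] by blast
    have "\<exists>x. 0 < reach N (0, j) (x, j0)" for j
    proof -
      have "0 < (avg ^^ N) (\<lambda>s. of_bool (snd s = j0)) (0, j)"
        using N[of N j j0] by (simp add: matrix_power_eq_internal_avg[OF sk] internal_avg_pow[where x = 0])
      then have "\<exists>t. 0 < reach N (0, j) t \<and> (0::real) < of_bool (snd t = j0)"
        by (intro ex_reach bdd_intros) auto
      then show ?thesis by (auto simp: of_bool_def split: if_splits)
    qed
    then obtain x where x: "\<And>j. 0 < reach N (0, j) (x j, j0)" by metis
    define B where "B = N + n1 + n2"
    define a where "a j = x j + y' + z'" for j
    have pts: "0 < reach B (0, j) (a j, j0)" "0 < reach B (0, j) (a j + v, j0)" "0 < reach B (0, j) (a j + w, j0)" for j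
    proof -
      show "0 < reach B (0, j) (a j, j0)"
        unfolding B_def a_def by (intro reach_loop[of _ _ _ j0] x y z)
      have "0 < reach B (0, j) (x j + y + z', j0)"
        unfolding B_def by (intro reach_loop[of _ _ _ j0] x y z)
      then show "0 < reach B (0, j) (a j + v, j0)" by (simp add: a_def y(1) algebra_simps)
      have "0 < reach B (0, j) (x j + y' + z, j0)"
        unfolding B_def by (intro reach_loop[of _ _ _ j0] x y z)
      then show "0 < reach B (0, j) (a j + w, j0)" by (simp add: a_def z(1) algebra_simps)
    qed
    define \<alpha> where "\<alpha> = Min (range (\<lambda>j. min (reach B (0, j) (a j, j0))
        (min (reach B (0, j) (a j + v, j0)) (reach B (0, j) (a j + w, j0)))))"
    have "0 < \<alpha>" unfolding \<alpha>_def using pts by (subst Min_gr_iff) auto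
    moreover have "\<alpha> \<le> min (reach B (0, j) (a j, j0))
        (min (reach B (0, j) (a j + v, j0)) (reach B (0, j) (a j + w, j0)))" for j
      unfolding \<alpha>_def by (rule Min_le) auto
    ultimately show "\<exists>C. \<forall>k j i. return_prob k j i \<le> C / (real k + 1)"
      using y(2) by (intro return_prob_bound[OF indep, where \<alpha> = \<alpha> and B = B and a = a and ?j0.0 = j0]) (auto simp: B_def)
  qed
qed

section \<open>The law of the path and the weak law\<close>

context internal_walk
begin

primrec path_weight :: "'v \<times> 'e \<Rightarrow> ('v \<times> 'e) list \<Rightarrow> real" where
  "path_weight s [] = 1"
| "path_weight s (t # l) = pmf (step s) t * path_weight t l"

lemma path_weight_snoc: "path_weight s (l @ [t]) = path_weight s l * pmf (step (last (s # l))) t"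
  by (induction l arbitrary: s) auto

lemma pmf_paths: "length l = n \<Longrightarrow> pmf (paths n s) (u # l) = of_bool (u = s) * path_weight s l"
proof (induction n arbitrary: s u l)
  case (Suc n)
  then obtain t l' where l: "l = t # l'" "length l' = n" by (cases l) auto
  show ?case
  proof (cases "u = s")
    case True
    have "pmf (paths (Suc n) s) (s # l) = pmf (bind_pmf (step s) (paths n)) l"
      by (simp add: pmf_map_inj')
    also have "\<dots> = measure_pmf.expectation (step s) (\<lambda>x. path_weight t l' * indicator {t} x)"
      unfolding pmf_bind l(1)
      by (intro Bochner_Integration.integral_cong) (auto simp: Suc.IH[OF l(2)] indicator_def)
    also have "\<dots> = path_weight s l" by (simp add: l(1) pmf.rep_eq)
    finally show ?thesis using True by simp
  next
    case False
    then have "u # l \<notin> set_pmf (paths (Suc n) s)" by auto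
    then show ?thesis using False by (simp add: set_pmf_iff del: paths.simps)
  qed
qed auto

lemma length_paths: "l \<in> set_pmf (paths n s) \<Longrightarrow> length l = Suc n"
  by (induction n arbitrary: l s) auto

end

lemma measurable_path:
  fixes \<xi> :: "nat \<Rightarrow> 'a \<Rightarrow> 's::countable"
  assumes meas: "\<And>i. \<xi> i \<in> M \<rightarrow>\<^sub>M count_space UNIV"
  shows "(\<lambda>\<omega>. map (\<lambda>i. \<xi> i \<omega>) [0..<n]) \<in> M \<rightarrow>\<^sub>M count_space UNIV"
proof (induction n)
  case (Suc n)
  have "(\<lambda>\<omega>. map (\<lambda>i. \<xi> i \<omega>) [0..<n] @ [\<xi> n \<omega>]) \<in> M \<rightarrow>\<^sub>M count_space UNIV"
  proof (rule measurable_compose_countable[OF _ Suc])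
    show "(\<lambda>\<omega>. l @ [\<xi> n \<omega>]) \<in> M \<rightarrow>\<^sub>M count_space UNIV" for l
      by (rule measurable_compose[OF meas]) simp
  qed
  then show ?case by simp
qed simp

text \<open>
The law of the first \<open>n + 1\<close> states is a mixture of the path laws over the law \<open>\<nu>\<close> of the initial
state. On a countable space it is determined by the probabilities of single paths, which the Markov
property computes from the end of the path, whereas \<open>paths\<close> grows at its beginning; \<open>path_weight_snoc\<close>
reconciles the two.
\<close>

lemma path_law:
  fixes p :: "('d::finite, 'e::finite) jump_kernel"
    and \<xi> :: "nat \<Rightarrow> 'a \<Rightarrow> (int ^ 'd) \<times> 'e"
  assumes ps: "prob_space M" and sk: "stochastic_kernel p" and rw: "rwwis M p \<xi>"
  shows "\<exists>\<nu>. \<forall>n. distr M (count_space UNIV) (\<lambda>\<omega>. map (\<lambda>i. \<xi> i \<omega>) [0..<Suc n])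
           = measure_pmf (bind_pmf \<nu> (internal_walk.paths (jump_law p) n))"
proof -
  interpret prob_space M by (rule ps)
  interpret lattice_walk "jump_law p" .
  have meas [measurable]: "\<xi> i \<in> M \<rightarrow>\<^sub>M count_space UNIV" for i using rw by (simp add: rwwis_def)
  let ?X = "\<lambda>n \<omega>. map (\<lambda>i. \<xi> i \<omega>) [0..<Suc n]"
  have X_eq: "{\<omega> \<in> space M. ?X n \<omega> = l} = {\<omega> \<in> space M. \<forall>i\<le>n. \<xi> i \<omega> = l ! i}" if "length l = Suc n" for l n
    using that by (auto simp: list_eq_iff_nth_eq less_Suc_eq_le simp del: upt_Suc)
  have all_meas: "{\<omega> \<in> space M. \<forall>i\<le>n. \<xi> i \<omega> = h i} \<in> sets M" for n h by measurable
  have X_meas: "?X n \<in> M \<rightarrow>\<^sub>M count_space UNIV" for n by (intro measurable_path meas)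
  define \<nu> where "\<nu> = embed_pmf (\<lambda>s. prob {\<omega> \<in> space M. \<xi> 0 \<omega> = s})"
  have \<nu>: "pmf \<nu> s = prob {\<omega> \<in> space M. \<xi> 0 \<omega> = s}" for s
    unfolding \<nu>_def
  proof (rule pmf_embed_pmf)
    have "(\<integral>\<^sup>+s. ennreal (prob {\<omega> \<in> space M. \<xi> 0 \<omega> = s}) \<partial>count_space UNIV)
        = (\<integral>\<^sup>+s. emeasure (distr M (count_space UNIV) (\<xi> 0)) {s} \<partial>count_space UNIV)"
      by (intro nn_integral_cong) (auto simp: emeasure_distr emeasure_eq_measure vimage_def Int_def conj_commute)
    also have "\<dots> = emeasure (distr M (count_space UNIV) (\<xi> 0)) UNIV"
      by (rule emeasure_countable_singleton[symmetric]) auto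
    also have "\<dots> = 1" by (simp add: emeasure_distr emeasure_space_1)
    finally show "(\<integral>\<^sup>+s. ennreal (prob {\<omega> \<in> space M. \<xi> 0 \<omega> = s}) \<partial>count_space UNIV) = 1" .
  qed auto
  have step_pmf: "pmf (step s) t = p (fst t - fst s) (snd s) (snd t)" for s t
  proof -
    have "pmf (step s) ((\<lambda>(y, k). (fst s + y, k)) (fst t - fst s, snd t)) = pmf (jump_law p (snd s)) (fst t - fst s, snd t)"
      unfolding step_def by (rule pmf_map_inj') (auto simp: inj_def)
    then show ?thesis by (simp add: pmf_jump_law[OF sk])
  qed
  have prob_path: "prob {\<omega> \<in> space M. \<forall>i\<le>n. \<xi> i \<omega> = (s # l) ! i} = pmf \<nu> s * path_weight s l"
    if "length l = n" for n s l
    using that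
  proof (induction n arbitrary: l)
    case 0
    then show ?case by (simp add: \<nu>)
  next
    case (Suc n)
    obtain l' t where l: "l = l' @ [t]" "length l' = n"
      using Suc.prems by (cases l rule: rev_cases) auto
    let ?h = "\<lambda>i. (s # l') ! i"
    let ?P = "prob {\<omega> \<in> space M. \<forall>i\<le>n. \<xi> i \<omega> = ?h i}"
    have nth: "(s # l) ! i = ?h i" if "i \<le> n" for i
      using that l by (cases i) (auto simp: nth_append)
    have nthS: "(s # l) ! Suc n = t" using l by (simp add: nth_append)
    have last: "?h n = last (s # l')" unfolding l(2)[symmetric] by (subst last_conv_nth) auto
    have ev: "{\<omega> \<in> space M. \<forall>i\<le>Suc n. \<xi> i \<omega> = (s # l) ! i}
        = {\<omega> \<in> space M. \<xi> (Suc n) \<omega> = t \<and> (\<forall>i\<le>n. \<xi> i \<omega> = ?h i)}"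
      unfolding le_Suc_eq using nth nthS by (intro Collect_cong) metis
    have "prob {\<omega> \<in> space M. \<xi> (Suc n) \<omega> = t \<and> (\<forall>i\<le>n. \<xi> i \<omega> = ?h i)} = ?P * pmf (step (last (s # l'))) t"
    proof (cases "?P > 0")
      case True
      have markov: "cond_prob M (\<lambda>\<omega>. \<xi> (Suc n) \<omega> = (x', k)) (\<lambda>\<omega>. \<forall>i\<le>n. \<xi> i \<omega> = h i) = p (x' - x) j k"
        if "h n = (x, j)" "prob {\<omega> \<in> space M. \<forall>i\<le>n. \<xi> i \<omega> = h i} > 0" for h x j x' k
        using rw that unfolding rwwis_def by blast
      have "cond_prob M (\<lambda>\<omega>. \<xi> (Suc n) \<omega> = (fst t, snd t)) (\<lambda>\<omega>. \<forall>i\<le>n. \<xi> i \<omega> = ?h i)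
          = p (fst t - fst (?h n)) (snd (?h n)) (snd t)"
        by (rule markov[OF _ True]) simp
      then show ?thesis using True unfolding cond_prob_def last[symmetric] step_pmf by (simp add: field_simps)
    next
      case False
      then have P0: "?P = 0" by (simp add: zero_less_measure_iff)
      have "prob {\<omega> \<in> space M. \<xi> (Suc n) \<omega> = t \<and> (\<forall>i\<le>n. \<xi> i \<omega> = ?h i)} \<le> ?P"
        by (intro finite_measure_mono all_meas) auto
      then have "prob {\<omega> \<in> space M. \<xi> (Suc n) \<omega> = t \<and> (\<forall>i\<le>n. \<xi> i \<omega> = ?h i)} = 0"
        unfolding P0 by (simp add: measure_le_0_iff)
      then show ?thesis unfolding P0 by simp
    qed
    then show ?case unfolding ev using Suc.IH[OF l(2)] by (simp add: l(1) path_weight_snoc)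
  qed
  have "distr M (count_space UNIV) (?X n) = measure_pmf (bind_pmf \<nu> (paths n))" for n
  proof (rule measure_eqI_countable_AE)
    let ?L = "{l :: ((int ^ 'd) \<times> 'e) list. length l = Suc n}"
    show "AE l in distr M (count_space UNIV) (?X n). l \<in> ?L"
      by (subst AE_distr_iff[OF X_meas]) (auto simp del: upt_Suc)
    show "AE l in measure_pmf (bind_pmf \<nu> (paths n)). l \<in> ?L"
      by (auto simp: AE_measure_pmf_iff length_paths)
    show "emeasure (distr M (count_space UNIV) (?X n)) {l} = emeasure (measure_pmf (bind_pmf \<nu> (paths n))) {l}"
      if "l \<in> ?L" for l
    proof -
      have len: "length l = Suc n" using that by simp
      then obtain s l' where l: "l = s # l'" "length l' = n" by (auto simp: length_Suc_conv)
      have "pmf (bind_pmf \<nu> (paths n)) l = measure_pmf.expectation \<nu> (\<lambda>u. path_weight s l' * indicator {s} u)"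
        unfolding pmf_bind l(1)
        by (intro Bochner_Integration.integral_cong) (auto simp: pmf_paths[OF l(2)] indicator_def)
      also have "\<dots> = pmf \<nu> s * path_weight s l'" by (simp add: pmf.rep_eq)
      also have "\<dots> = prob {\<omega> \<in> space M. ?X n \<omega> = l}"
        using prob_path[OF l(2), of s] X_eq[of l n] that by (simp add: l(1) del: upt_Suc)
      finally have "ennreal (pmf (bind_pmf \<nu> (paths n)) l) = emeasure M {\<omega> \<in> space M. ?X n \<omega> = l}"
        by (simp add: emeasure_eq_measure)
      then show ?thesis
        by (simp add: emeasure_distr[OF X_meas] emeasure_pmf_single vimage_def Int_def conj_commute del: upt_Suc)
    qed
  qed auto
  then show ?thesis by blast
qed

lemma path_moments:
  fixes p :: "('d::finite, 'e::finite) jump_kernel"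
    and \<xi> :: "nat \<Rightarrow> 'a \<Rightarrow> (int ^ 'd) \<times> 'e"
  assumes ps: "prob_space M" and sk: "stochastic_kernel p" and rw: "rwwis M p \<xi>"
    and a: "0 \<le> a" "\<And>s. a \<le> internal_walk.mean_range (jump_law p) n s"
    and b: "\<And>s. internal_walk.square_range (jump_law p) n s \<le> b"
  shows "integrable M (\<lambda>\<omega>. real (visited_sites \<xi> n \<omega>))"
    and "integrable M (\<lambda>\<omega>. (real (visited_sites \<xi> n \<omega>))\<^sup>2)"
    and "a \<le> expected_visited M \<xi> n"
    and "(\<integral>\<omega>. (real (visited_sites \<xi> n \<omega>))\<^sup>2 \<partial>M) \<le> b"
proof -
  interpret prob_space M by (rule ps)
  interpret lattice_walk "jump_law p" .
  let ?X = "\<lambda>\<omega>. map (\<lambda>i. \<xi> i \<omega>) [0..<Suc n]"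
  obtain \<nu> where \<nu>: "distr M (count_space UNIV) ?X = measure_pmf (bind_pmf \<nu> (paths n))"
    using path_law[OF ps sk rw] by blast
  have X_meas: "?X \<in> M \<rightarrow>\<^sub>M count_space UNIV"
    using rw by (intro measurable_path) (simp add: rwwis_def)
  have vs: "visited_sites \<xi> n \<omega> = site_count (?X \<omega>)" for \<omega>
    by (simp add: visited_sites_def site_count_def image_image atLeastLessThanSuc_atLeastAtMost del: upt_Suc)
  have nn: "(\<integral>\<^sup>+\<omega>. F (?X \<omega>) \<partial>M) = (\<integral>\<^sup>+s. \<integral>\<^sup>+l. F l \<partial>paths n s \<partial>\<nu>)" for F :: "_ \<Rightarrow> ennreal"
  proof -
    have "(\<integral>\<^sup>+\<omega>. F (?X \<omega>) \<partial>M) = (\<integral>\<^sup>+l. F l \<partial>distr M (count_space UNIV) ?X)"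
      by (subst nn_integral_distr[OF X_meas]) auto
    then show ?thesis unfolding \<nu> by (simp del: upt_Suc)
  qed
  have L_meas: "(\<lambda>\<omega>. f (visited_sites \<xi> n \<omega>)) \<in> borel_measurable M" for f :: "nat \<Rightarrow> real"
    unfolding vs by (rule measurable_compose[OF X_meas]) simp
  have L_le: "real (visited_sites \<xi> n \<omega>) \<le> real n + 1" for \<omega>
    using card_image_le[of "{0..n}" "\<lambda>i. fst (\<xi> i \<omega>)"] by (simp add: visited_sites_def)
  show i1: "integrable M (\<lambda>\<omega>. real (visited_sites \<xi> n \<omega>))"
    by (rule integrable_const_bound[where B = "real n + 1"]) (auto simp: L_le intro: L_meas)
  show i2: "integrable M (\<lambda>\<omega>. (real (visited_sites \<xi> n \<omega>))\<^sup>2)"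
    by (rule integrable_const_bound[where B = "(real n + 1)\<^sup>2"])
      (auto simp: L_le intro!: power_mono L_meas[of "\<lambda>k. (real k)\<^sup>2"])
  have "ennreal (expected_visited M \<xi> n) = (\<integral>\<^sup>+s. ennreal (mean_range n s) \<partial>\<nu>)"
    unfolding expected_visited_def using nn[of "\<lambda>l. ennreal (site_count l)"] i1
    by (simp add: nn_integral_eq_integral[symmetric] vs paths_site_count del: upt_Suc)
  also have "\<dots> \<ge> (\<integral>\<^sup>+s. ennreal a \<partial>\<nu>)" by (intro nn_integral_mono ennreal_leI a)
  finally have "ennreal a \<le> ennreal (expected_visited M \<xi> n)" by simp
  then show "a \<le> expected_visited M \<xi> n"
    by (rule ennreal_le_iff[THEN iffD1, rotated]) (simp add: expected_visited_def)
  have "ennreal (\<integral>\<omega>. (real (visited_sites \<xi> n \<omega>))\<^sup>2 \<partial>M)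
      = (\<integral>\<^sup>+s. \<integral>\<^sup>+l. ennreal ((real (site_count l))\<^sup>2) \<partial>paths n s \<partial>\<nu>)"
    using nn[of "\<lambda>l. ennreal ((real (site_count l))\<^sup>2)"] i2
    by (simp add: nn_integral_eq_integral[symmetric] vs del: upt_Suc)
  also have "\<dots> \<le> (\<integral>\<^sup>+s. ennreal b \<partial>\<nu>)"
    by (intro nn_integral_mono order_trans[OF paths_square_range] ennreal_leI b)
  finally have "ennreal (\<integral>\<omega>. (real (visited_sites \<xi> n \<omega>))\<^sup>2 \<partial>M) \<le> ennreal b" by simp
  moreover have "0 \<le> b" using b[of undefined] square_range_nonneg[of n undefined] by linarith
  ultimately show "(\<integral>\<omega>. (real (visited_sites \<xi> n \<omega>))\<^sup>2 \<partial>M) \<le> b" by simp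
qed

text \<open>
The variance is at most \<open>(1 + \<delta>) S\<^sup>2 - (1 - \<delta>)\<^sup>2 S\<^sup>2 \<le> 3 \<delta> S\<^sup>2\<close>, and the expectation is at least \<open>S / 2\<close>.
\<close>

lemma (in prob_space) relative_chebyshev:
  fixes L :: "'a \<Rightarrow> real"
  assumes L: "integrable M L" "integrable M (\<lambda>\<omega>. (L \<omega>)\<^sup>2)"
    and S: "0 < S" "(1 - \<delta>) * S \<le> expectation L" "expectation (\<lambda>\<omega>. (L \<omega>)\<^sup>2) \<le> (1 + \<delta>) * S\<^sup>2"
    and \<delta>: "0 < \<delta>" "\<delta> \<le> 1 / 2" and \<epsilon>: "0 < \<epsilon>"
  shows "prob {\<omega> \<in> space M. \<bar>L \<omega> - expectation L\<bar> > \<epsilon> * expectation L} \<le> 12 * \<delta> / \<epsilon>\<^sup>2"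
proof -
  let ?E = "expectation L"
  have [measurable]: "L \<in> borel_measurable M" using L(1) by simp
  have "1 / 2 * S \<le> (1 - \<delta>) * S" using \<delta> S by (intro mult_right_mono) auto
  then have E: "S / 2 \<le> ?E" using S by linarith
  then have E0: "0 < ?E" using S by linarith
  have "((1 - \<delta>) * S)\<^sup>2 = (1 - 2 * \<delta>) * S\<^sup>2 + (\<delta> * S)\<^sup>2" by (simp add: power2_eq_square algebra_simps)
  then have "(1 - 2 * \<delta>) * S\<^sup>2 \<le> ((1 - \<delta>) * S)\<^sup>2" by (simp only: le_add_same_cancel1 zero_le_power2)
  also have "\<dots> \<le> ?E\<^sup>2" using S \<delta> by (intro power_mono) auto
  finally have "variance L \<le> 3 * \<delta> * S\<^sup>2"
    using S(3) by (subst variance_eq[OF L]) (simp add: algebra_simps)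
  also have "3 * \<delta> * S\<^sup>2 \<le> 12 * \<delta> * ?E\<^sup>2"
  proof -
    have "(S / 2)\<^sup>2 \<le> ?E\<^sup>2" using E S by (intro power_mono) auto
    then have "\<delta> * (S / 2)\<^sup>2 \<le> \<delta> * ?E\<^sup>2" using \<delta> by (intro mult_left_mono) auto
    then show ?thesis by (simp add: power_divide)
  qed
  finally have var: "variance L \<le> 12 * \<delta> * ?E\<^sup>2" .
  have "prob {\<omega> \<in> space M. \<bar>L \<omega> - ?E\<bar> > \<epsilon> * ?E} \<le> prob {\<omega> \<in> space M. \<epsilon> * ?E \<le> \<bar>L \<omega> - ?E\<bar>}"
    by (intro finite_measure_mono) auto
  also have "\<dots> \<le> variance L / (\<epsilon> * ?E)\<^sup>2"
    using L \<epsilon> E0 by (intro Chebyshev_inequality) auto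
  also have "\<dots> \<le> 12 * \<delta> * ?E\<^sup>2 / (\<epsilon> * ?E)\<^sup>2" by (intro divide_right_mono var) simp
  also have "\<dots> = 12 * \<delta> / \<epsilon>\<^sup>2" using E0 by (simp add: power_mult_distrib)
  finally show ?thesis .
qed

theorem corollary3:
  fixes p :: "(2, 'e::finite) jump_kernel"
    and \<mu> :: "real ^ 'e"
    and M :: "'a measure"
    and \<xi> :: "nat \<Rightarrow> 'a \<Rightarrow> (int ^ 2) \<times> 'e"
  assumes "prob_space M"
    and "stochastic_kernel p"
    and "rwwis M p \<xi>"
    and "irreducible_chain (internal_matrix p)"
    and "aperiodic_chain (internal_matrix p)"
    and "stationary_distribution (internal_matrix p) \<mu>"
    and "trivial_arithmetic p"
    and "zero_mean p \<mu>"
    and "second_moments_converge p"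
    and "invertible (covariance p \<mu>)"
  shows "\<forall>\<epsilon>>0. (\<lambda>n. \<P>(\<omega> in M. \<bar>real (visited_sites \<xi> n \<omega>) - expected_visited M \<xi> n\<bar>
                               > \<epsilon> * expected_visited M \<xi> n)) \<longlonglongrightarrow> 0"
proof (intro allI impI)
  fix \<epsilon> :: real assume \<epsilon>: "0 < \<epsilon>"
  interpret prob_space M by fact
  interpret mixing_walk "jump_law p" "($) \<mu>"
    using assms by (intro mixing_walk_jump_law)
  let ?P = "\<lambda>n. \<P>(\<omega> in M. \<bar>real (visited_sites \<xi> n \<omega>) - expected_visited M \<xi> n\<bar> > \<epsilon> * expected_visited M \<xi> n)"
  show "?P \<longlonglongrightarrow> 0"
  proof (rule order_tendstoI)
    fix \<eta> :: real assume "0 < \<eta>"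
    define \<delta> where "\<delta> = min (1 / 2) (\<eta> * \<epsilon>\<^sup>2 / 24)"
    have \<delta>: "0 < \<delta>" "\<delta> \<le> 1 / 2" "12 * \<delta> / \<epsilon>\<^sup>2 < \<eta>"
    proof -
      show "0 < \<delta>" "\<delta> \<le> 1 / 2" using \<open>0 < \<eta>\<close> \<epsilon> by (auto simp: \<delta>_def)
      have "12 * \<delta> / \<epsilon>\<^sup>2 \<le> 12 * (\<eta> * \<epsilon>\<^sup>2 / 24) / \<epsilon>\<^sup>2"
        by (intro divide_right_mono mult_left_mono) (auto simp: \<delta>_def)
      also have "\<dots> = \<eta> / 2" using \<epsilon> by simp
      finally show "12 * \<delta> / \<epsilon>\<^sup>2 < \<eta>" using \<open>0 < \<eta>\<close> by simp
    qed
    have "eventually (\<lambda>n. \<forall>s. (1 - \<delta>) * escape_total n \<le> mean_range n s \<and> square_range n s \<le> (1 + \<delta>) * (escape_total n)\<^sup>2) sequentially"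
      using \<delta> by (intro range_moments) auto
    then show "eventually (\<lambda>n. ?P n < \<eta>) sequentially"
    proof eventually_elim
      case (elim n)
      have S: "0 < escape_total n" using escape_total_mono[of 0 n] by (simp add: escape_total_def)
      have a: "0 \<le> (1 - \<delta>) * escape_total n" using S \<delta> by simp
      note m = path_moments[OF assms(1-3) a, of n "(1 + \<delta>) * (escape_total n)\<^sup>2"]
      have "?P n \<le> 12 * \<delta> / \<epsilon>\<^sup>2"
        using relative_chebyshev[of "\<lambda>\<omega>. real (visited_sites \<xi> n \<omega>)" "escape_total n" \<delta> \<epsilon>] m elim S \<delta> \<epsilon>
        by (simp add: expected_visited_def)
      then show ?case using \<delta>(3) by linarith
    qed
  next
    fix a :: real assume "a < 0"
    then show "eventually (\<lambda>n. a < ?P n) sequentially"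
      by (intro always_eventually) (auto intro: less_le_trans)
  qed
qed

end
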